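(* Let $\mathcal{A}(1)$ be the family of all elliptic curves defined over number fields. For each $B \in \mathbb{Z}^+$, the set \[ \mathcal{S}(\mathcal{A}(1),B) = \{ d \in \mathbb{Z}^+ \mid \exists \text{ a number field } F \text{ with } [F:\mathbb{Q}]=d \text{ and an elliptic curve } E_{/F} \text{ with } \# E(F)[\mathrm{tors}] \geq B \} \] contains all but finitely many positive integers. Consequently torsion is not typically bounded on $\mathcal{A}(1)$, i.e. there is $\epsilon>0$ such that for no $B \in \mathbb{Z}^+$ does $\mathcal{S}(\mathcal{A}(1),B)$ have upper density at most $\epsilon$.
   Context: For $\mathcal{S} \subset \mathbb{Z}^+$, the upper density is $\overline{\delta}(\mathcal{S}) = \limsup_{x\to\infty} \#(\mathcal{S}\cap[1,x])/x$. Torsion is typically bounded on a family $\mathcal{F}$ of abelian varieties over number fields if for every $\epsilon>0$ there is $B_\epsilon$ such that the set of $d$ for which some $A_{/F}\in\mathcal{F}$ with $[F:\mathbb{Q}]=d$ has $\#A(F)[\mathrm{tors}]\ge B_\epsilon$ has upper density at most $\epsilon$. *)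

theory Defs
  imports Complex_Main "HOL-Library.Extended_Real" "HOL-Library.Liminf_Limsup"
begin

text \<open>Number fields are modelled as subfields of the complex numbers (every number
field embeds in C, and the torsion count of an elliptic curve does not depend on
the embedding).\<close>

definition is_subfield_C :: "complex set \<Rightarrow> bool" where
  "is_subfield_C F \<longleftrightarrow> 0 \<in> F \<and> 1 \<in> F \<and>
     (\<forall>x\<in>F. \<forall>y\<in>F. x + y \<in> F \<and> x * y \<in> F) \<and>
     (\<forall>x\<in>F. - x \<in> F \<and> inverse x \<in> F)"

definition has_Q_degree :: "complex set \<Rightarrow> nat \<Rightarrow> bool" where
  "has_Q_degree F d \<longleftrightarrow> (\<exists>b::nat \<Rightarrow> complex.
     (\<forall>i<d. b i \<in> F) \<and>
     (\<forall>x\<in>F. \<exists>q::nat \<Rightarrow> rat. x = (\<Sum>i<d. of_rat (q i) * b i)) \<and>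
     (\<forall>q::nat \<Rightarrow> rat. (\<Sum>i<d. of_rat (q i) * b i) = 0 \<longrightarrow> (\<forall>i<d. q i = 0)))"

definition number_field_of_degree :: "complex set \<Rightarrow> nat \<Rightarrow> bool" where
  "number_field_of_degree F d \<longleftrightarrow> is_subfield_C F \<and> has_Q_degree F d"

type_synonym wcoeffs = "complex \<times> complex \<times> complex \<times> complex \<times> complex"

definition wdisc :: "wcoeffs \<Rightarrow> complex" where
  "wdisc c = (case c of (a1,a2,a3,a4,a6) \<Rightarrow>
     let b2 = a1^2 + 4*a2; b4 = 2*a4 + a1*a3; b6 = a3^2 + 4*a6;
         b8 = a1^2*a6 + 4*a2*a6 - a1*a3*a4 + a2*a3^2 - a4^2
     in - (b2^2*b8) - 8*b4^3 - 27*b6^2 + 9*b2*b4*b6)"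

definition on_curve :: "wcoeffs \<Rightarrow> complex \<Rightarrow> complex \<Rightarrow> bool" where
  "on_curve c x y = (case c of (a1,a2,a3,a4,a6) \<Rightarrow>
     y^2 + a1*x*y + a3*y = x^3 + a2*x^2 + a4*x + a6)"

text \<open>Projective points: None is the point at infinity O.\<close>
type_synonym wpoint = "(complex \<times> complex) option"

text \<open>Chord-and-tangent group law (Silverman, Alg. III.2.3).\<close>
fun wadd :: "wcoeffs \<Rightarrow> wpoint \<Rightarrow> wpoint \<Rightarrow> wpoint" where
  "wadd c None P = P"
| "wadd c (Some p) None = Some p"
| "wadd c (Some (x1,y1)) (Some (x2,y2)) = (case c of (a1,a2,a3,a4,a6) \<Rightarrow>
     if x1 = x2 \<and> y1 + y2 + a1*x2 + a3 = 0 then None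
     else
       let l = (if x1 = x2 then (3*x1^2 + 2*a2*x1 + a4 - a1*y1) / (2*y1 + a1*x1 + a3)
                else (y2 - y1) / (x2 - x1));
           v = y1 - l*x1;
           x3 = l^2 + a1*l - a2 - x1 - x2;
           y3 = - (l + a1)*x3 - v - a3
       in Some (x3, y3))"

fun wmult :: "wcoeffs \<Rightarrow> nat \<Rightarrow> wpoint \<Rightarrow> wpoint" where
  "wmult c 0 P = None"
| "wmult c (Suc n) P = wadd c P (wmult c n P)"

definition rat_points :: "wcoeffs \<Rightarrow> complex set \<Rightarrow> wpoint set" where
  "rat_points c F = {None} \<union> {Some (x,y) | x y. x \<in> F \<and> y \<in> F \<and> on_curve c x y}"

definition torsion_points :: "wcoeffs \<Rightarrow> complex set \<Rightarrow> wpoint set" where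
  "torsion_points c F = {P \<in> rat_points c F. \<exists>n>0. wmult c n P = None}"

definition coeffs_in :: "wcoeffs \<Rightarrow> complex set \<Rightarrow> bool" where
  "coeffs_in c F = (case c of (a1,a2,a3,a4,a6) \<Rightarrow>
     a1 \<in> F \<and> a2 \<in> F \<and> a3 \<in> F \<and> a4 \<in> F \<and> a6 \<in> F)"

definition elliptic_over :: "wcoeffs \<Rightarrow> complex set \<Rightarrow> bool" where
  "elliptic_over c F \<longleftrightarrow> coeffs_in c F \<and> wdisc c \<noteq> 0"

definition S_A1 :: "nat \<Rightarrow> nat set" where
  "S_A1 B = {d. d > 0 \<and> (\<exists>F c. number_field_of_degree F d \<and> elliptic_over c F \<and>
                card (torsion_points c F) \<ge> B)}"

definition upper_density :: "nat set \<Rightarrow> ereal" where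
  "upper_density S = limsup (\<lambda>n::nat. ereal (real (card (S \<inter> {1..n})) / real n))"

end

theory Submission
  imports Defs "HOL-Computational_Algebra.Computational_Algebra" "HOL-Computational_Algebra.Field_as_Ring"
begin

text \<open>
  Near the cusp \<open>t = 0\<close> the curve \<open>y\<^sup>2 = x (x + 1) (x + 16 t\<^sup>M)\<close>, \<open>M = 2\<^sup>k\<close>, has a point of order \<open>2\<^sup>k\<^sup>+\<^sup>1\<close>
  whose abscissa \<open>\<eta>\<close> is a power series in \<open>t\<close>, obtained from \<open>(0, 0)\<close> by repeated halving; a
  quadratic twist makes the point itself rational over \<open>\<rat>(t, \<eta>)\<close>. This function field lies in
  \<open>\<rat>((t))\<close>, so \<open>t = 0\<close> gives it a rational place, and a Riemann-type dimension count provides, for all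
  large \<open>d\<close>, functions \<open>f\<close> and \<open>x\<close> with poles only at that place, of orders \<open>d\<close> and \<open>d + 1\<close>. They satisfy a
  relation \<open>H(f, x) = 0\<close> whose Newton polygon has the single edge from \<open>x\<^sup>d\<close> to \<open>f\<^sup>d\<^sup>+\<^sup>1\<close>; setting
  \<open>f = 2\<^sup>-\<^sup>r\<close> for suitable large \<open>r\<close> yields a polynomial that is Eisenstein at 2 after rescaling, hence a
  number field of degree exactly \<open>d\<close> to which the curve and its torsion points specialise. These
  fields are totally ramified at 2, and that valuation also shows the torsion to be finite: doubling
  makes a very negative \<open>v x\<close> more negative, so torsion points are bounded, and the difference of two
  torsion points that are very close is again such a point.
\<close>

section \<open>Evaluation of polynomials along ring homomorphisms\<close>

text \<open>\<open>card\<close> of an infinite set is 0, so many torsion points alone do not put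
  \<open>d\<close> into \<open>S_A1\<close>: finiteness of the torsion has to be proved over each
  field, and with it the group law, whose associativity is derived from the chord-and-tangent
  formulas. The pole orders d and d + 1 are chosen because d + 1 is 1 modulo d. Hence 1, x, ...,
  x^(d-1) have pole orders that differ modulo d and form a basis of the function field over Q(f),
  and in a relation of degree d only the terms with x^0 and x^d can share the largest order.
  Substituting 2^-r for f turns pole orders into 2-adic valuations, so the exact degree d comes from
  a Newton polygon and no irreducibility theorem of Hilbert type is involved. The exponent
  \<open>2\<^sup>k\<close> of t is explained by the halvings: each one takes square roots and so
  halves the order in t, and all k of them must stay inside power series in t. Specialisation is
  defined only on functions regular at the chosen point. It is applied to a finite list of functions
  together with their inverses, which preserves every nonvanishing condition.\<close>

locale comm_ring_map =
  fixes h :: "'a::comm_ring_1 \<Rightarrow> 'b::comm_ring_1"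
  assumes h_1 [simp]: "h 1 = 1" and h_add [simp]: "h (x + y) = h x + h y"
    and h_mult [simp]: "h (x * y) = h x * h y"
begin

lemma h_0 [simp]: "h 0 = 0"
  using h_add[of 0 0] by simp

lemma h_minus [simp]: "h (- x) = - h x"
  using h_add[of x "- x"] by (simp add: eq_neg_iff_add_eq_0 add.commute)

lemma h_diff [simp]: "h (x - y) = h x - h y"
  using h_add[of x "- y"] by simp

lemma h_sum: "h (sum f A) = (\<Sum>x\<in>A. h (f x))"
  by (induction A rule: infinite_finite_induct) auto

lemma map_poly_add: "map_poly h (P + Q) = map_poly h P + map_poly h Q"
  by (intro poly_eqI) (simp add: coeff_map_poly)

lemma map_poly_mult: "map_poly h (P * Q) = map_poly h P * map_poly h Q"
  by (intro poly_eqI) (simp add: coeff_map_poly coeff_mult h_sum)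

text \<open>One evaluation serves several coefficient maps: rationals into C (\<open>rc\<close>) and
  into Laurent series (\<open>fc\<close>), and Q[T] into Laurent series by T -> f
  (\<open>ff\<close>) or into C by T -> T0 (\<open>sp\<close>). The last two act on the same
  bivariate polynomials, which is how functions are compared with their specialisations.\<close>

definition ev :: "'a poly \<Rightarrow> 'b \<Rightarrow> 'b" where "ev P z = poly (map_poly h P) z"

lemma ev_0 [simp]: "ev 0 z = 0" and ev_1 [simp]: "ev 1 z = 1"
  by (auto simp: ev_def)

lemma ev_add [simp]: "ev (P + Q) z = ev P z + ev Q z"
  by (simp add: ev_def map_poly_add)

lemma ev_mult [simp]: "ev (P * Q) z = ev P z * ev Q z"
  by (simp add: ev_def map_poly_mult)

lemma ev_pCons [simp]: "ev (pCons q P) z = h q + z * ev P z"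
  by (simp add: ev_def map_poly_pCons)

lemma ev_const: "ev [:q:] z = h q"
  by simp

lemma ev_smult [simp]: "ev (smult q P) z = h q * ev P z"
  by (simp add: ev_def map_poly_smult)

lemma ev_minus [simp]: "ev (- P) z = - ev P z"
  using ev_smult[of "-1" P z] by (simp add: h_minus del: ev_smult)

lemma ev_diff [simp]: "ev (P - Q) z = ev P z - ev Q z"
  using ev_add[of P "- Q"] by simp

lemma ev_sum: "ev (sum f A) z = (\<Sum>x\<in>A. ev (f x) z)"
  by (induction A rule: infinite_finite_induct) auto

lemma ev_monom [simp]: "ev (monom q n) z = h q * z ^ n"
  by (simp add: ev_def map_poly_monom poly_monom)

lemma ev_altdef: assumes "degree P < n" shows "ev P z = (\<Sum>i<n. h (coeff P i) * z ^ i)"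
proof -
  have "P = (\<Sum>i<n. monom (coeff P i) i)"
    using assms by (intro poly_eqI) (auto simp: coeff_sum coeff_eq_0 not_less)
  then have "ev P z = ev (\<Sum>i<n. monom (coeff P i) i) z" by simp
  then show ?thesis by (simp add: ev_sum)
qed

end

section \<open>The 2-adic valuation on the rationals\<close>

definition v2 :: "rat \<Rightarrow> int" where
  "v2 q = int (multiplicity 2 (fst (quotient_of q))) - int (multiplicity 2 (snd (quotient_of q)))"

lemma v2_frac:
  assumes "a \<noteq> 0" "b \<noteq> 0"
  shows "v2 (of_int a / of_int b) = int (multiplicity 2 a) - int (multiplicity 2 b)"
proof -
  obtain n m where nm: "quotient_of (of_int a / of_int b) = (n, m)" by fastforce
  have m: "m > 0" and eq: "of_int a / of_int b = (of_int n / of_int m :: rat)"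
    using quotient_of_denom_pos[OF nm] quotient_of_div[OF nm] by auto
  then have n: "n \<noteq> 0" using assms by auto
  have "of_int (a * m) = (of_int (n * b) :: rat)" using eq m assms by (simp add: field_simps)
  then have "a * m = n * b" by linarith
  then have "multiplicity 2 (a * m) = multiplicity 2 (n * b)" by simp
  then have "multiplicity 2 a + multiplicity 2 m = multiplicity 2 n + multiplicity 2 b"
    using assms m n by (simp add: prime_elem_multiplicity_mult_distrib)
  then show ?thesis by (simp add: v2_def nm)
qed

lemma rat_frac:
  fixes q :: rat assumes "q \<noteq> 0"
  obtains a b where "a \<noteq> 0" "b \<noteq> 0" "q = of_int a / of_int b"
proof -
  obtain n m where nm: "quotient_of q = (n, m)" by fastforce
  then show ?thesis using that[of n m] quotient_of_denom_pos[OF nm] quotient_of_div[OF nm] assms by auto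
qed

lemma v2_mult: assumes "x \<noteq> 0" "y \<noteq> 0" shows "v2 (x * y) = v2 x + v2 y"
proof -
  obtain a b where 1: "a \<noteq> 0" "b \<noteq> 0" "x = of_int a / of_int b" using assms(1) by (rule rat_frac)
  obtain c d where 2: "c \<noteq> 0" "d \<noteq> 0" "y = of_int c / of_int d" using assms(2) by (rule rat_frac)
  have "x * y = of_int (a*c) / of_int (b*d)" using 1 2 by simp
  then show ?thesis using 1 2 v2_frac[of "a*c" "b*d"]
    by (simp add: v2_frac prime_elem_multiplicity_mult_distrib)
qed

lemma v2_1 [simp]: "v2 1 = 0"
  using v2_frac[of 1 1] by simp

lemma v2_2 [simp]: "v2 2 = 1"
  using v2_frac[of 2 1] by simp

lemma v2_minus [simp]: "v2 (- x) = v2 x"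
proof (cases "x = 0")
  case False
  have "v2 (- 1) = 0" using v2_frac[of "-1" 1] by simp
  then show ?thesis using v2_mult[of "-1" x] False by simp
qed simp

text \<open>The fractional ideal generated by 2^k over the integers localised at 2. Zero is listed
  separately because \<open>v2 0\<close> is the junk value 0.\<close>

definition vge :: "int \<Rightarrow> rat \<Rightarrow> bool" where
  "vge k q \<longleftrightarrow> q = 0 \<or> v2 q \<ge> k"

lemma vge_0 [simp]: "vge k 0" by (simp add: vge_def)
lemma vge_self [simp]: "vge (v2 q) q" by (simp add: vge_def)
lemma vge_minus [simp]: "vge k (- x) \<longleftrightarrow> vge k x" by (simp add: vge_def)
lemma vge_mono: "vge k x \<Longrightarrow> l \<le> k \<Longrightarrow> vge l x" by (auto simp: vge_def)
lemma vge_mult: "vge k x \<Longrightarrow> vge l y \<Longrightarrow> vge (k + l) (x * y)"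
  by (cases "x = 0"; cases "y = 0") (simp_all add: vge_def v2_mult)

lemma vge_multI: "vge k x \<Longrightarrow> vge l y \<Longrightarrow> m \<le> k + l \<Longrightarrow> vge m (x * y)"
  using vge_mult vge_mono by blast

lemma vge_0_frac: "odd b \<Longrightarrow> vge 0 (of_int a / of_int b)"
  by (cases "a = 0") (auto simp: vge_def v2_frac not_dvd_imp_multiplicity_0 intro: ccontr)

lemma vge_0_fracE:
  assumes "vge 0 q" obtains a b where "odd b" "q = of_int a / of_int b"
proof (cases "q = 0")
  case True
  then show ?thesis using that[of 1 0] by simp
next
  case False
  obtain n m where nm: "quotient_of q = (n, m)" by fastforce
  have m: "m > 0" and eq: "q = of_int n / of_int m" and co: "coprime n m"
    using quotient_of_denom_pos[OF nm] quotient_of_div[OF nm] quotient_of_coprime[OF nm] by auto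
  have n: "n \<noteq> 0" using eq False by auto
  have "odd m"
  proof
    assume "even m"
    then have "multiplicity 2 m > 0" "odd n" using m co
      by (auto simp: prime_multiplicity_gt_zero_iff)
    then show False using assms False eq m n
      by (simp add: vge_def v2_frac not_dvd_imp_multiplicity_0)
  qed
  then show ?thesis using that eq by blast
qed

lemma vge_0_add: assumes "vge 0 x" "vge 0 y" shows "vge 0 (x + y)"
proof -
  obtain a b where 1: "odd b" "x = of_int a / of_int b" using assms(1) by (rule vge_0_fracE)
  obtain c d where 2: "odd d" "y = of_int c / of_int d" using assms(2) by (rule vge_0_fracE)
  have "b \<noteq> 0" "d \<noteq> 0" using 1 2 by auto
  then have "x + y = of_int (a*d + c*b) / of_int (b*d)" using 1 2 by (simp add: field_simps)
  then show ?thesis using vge_0_frac[of "b*d" "a*d + c*b"] 1 2 by (simp only:) simp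
qed

lemma v2_powi [simp]: "v2 (2 powi k) = k"
proof -
  have n: "v2 (2 ^ n) = int n" for n by (induction n) (auto simp: v2_mult)
  have "v2 (1/2) = -1" using v2_frac[of 1 2] by simp
  then have "v2 ((1/2) ^ n) = - int n" for n
    by (induction n) (use v2_mult[of "1/2" "(1/2) ^ _"] in auto)
  then show ?thesis using n by (auto simp: power_int_def inverse_eq_divide)
qed

text \<open>Scaling reduces every bound to the case \<open>k = 0\<close>, where additivity is
  visible from fractions with odd denominators.\<close>

lemma vge_shift: "vge k x \<longleftrightarrow> vge 0 (2 powi (- k) * x)"
  by (cases "x = 0") (auto simp: vge_def v2_mult)

lemma vge_add: assumes "vge k x" "vge k y" shows "vge k (x + y)"
  using assms vge_0_add unfolding vge_shift[of k] by (simp add: distrib_left)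

lemma vge_diff: "vge k x \<Longrightarrow> vge k y \<Longrightarrow> vge k (x - y)"
  using vge_add[of k x "- y"] by simp

lemma vge_sum: "(\<And>i. i \<in> I \<Longrightarrow> vge k (f i)) \<Longrightarrow> vge k (sum f I)"
  by (induction I rule: infinite_finite_induct) (auto intro: vge_add)

lemma v2_add_eq:
  assumes "x \<noteq> 0" "vge (v2 x + 1) y" shows "x + y \<noteq> 0" "v2 (x + y) = v2 x"
proof -
  show nz: "x + y \<noteq> 0"
  proof
    assume "x + y = 0"
    then have "y = - x" by (simp add: add_eq_0_iff2)
    then show False using assms by (simp add: vge_def)
  qed
  have "vge (v2 x) (x + y)" using assms(2) by (intro vge_add) (auto elim: vge_mono)
  moreover have "\<not> vge (v2 x + 1) (x + y)"
  proof
    assume "vge (v2 x + 1) (x + y)"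
    from vge_diff[OF this assms(2)] assms(1) show False by (simp add: vge_def)
  qed
  ultimately show "v2 (x + y) = v2 x" using nz by (auto simp: vge_def)
qed

lemma vge_residue: assumes "vge 0 q" shows "vge 1 q \<or> vge 1 (q - 1)"
proof -
  obtain a b where 1: "odd b" "q = of_int a / of_int b" using assms by (rule vge_0_fracE)
  then have b: "b \<noteq> 0" by auto
  show ?thesis
  proof (cases "even a")
    case True
    then obtain c where "a = 2 * c" by (rule evenE)
    then have "q = 2 * (of_int c / of_int b)" using 1 by simp
    moreover have "vge 1 (2 * (of_int c / of_int b))"
      using 1 by (intro vge_multI[of 1 2 0] vge_0_frac) (auto simp: vge_def)
    ultimately show ?thesis by simp
  next
    case False
    then have "even (a - b)" using 1 by simp
    then obtain c where "a - b = 2 * c" by (rule evenE)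
    then have "of_int (a - b) = (of_int (2 * c) :: rat)" by simp
    then have "q - 1 = 2 * (of_int c / of_int b)" using 1 b by (simp add: field_simps)
    moreover have "vge 1 (2 * (of_int c / of_int b))"
      using 1 by (intro vge_multI[of 1 2 0] vge_0_frac) (auto simp: vge_def)
    ultimately show ?thesis by simp
  qed
qed

section \<open>Number fields of 2-Eisenstein polynomials\<close>

interpretation rc: comm_ring_map "of_rat :: rat \<Rightarrow> complex"
  by standard (auto simp: of_rat_add of_rat_mult)


locale eisenstein2 =
  fixes H :: "rat poly" and d :: nat and z :: complex
  assumes d_pos: "d > 0" and deg_H: "degree H = d" and monic_H: "coeff H d = 1"
    and vge_H: "\<And>i. i < d \<Longrightarrow> vge 1 (coeff H i)" and v2_H0: "coeff H 0 \<noteq> 0" "v2 (coeff H 0) = 1"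
    and root: "rc.ev H z = 0"
begin

lemma H_nz [simp]: "H \<noteq> 0"
  using v2_H0 by auto

text \<open>Newton polygon argument: with the weight \<open>d * v2 (coeff P i) + i\<close>, the minimal weights of
  the two factors add up to that of \<open>H\<close>, which forces both constant coefficients to have larger
  valuation than the leading ones.\<close>

definition wt :: "rat poly \<Rightarrow> nat \<Rightarrow> int" where
  "wt P i = int d * v2 (coeff P i) + int i"

text \<open>Ties are broken to the left, so that in a product of two polynomials exactly one term
  attains the least weight at the sum of the two indices.\<close>

lemma min_weight:
  assumes "P \<noteq> 0"
  obtains i where "coeff P i \<noteq> 0"
    "\<And>j. coeff P j \<noteq> 0 \<Longrightarrow> wt P i \<le> wt P j" "\<And>j. coeff P j \<noteq> 0 \<Longrightarrow> j < i \<Longrightarrow> wt P i < wt P j"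
proof -
  let ?S = "{i. coeff P i \<noteq> 0}"
  have fin: "finite ?S" by (rule finite_subset[of _ "{..degree P}"]) (auto intro: le_degree)
  have ne: "?S \<noteq> {}" using assms by (auto simp: poly_eq_iff)
  define m where "m = Min (wt P ` ?S)"
  define i where "i = (LEAST i. coeff P i \<noteq> 0 \<and> wt P i = m)"
  have "m \<in> wt P ` ?S" unfolding m_def using fin ne by (intro Min_in) auto
  then have "\<exists>i. coeff P i \<noteq> 0 \<and> wt P i = m" by auto
  then have i: "coeff P i \<noteq> 0 \<and> wt P i = m" unfolding i_def by (rule LeastI_ex)
  have le: "m \<le> wt P j" if "coeff P j \<noteq> 0" for j
    unfolding m_def using fin that by (intro Min_le) auto
  have "wt P i < wt P j" if "coeff P j \<noteq> 0" "j < i" for j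
    using le[OF that(1)] not_less_Least[of j "\<lambda>i. coeff P i \<noteq> 0 \<and> wt P i = m"] that i
    unfolding i_def by force
  then show ?thesis using that i le by blast
qed

lemma irreducible_H:
  assumes PQ: "P * Q = H" shows "degree P = 0 \<or> degree Q = 0"
proof (rule ccontr)
  assume "\<not> ?thesis"
  then have deg: "degree P > 0" "degree Q > 0" by auto
  then have nz: "P \<noteq> 0" "Q \<noteq> 0" by auto
  obtain i where i: "coeff P i \<noteq> 0" "\<And>j. coeff P j \<noteq> 0 \<Longrightarrow> wt P i \<le> wt P j"
    "\<And>j. coeff P j \<noteq> 0 \<Longrightarrow> j < i \<Longrightarrow> wt P i < wt P j" using min_weight[OF nz(1)] by metis
  obtain k where k: "coeff Q k \<noteq> 0" "\<And>j. coeff Q j \<noteq> 0 \<Longrightarrow> wt Q k \<le> wt Q j"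
    "\<And>j. coeff Q j \<noteq> 0 \<Longrightarrow> j < k \<Longrightarrow> wt Q k < wt Q j" using min_weight[OF nz(2)] by metis
  let ?c = "coeff P i * coeff Q k"
  have c: "?c \<noteq> 0" "v2 ?c = v2 (coeff P i) + v2 (coeff Q k)" using i k by (auto simp: v2_mult)
  have "coeff H (i + k) = (\<Sum>j\<le>i+k. coeff P j * coeff Q (i + k - j))"
    unfolding PQ[symmetric] by (rule coeff_mult)
  also have "\<dots> = ?c + (\<Sum>j\<in>{..i+k}-{i}. coeff P j * coeff Q (i + k - j))"
    by (subst sum.remove[of _ i]) auto
  finally have H: "coeff H (i + k) = ?c + (\<Sum>j\<in>{..i+k}-{i}. coeff P j * coeff Q (i + k - j))" .
  \<comment> \<open>Any other pair with the same index sum has one member to the left of its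
    minimum, where the weight is strictly larger. Equal index sums turn this into a strict
    inequality of valuations.\<close>
  have rest: "vge (v2 ?c + 1) (coeff P j * coeff Q (i + k - j))" if "j \<in> {..i+k}-{i}" for j
  proof (cases "coeff P j = 0 \<or> coeff Q (i + k - j) = 0")
    case False
    then have nz: "coeff P j \<noteq> 0" "coeff Q (i + k - j) \<noteq> 0" by auto
    have "wt P i + wt Q k < wt P j + wt Q (i + k - j)"
    proof (cases "j < i")
      case True
      then show ?thesis using i(3)[OF nz(1)] k(2)[OF nz(2)] by linarith
    next
      case False
      then have "i + k - j < k" using that by auto
      then show ?thesis using i(2)[OF nz(1)] k(3)[OF nz(2)] by linarith
    qed
    then have "int d * (v2 (coeff P i) + v2 (coeff Q k)) < int d * (v2 (coeff P j) + v2 (coeff Q (i + k - j)))"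
      using that by (auto simp: wt_def algebra_simps)
    then have "v2 (coeff P i) + v2 (coeff Q k) < v2 (coeff P j) + v2 (coeff Q (i + k - j))"
      using d_pos by simp
    then show ?thesis using nz c by (simp add: vge_def v2_mult)
  qed auto
  have "coeff H (i + k) \<noteq> 0" "v2 (coeff H (i + k)) = v2 ?c"
    unfolding H by (rule v2_add_eq[OF c(1) vge_sum[OF rest]]; assumption)+
  then have "wt P i + wt Q k = wt H (i + k)" "coeff H (i + k) \<noteq> 0"
    using c by (auto simp: wt_def algebra_simps)
  \<comment> \<open>The Eisenstein conditions say that no coefficient lies below weight
    \<open>d\<close>, the weight of the leading one.\<close>
  moreover have "wt H j \<ge> d" if "coeff H j \<noteq> 0" for j
  proof (cases "j < d")
    case True
    then have "v2 (coeff H j) \<ge> 1" using vge_H that by (auto simp: vge_def)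
    then have "int d * v2 (coeff H j) \<ge> int d * 1" by (intro mult_left_mono) auto
    then show ?thesis by (simp add: wt_def)
  next
    case False
    then have "j = d" using that deg_H le_degree le_antisym not_less by metis
    then show ?thesis by (simp add: wt_def monic_H)
  qed
  ultimately have ge: "wt P i + wt Q k \<ge> d" by metis
  have deg_sum: "degree P + degree Q = d"
    using degree_mult_eq[OF nz] PQ deg_H by simp
  have lc: "lead_coeff P * lead_coeff Q = 1"
    using lead_coeff_mult[of P Q] PQ deg_H monic_H by simp
  then have vl: "v2 (lead_coeff P) + v2 (lead_coeff Q) = 0"
    using v2_mult[of "lead_coeff P" "lead_coeff Q"] nz by simp
  have c0: "coeff P 0 * coeff Q 0 = coeff H 0" unfolding PQ[symmetric] by (simp add: coeff_mult)
  then have c0nz: "coeff P 0 \<noteq> 0" "coeff Q 0 \<noteq> 0" using v2_H0 by auto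
  have "wt P i \<le> wt P (degree P)" "wt Q k \<le> wt Q (degree Q)"
    using i(2) k(2) nz by auto
  moreover have "wt P (degree P) + wt Q (degree Q) = d"
  proof -
    have "wt P (degree P) + wt Q (degree Q) = int d * (v2 (lead_coeff P) + v2 (lead_coeff Q)) + int (degree P + degree Q)"
      by (simp add: wt_def algebra_simps)
    then show ?thesis using vl deg_sum by simp
  qed
  ultimately have "wt P i = wt P (degree P)" "wt Q k = wt Q (degree Q)" using ge by linarith+
  then have "wt P (degree P) \<le> wt P 0" "wt Q (degree Q) \<le> wt Q 0" using i(2) k(2) c0nz by metis+
  then have "int d * v2 (lead_coeff P) < int d * v2 (coeff P 0)" "int d * v2 (lead_coeff Q) < int d * v2 (coeff Q 0)"
    using deg by (auto simp: wt_def)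
  then have "v2 (lead_coeff P) < v2 (coeff P 0)" "v2 (lead_coeff Q) < v2 (coeff Q 0)"
    using d_pos by (simp_all add: mult_less_cancel_left_disj)
  \<comment> \<open>The leading valuations cancel, and each constant coefficient gains at least 1
    over its leading coefficient.\<close>
  then have "v2 (coeff P 0 * coeff Q 0) \<ge> 2" using vl c0nz by (simp add: v2_mult)
  then show False using c0 v2_H0 by simp
qed

section \<open>The number field Q(z)\<close>

lemma ev_zero_iff: "rc.ev P z = 0 \<longleftrightarrow> H dvd P"
proof
  assume P: "rc.ev P z = 0"
  define g where "g = gcd P H"
  have g: "rc.ev g z = 0"
  proof -
    obtain u w where "u * P + w * H = g"
      using bezout_coefficients_fst_snd[of P H] unfolding g_def by metis
    then have "rc.ev g z = rc.ev u z * rc.ev P z + rc.ev w z * rc.ev H z" by (metis rc.ev_add rc.ev_mult)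
    then show ?thesis using P root by simp
  qed
  have "g dvd H" by (simp add: g_def)
  then obtain k where k: "g * k = H" by (metis dvdE)
  have "degree g \<noteq> 0"
  proof
    assume "degree g = 0"
    then obtain c where "g = [:c:]" by (rule degree_eq_zeroE)
    then have "g = 0" using g by simp
    then show False using k by auto
  qed
  then have "degree k = 0" using irreducible_H[OF k] by auto
  then obtain c where c: "k = [:c:]" by (rule degree_eq_zeroE)
  then have "c \<noteq> 0" using k by auto
  then have "H dvd g" using k c by (metis dvd_smult_cancel dvd_refl mult.commute mult_pCons_left mult_zero_left pCons_0_0 add_0_right)
  then show "H dvd P" by (metis g_def dvd_trans gcd_dvd1)
next
  assume "H dvd P"
  then show "rc.ev P z = 0" using root by (auto elim!: dvdE)
qed

definition K :: "complex set" where "K = range (\<lambda>P. rc.ev P z)"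

lemma ev_mod: "rc.ev (P mod H) z = rc.ev P z"
proof -
  have "rc.ev P z = rc.ev (P div H * H + P mod H) z" by simp
  then show ?thesis unfolding rc.ev_add rc.ev_mult root by simp
qed

lemma K_closed: "x \<in> K \<Longrightarrow> y \<in> K \<Longrightarrow> x + y \<in> K" "x \<in> K \<Longrightarrow> y \<in> K \<Longrightarrow> x * y \<in> K"
    "x \<in> K \<Longrightarrow> - x \<in> K"
  unfolding K_def by (auto simp flip: rc.ev_add rc.ev_mult rc.ev_minus)

lemma of_rat_in_K: "of_rat q \<in> K"
  unfolding K_def using rc.ev_const[of q z] by (metis rangeI)

lemma z_in_K: "z \<in> K"
  unfolding K_def by (rule image_eqI[of _ _ "[:0, 1:]"]) auto

lemma K_inverse: assumes "x \<in> K" shows "inverse x \<in> K"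
proof (cases "x = 0")
  case True
  then show ?thesis using of_rat_in_K[of 0] by simp
next
  case False
  obtain P where P: "x = rc.ev P z" using assms by (auto simp: K_def)
  define g where "g = gcd P H"
  obtain k where k: "g * k = H" using gcd_dvd2[of P H] unfolding g_def by (metis dvdE)
  have "degree g = 0"
  proof (rule ccontr)
    assume "degree g \<noteq> 0"
    then have "degree k = 0" using irreducible_H[OF k] by auto
    then obtain c where c: "k = [:c:]" by (rule degree_eq_zeroE)
    then have "c \<noteq> 0" using k by auto
    have "H = smult c g" using k c by (simp add: mult.commute)
    then have "H dvd g" using \<open>c \<noteq> 0\<close> by (simp add: smult_dvd)
    then have "H dvd P" by (metis g_def dvd_trans gcd_dvd1)
    then show False using ev_zero_iff P False by simp
  qed
  then obtain c where c: "g = [:c:]" by (rule degree_eq_zeroE)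
  then have "c \<noteq> 0" using k by auto
  obtain u w where "u * P + w * H = g"
    using bezout_coefficients_fst_snd[of P H] unfolding g_def by metis
  then have "rc.ev u z * rc.ev P z + rc.ev w z * rc.ev H z = rc.ev g z" by (metis rc.ev_add rc.ev_mult)
  then have "rc.ev u z * x = of_rat c" using c root P by simp
  then have "x * rc.ev (smult (inverse c) u) z = inverse (of_rat c) * of_rat c"
    by (simp add: of_rat_inverse mult_ac del: inverse_eq_divide)
  then have "inverse x = rc.ev (smult (inverse c) u) z"
    using \<open>c \<noteq> 0\<close> by (intro inverse_unique) simp
  then show ?thesis unfolding K_def by (rule image_eqI) simp
qed

lemma number_field: "number_field_of_degree K d"
proof -
  have "is_subfield_C K"
    using K_closed K_inverse of_rat_in_K[of 0] of_rat_in_K[of 1] by (auto simp: is_subfield_C_def)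
  moreover have "has_Q_degree K d"
    unfolding has_Q_degree_def
  proof (intro exI[of _ "\<lambda>i. z ^ i"] conjI allI impI ballI)
    fix i show "z ^ i \<in> K" unfolding K_def by (rule image_eqI[of _ _ "monom 1 i"]) auto
  next
    fix x assume "x \<in> K"
    then obtain P where "x = rc.ev P z" by (auto simp: K_def)
    then have "x = rc.ev (P mod H) z" by (simp add: ev_mod)
    moreover have "degree (P mod H) < d" using degree_mod_less[of H P] deg_H d_pos by auto
    ultimately show "\<exists>q. x = (\<Sum>i<d. of_rat (q i) * z ^ i)" using rc.ev_altdef by metis
  next
    fix q :: "nat \<Rightarrow> rat" and i assume q: "(\<Sum>i<d. of_rat (q i) * z ^ i) = 0" and i: "i < d"
    define P where "P = (\<Sum>i<d. monom (q i) i)"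
    have cP: "coeff P j = (if j < d then q j else 0)" for j by (auto simp: P_def coeff_sum)
    have "rc.ev P z = 0" using q by (simp add: P_def rc.ev_sum)
    then have "H dvd P" by (simp add: ev_zero_iff)
    moreover have "degree P < d" using d_pos cP by (intro degree_lessI) auto
    ultimately have "P = 0" using deg_H dvd_imp_degree_le[of H P] by force
    then show "q i = 0" using cP[of i] i by simp
  qed
  ultimately show ?thesis by (simp add: number_field_of_degree_def)
qed

text \<open>\<open>Oa\<close> is the ring generated by \<open>z\<close> over the localisation of the integers at 2, and \<open>Ol\<close> its
  localisation at \<open>z\<close>. The residue field has two elements, so \<open>UU = 1 + z Ol\<close> is the whole unit group.\<close>

definition Oa :: "complex set" where "Oa = {rc.ev P z |P. \<forall>i. vge 0 (coeff P i)}"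

lemma Oa_I: "(\<And>i. vge 0 (coeff P i)) \<Longrightarrow> rc.ev P z \<in> Oa"
  by (auto simp: Oa_def)

lemma Oa_add: assumes "x \<in> Oa" "y \<in> Oa" shows "x + y \<in> Oa"
proof -
  obtain P Q where "x = rc.ev P z" "\<forall>i. vge 0 (coeff P i)" "y = rc.ev Q z" "\<forall>i. vge 0 (coeff Q i)"
    using assms by (auto simp: Oa_def)
  then show ?thesis using Oa_I[of "P + Q"] by (auto simp: vge_0_add)
qed

lemma Oa_mult: assumes "x \<in> Oa" "y \<in> Oa" shows "x * y \<in> Oa"
proof -
  obtain P Q where "x = rc.ev P z" "\<forall>i. vge 0 (coeff P i)" "y = rc.ev Q z" "\<forall>i. vge 0 (coeff Q i)"
    using assms by (auto simp: Oa_def)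
  moreover from this have "vge 0 (coeff (P * Q) i)" for i
    unfolding coeff_mult by (intro vge_sum vge_multI[of 0 _ 0]) auto
  ultimately show ?thesis using Oa_I[of "P * Q"] by auto
qed

lemma Oa_of_rat: "vge 0 q \<Longrightarrow> of_rat q \<in> Oa"
proof -
  assume "vge 0 q"
  then have "vge 0 (coeff [:q:] i)" for i by (cases i) auto
  then show ?thesis using Oa_I[of "[:q:]"] by simp
qed

lemma Oa_0: "0 \<in> Oa" and Oa_1: "1 \<in> Oa"
  using Oa_of_rat[of 0] Oa_of_rat[of 1] by (auto simp: vge_def)

lemma z_in_Oa: "z \<in> Oa"
proof -
  have "vge 0 (coeff [:0, 1:] i)" for i :: nat
    by (cases i; cases "i - 1") (auto simp: vge_def)
  then show ?thesis using Oa_I[of "[:0, 1:]"] by simp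
qed

lemma Oa_minus: "x \<in> Oa \<Longrightarrow> - x \<in> Oa"
  using Oa_mult[OF Oa_of_rat[of "-1"], of x] by (simp add: vge_def)

lemma Oa_diff: "x \<in> Oa \<Longrightarrow> y \<in> Oa \<Longrightarrow> x - y \<in> Oa"
  using Oa_add[of x "- y"] Oa_minus[of y] by simp

text \<open>If z P(z) = 1, then 1 - X P is H times some Q, and Q is 2-integral because H is monic.
  Comparing constant coefficients gives 1 = H(0) Q(0) with H(0) of valuation 1.\<close>

lemma one_notin_zOa: assumes "a \<in> Oa" shows "z * a \<noteq> 1"
proof
  assume za: "z * a = 1"
  obtain P where P: "a = rc.ev P z" "\<And>i. vge 0 (coeff P i)" using assms by (auto simp: Oa_def)
  define N where "N = 1 - pCons 0 P"
  have "rc.ev N z = 0" using za P by (simp add: N_def)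
  then obtain Q where Q: "N = H * Q" by (auto simp: ev_zero_iff elim: dvdE)
  have N: "vge 0 (coeff N i)" for i
    using P(2) by (auto simp: N_def coeff_1 coeff_pCons vge_def split: nat.splits) 
  have "vge 0 (coeff Q i)" for i
  proof (cases "i \<le> degree Q")
    case True
    \<comment> \<open>Recursion downwards from the top: as H is monic, each coefficient of Q is a
      coefficient of N minus an integral combination of higher coefficients of Q.\<close>
    have "vge 0 (coeff Q (degree Q - k))" if "k \<le> degree Q" for k
      using that
    proof (induction k rule: less_induct)
      case (less k)
      define i where "i = degree Q - k"
      have IH: "vge 0 (coeff Q i')" if "i < i'" for i'
        using less(1)[of "degree Q - i'"] less(2) that by (cases "i' \<le> degree Q") (auto simp: i_def coeff_eq_0)
      have "coeff N (d + i) = (\<Sum>j\<le>d+i. coeff H j * coeff Q (d + i - j))"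
        unfolding Q by (rule coeff_mult)
      also have "\<dots> = coeff H d * coeff Q i + (\<Sum>j\<in>{..d+i}-{d}. coeff H j * coeff Q (d + i - j))"
        by (subst sum.remove[of _ d]) auto
      finally have "coeff Q i = coeff N (d + i) - (\<Sum>j\<in>{..d+i}-{d}. coeff H j * coeff Q (d + i - j))"
        by (simp add: monic_H)
      moreover have "vge 0 (coeff H j * coeff Q (d + i - j))" if j: "j \<in> {..d+i}-{d}" for j
      proof (cases "j < d")
        case True
        have "vge 0 (coeff Q (d + i - j))"
          using IH True by simp
        then show ?thesis using vge_H[OF True] by (auto intro: vge_multI)
      next
        case False
        then have "coeff H j = 0" using j deg_H by (intro coeff_eq_0) auto
        then show ?thesis by simp
      qed
      ultimately show ?case using N unfolding i_def[symmetric] by (auto intro!: vge_diff vge_sum)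
    qed
    from this[of "degree Q - i"] True show ?thesis by simp
  qed (simp add: coeff_eq_0)
  moreover have "1 = coeff H 0 * coeff Q 0"
    using arg_cong[OF Q, of "\<lambda>p. coeff p 0"] by (simp add: N_def coeff_mult)
  ultimately have "vge 1 (1::rat)" using v2_H0 vge_multI[of 1 "coeff H 0" 0 "coeff Q 0" 1]
    by (simp add: vge_def)
  then show False by (simp add: vge_def)
qed

lemma z_nz: "z \<noteq> 0"
proof
  assume "z = 0"
  obtain c H' where H: "H = pCons c H'" by (cases H)
  have "of_rat c = (0 :: complex)" using root unfolding H \<open>z = 0\<close> by simp
  then show False using v2_H0 H by simp
qed

text \<open>H(z) = 0 writes the constant coefficient of H, which is 2 times a 2-adic unit, as a
  multiple of z.\<close>

lemma two_in_zOa: obtains a where "a \<in> Oa" "2 = z * a"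
proof -
  obtain c H' where H: "H = pCons c H'" by (cases H)
  have c: "c \<noteq> 0" "v2 c = 1" using v2_H0 H by auto
  have H': "vge 0 (coeff H' i)" for i
  proof -
    have "coeff H' i = coeff H (Suc i)" by (simp add: H)
    then show ?thesis
      using vge_H[of "Suc i"] monic_H deg_H coeff_eq_0[of H "Suc i"]
      by (cases "Suc i" d rule: linorder_cases) (auto intro: vge_mono simp: vge_def)
  qed
  have "of_rat c + z * rc.ev H' z = 0" using root by (simp add: H)
  then have cH: "z * rc.ev H' z = - of_rat c" by (simp add: eq_neg_iff_add_eq_0 add.commute)
  have "z * (of_rat (- (2 / c)) * rc.ev H' z) = of_rat (- (2 / c)) * (z * rc.ev H' z)"
    by (simp only: mult_ac)
  also have "\<dots> = of_rat (2 / c * c)" unfolding cH of_rat_mult of_rat_minus by simp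
  also have "\<dots> = 2" using c by simp
  finally have "2 = z * (of_rat (- (2 / c)) * rc.ev H' z)" ..
  moreover have "vge 0 (- (2 / c))"
    using v2_mult[of "2 / c" c] c by (simp add: vge_def)
  ultimately show ?thesis using that Oa_mult[OF Oa_of_rat Oa_I] H' by blast
qed

lemma vge_1_in_zOa: assumes "vge 1 q" obtains a where "a \<in> Oa" "of_rat q = z * a"
proof -
  obtain a where a: "a \<in> Oa" "2 = z * a" by (rule two_in_zOa)
  have "vge 0 (q * (1/2))"
    by (rule vge_multI[OF assms, of "-1"]) (use v2_frac[of 1 2] in \<open>auto simp: vge_def\<close>)
  then have "of_rat (q/2) * a \<in> Oa" using a by (auto intro!: Oa_mult Oa_of_rat)
  moreover have "of_rat q = z * (of_rat (q/2) * a)" 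
  proof -
    have "z * (of_rat (q/2) * a) = of_rat (q/2) * (z * a)" by (simp only: mult_ac)
    also have "\<dots> = of_rat (q/2 * 2)" unfolding a(2)[symmetric] of_rat_mult by simp
    finally show ?thesis by simp
  qed
  ultimately show ?thesis using that by blast
qed

lemma Oa_residue: assumes "x \<in> Oa" obtains a where "a \<in> Oa" "x = z * a \<or> x = 1 + z * a"
proof -
  obtain P where P: "x = rc.ev P z" "\<And>i. vge 0 (coeff P i)" using assms by (auto simp: Oa_def)
  obtain c P' where c: "P = pCons c P'" by (cases P)
  have P': "rc.ev P' z \<in> Oa" using P(2)[of "Suc _"] unfolding c by (intro Oa_I) auto
  have x: "x = of_rat c + z * rc.ev P' z" by (simp add: P c)
  consider "vge 1 c" | "vge 1 (c - 1)" using vge_residue[of c] P(2)[of 0] c by auto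
  then show ?thesis
  proof cases
    case 1
    then obtain a where "a \<in> Oa" "of_rat c = z * a" using vge_1_in_zOa by metis
    then show ?thesis using that[of "a + rc.ev P' z"] Oa_add[OF _ P'] x by (simp add: distrib_left)
  next
    case 2
    then obtain a where "a \<in> Oa" "of_rat (c - 1) = z * a" using vge_1_in_zOa by metis
    then have "of_rat c = 1 + z * a" by (simp add: of_rat_diff algebra_simps)
    then show ?thesis using that[of "a + rc.ev P' z"] Oa_add[OF \<open>a \<in> Oa\<close> P'] x by (simp add: distrib_left)
  qed
qed

definition U0 :: "complex set" where "U0 = {1 + z * a |a. a \<in> Oa}"

lemma U0_sub: "U0 \<subseteq> Oa" unfolding U0_def by (auto intro!: Oa_add Oa_1 Oa_mult z_in_Oa)

lemma U0_nz: assumes "b \<in> U0" shows "b \<noteq> 0"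
proof
  assume "b = 0"
  then obtain a where "a \<in> Oa" "1 + z * a = 0" using assms by (auto simp: U0_def)
  then have "z * a = - 1" by (simp add: eq_neg_iff_add_eq_0 add.commute)
  then have "z * (- a) = 1" by simp
  then show False using one_notin_zOa Oa_minus \<open>a \<in> Oa\<close> by blast
qed

lemma U0_mult: assumes "b \<in> U0" "c \<in> U0" shows "b * c \<in> U0"
proof -
  obtain x y where "x \<in> Oa" "y \<in> Oa" "b = 1 + z * x" "c = 1 + z * y" using assms by (auto simp: U0_def)
  moreover from this have "b * c = 1 + z * (x + y + z * (x * y))" by (simp add: algebra_simps)
  moreover from calculation have "x + y + z * (x * y) \<in> Oa" by (intro Oa_add Oa_mult z_in_Oa)
  ultimately show ?thesis unfolding U0_def by blast
qed

lemma one_U0: "1 \<in> U0" unfolding U0_def using Oa_0 by (auto intro!: exI[of _ 0])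

lemma U0_plus: assumes "b \<in> U0" "a \<in> Oa" shows "b + z * a \<in> U0"
proof -
  obtain x where "x \<in> Oa" "b = 1 + z * x" using assms by (auto simp: U0_def)
  then have "b + z * a = 1 + z * (x + a)" "x + a \<in> Oa"
    using assms(2) by (auto intro: Oa_add simp: distrib_left)
  then show ?thesis unfolding U0_def by blast
qed

definition Ol :: "complex set" where "Ol = {a / b |a b. a \<in> Oa \<and> b \<in> U0}"

lemma Oa_sub_Ol: "Oa \<subseteq> Ol"
proof
  fix x assume "x \<in> Oa"
  then have "x = x / 1 \<and> x \<in> Oa \<and> 1 \<in> U0" using one_U0 by simp
  then show "x \<in> Ol" unfolding Ol_def by blast
qed

lemma Ol_add: assumes "x \<in> Ol" "y \<in> Ol" shows "x + y \<in> Ol"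
proof -
  obtain a b c d where 1: "x = a / b" "y = c / d" "a \<in> Oa" "b \<in> U0" "c \<in> Oa" "d \<in> U0"
    using assms by (auto simp: Ol_def)
  then have "x + y = (a*d + c*b) / (b*d)" using U0_nz by (simp add: field_simps)
  moreover have "a*d + c*b \<in> Oa" "b*d \<in> U0"
    using 1 subsetD[OF U0_sub] by (auto intro!: U0_mult Oa_add Oa_mult)
  ultimately show ?thesis unfolding Ol_def by blast
qed

lemma Ol_mult: assumes "x \<in> Ol" "y \<in> Ol" shows "x * y \<in> Ol"
proof -
  obtain a b c d where 1: "x = a / b" "y = c / d" "a \<in> Oa" "b \<in> U0" "c \<in> Oa" "d \<in> U0"
    using assms by (auto simp: Ol_def)
  then have "x * y = (a*c) / (b*d)" by simp
  then show ?thesis using 1 U0_mult Oa_mult unfolding Ol_def by blast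
qed

lemma Ol_0: "0 \<in> Ol" and Ol_1: "1 \<in> Ol" and z_in_Ol: "z \<in> Ol"
  using Oa_sub_Ol Oa_0 Oa_1 z_in_Oa by auto

lemma Ol_minus: "x \<in> Ol \<Longrightarrow> - x \<in> Ol"
  using Ol_mult[of "- 1" x] Oa_minus[OF Oa_1] Oa_sub_Ol by auto

lemma Ol_sum: "(\<And>i. i \<in> I \<Longrightarrow> f i \<in> Ol) \<Longrightarrow> sum f I \<in> Ol"
  by (induction I rule: infinite_finite_induct) (auto intro: Ol_add Ol_0)

lemma Ol_residue: assumes "x \<in> Ol" obtains a where "a \<in> Ol" "x = z * a \<or> x = 1 + z * a"
proof -
  obtain a b where 1: "x = a / b" "a \<in> Oa" "b \<in> U0" using assms by (auto simp: Ol_def)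
  have nz: "b \<noteq> 0" using 1 U0_nz by auto
  obtain b' where b': "b' \<in> Oa" "b = 1 + z * b'" using 1 by (auto simp: U0_def)
  obtain a' where a': "a' \<in> Oa" "a = z * a' \<or> a = 1 + z * a'" using Oa_residue 1 by metis
  show ?thesis
  proof (cases "a = z * a'")
    case True
    then have "x = z * (a' / b)" using 1 by simp
    moreover have "a' / b \<in> Ol" using 1 a' unfolding Ol_def by blast
    ultimately show ?thesis using that by blast
  next
    case False
    then have "a = b + z * (a' - b')" using a' b' by (simp add: algebra_simps)
    then have "x = 1 + z * ((a' - b') / b)" using nz 1 by (simp add: field_simps)
    moreover have "(a' - b') / b \<in> Ol" using 1 a' b' Oa_diff unfolding Ol_def by blast
    ultimately show ?thesis using that by blast
  qed
qed

lemma one_notin_zOl: assumes "x \<in> Ol" shows "z * x \<noteq> 1"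
proof
  assume zx: "z * x = 1"
  obtain a b where 1: "x = a / b" "a \<in> Oa" "b \<in> U0" using assms by (auto simp: Ol_def)
  obtain b' where b': "b' \<in> Oa" "b = 1 + z * b'" using 1 by (auto simp: U0_def)
  have "z * a = b" using zx 1 U0_nz by (auto simp: field_simps)
  then have "z * (a - b') = 1" using b' by (simp add: algebra_simps)
  then show False using one_notin_zOa Oa_diff 1 b' by blast
qed

definition UU :: "complex set" where "UU = {1 + z * a |a. a \<in> Ol}"

lemma UU_nz: assumes "b \<in> UU" shows "b \<noteq> 0"
proof
  assume "b = 0"
  then obtain a where "a \<in> Ol" "1 + z * a = 0" using assms by (auto simp: UU_def)
  then have "z * a = - 1" by (simp add: eq_neg_iff_add_eq_0 add.commute)
  then have "z * (- a) = 1" by simp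
  then show False using one_notin_zOl Ol_minus \<open>a \<in> Ol\<close> by blast
qed

lemma UU_mult: assumes "b \<in> UU" "c \<in> UU" shows "b * c \<in> UU"
proof -
  obtain x y where "x \<in> Ol" "y \<in> Ol" "b = 1 + z * x" "c = 1 + z * y" using assms by (auto simp: UU_def)
  moreover from this have "b * c = 1 + z * (x + y + z * (x * y))" by (simp add: algebra_simps)
  moreover from calculation have "x + y + z * (x * y) \<in> Ol" by (intro Ol_add Ol_mult z_in_Ol)
  ultimately show ?thesis unfolding UU_def by blast
qed

lemma one_UU: "1 \<in> UU" unfolding UU_def using Ol_0 by (auto intro!: exI[of _ 0])

lemma UU_sub: "UU \<subseteq> Ol" unfolding UU_def by (auto intro!: Ol_add Ol_1 Ol_mult z_in_Ol)

lemma UU_plus: assumes "b \<in> UU" "a \<in> Ol" shows "b + z * a \<in> UU"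
proof -
  obtain x where "x \<in> Ol" "b = 1 + z * x" using assms by (auto simp: UU_def)
  then have "b + z * a = 1 + z * (x + a)" "x + a \<in> Ol"
    using assms(2) by (auto intro: Ol_add simp: distrib_left)
  then show ?thesis unfolding UU_def by blast
qed

lemma UU_inverse: assumes "u \<in> UU" shows "inverse u \<in> UU"
proof -
  obtain x where x: "x \<in> Ol" "u = 1 + z * x" using assms by (auto simp: UU_def)
  obtain a b where 1: "x = a / b" "a \<in> Oa" "b \<in> U0" using x by (auto simp: Ol_def)
  have nz: "b \<noteq> 0" "b + z * a \<noteq> 0" using 1 U0_nz U0_plus by auto
  have "u = (b + z * a) / b" using x 1 nz by (simp add: field_simps)
  then have "inverse u = b / (b + z * a)" by simp
  also have "\<dots> = 1 + z * (- a / (b + z * a))" using nz by (simp add: field_simps)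
  finally have "inverse u = 1 + z * (- a / (b + z * a))" .
  moreover have "- a / (b + z * a) \<in> Ol" using 1 U0_plus Oa_minus unfolding Ol_def by blast
  ultimately show ?thesis unfolding UU_def by blast
qed

lemma vge_1_UU: assumes "vge 1 (q - 1)" shows "of_rat q \<in> UU"
proof -
  obtain a where "a \<in> Oa" "of_rat (q - 1) = z * a" using vge_1_in_zOa assms by metis
  then have "of_rat q = 1 + z * a" "a \<in> Ol" using Oa_sub_Ol by (auto simp: of_rat_diff algebra_simps)
  then show ?thesis unfolding UU_def by blast
qed

text \<open>Total ramification of 2: the terms of H below X^d are, by the Eisenstein conditions,
  twice a polynomial that is 2-integral with a unit as constant coefficient, so z^d is 2 times a
  unit.\<close>

lemma two_eq: obtains u where "u \<in> UU" "2 = z powi d * u"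
proof -
  obtain y where y: "y \<in> UU" "z ^ d = 2 * y"
  proof -
    define Y where "Y = (\<Sum>i<d. monom (- coeff H i / 2) i)"
    have cY: "coeff Y i = (if i < d then - coeff H i / 2 else 0)" for i by (auto simp: Y_def coeff_sum)
    have half: "vge (-1) (1/2)" "v2 (1/2) = -1" using v2_frac[of 1 2] by (auto simp: vge_def)
    obtain c Y' where Y': "Y = pCons c Y'" by (cases Y)
    have c: "c = - coeff H 0 / 2" using cY[of 0] d_pos by (simp add: Y')
    have vY: "vge 0 (coeff Y i)" for i
      using vge_multI[of 1 "- coeff H i" "-1" "1/2" 0] vge_H[of i] half by (auto simp: cY)
    have "v2 c = 0" "c \<noteq> 0" using v2_mult[of "- coeff H 0" "1/2"] v2_H0 half by (auto simp: c)
    then have "vge 1 (c - 1)" using vge_residue[of c] vY[of 0] Y' by (auto simp: vge_def)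
    moreover have "rc.ev Y' z \<in> Oa" using vY[of "Suc _"] unfolding Y' by (intro Oa_I) auto
    ultimately have "rc.ev Y z \<in> UU" unfolding Y' using vge_1_UU UU_plus Oa_sub_Ol by auto
    moreover have "H = monom 1 d - smult 2 Y"
      using deg_H monic_H by (intro poly_eqI) (auto simp: cY coeff_eq_0)
    then have "z ^ d = 2 * rc.ev Y z"
      using root by (simp add: of_rat_numeral_eq)
    ultimately show ?thesis using that by blast
  qed
  show ?thesis
    by (rule that[OF UU_inverse[OF y(1)]]) (use y UU_nz in \<open>simp add: field_simps\<close>)
qed

lemma UU_powi: "u \<in> UU \<Longrightarrow> u powi k \<in> UU"
proof -
  assume u: "u \<in> UU"
  have n: "v ^ n \<in> UU" if "v \<in> UU" for v n using that by (induction n) (auto intro: one_UU UU_mult)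
  show ?thesis unfolding power_int_def using n[OF u] n[OF UU_inverse[OF u]] by auto
qed

lemma of_rat_decomp: assumes "q \<noteq> 0" obtains u where "u \<in> UU" "of_rat q = z powi (int d * v2 q) * u"
proof -
  obtain e where e: "e \<in> UU" "2 = z powi d * e" by (rule two_eq)
  define q' where "q' = q * 2 powi (- v2 q)"
  have "v2 q' = 0" "q' \<noteq> 0" using assms by (auto simp: q'_def v2_mult)
  then have "vge 1 (q' - 1)" using vge_residue[of q'] by (auto simp: vge_def)
  then have q': "of_rat q' \<in> UU" by (rule vge_1_UU)
  have "q = 2 powi (v2 q) * q'" by (simp add: q'_def power_int_minus)
  then have "of_rat q = of_rat (2 powi v2 q) * of_rat q'" by (metis of_rat_mult)
  also have "of_rat (2 powi v2 q) = (2::complex) powi v2 q"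
    by (simp add: power_int_def of_rat_power of_rat_inverse of_rat_divide)
  also have "\<dots> = z powi (int d * v2 q) * e powi (v2 q)"
    by (subst e(2)) (simp add: power_int_mult_distrib power_int_mult)
  finally have "of_rat q = z powi (int d * v2 q) * (e powi v2 q * of_rat q')" by simp
  then show ?thesis using that UU_mult UU_powi e q' by blast
qed

lemma z_powi_in_zOl: assumes "k > 0" "u \<in> Ol" obtains a where "a \<in> Ol" "z powi k * u = z * a"
proof -
  define n where "n = nat (k - 1)"
  have "k = int (Suc n)" using assms by (simp add: n_def)
  moreover have "z ^ n \<in> Ol" by (induction n) (auto intro: Ol_1 Ol_mult z_in_Ol)
  ultimately show ?thesis using that[of "z ^ n * u"] assms(2) Ol_mult by (simp add: power_int_of_nat[of z "Suc n", simplified] del: of_nat_Suc)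
qed

text \<open>The terms of P(z) have valuations \<open>wt P j\<close>. These are congruent to j modulo
  d, hence pairwise distinct for j < d, and the least one dominates the sum.\<close>

lemma K_decomp: assumes "x \<in> K" "x \<noteq> 0" obtains k u where "u \<in> UU" "x = z powi k * u"
proof -
  obtain P where P: "x = rc.ev P z" "degree P < d"
  proof -
    obtain P where "x = rc.ev P z" using assms by (auto simp: K_def)
    then have "x = rc.ev (P mod H) z" by (simp add: ev_mod)
    moreover have "degree (P mod H) < d" using degree_mod_less[of H P] deg_H d_pos by auto
    ultimately show ?thesis using that by blast
  qed
  then have "P \<noteq> 0" using assms by auto
  then obtain i where i: "coeff P i \<noteq> 0" "\<And>j. coeff P j \<noteq> 0 \<Longrightarrow> wt P i \<le> wt P j"
    using min_weight by metis
  have id: "i < d" using P(2) i(1) le_degree by fastforce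
  have "\<forall>j. coeff P j \<noteq> 0 \<longrightarrow> (\<exists>u. u \<in> UU \<and> of_rat (coeff P j) * z ^ j = z powi (wt P j) * u)"
  proof (intro allI impI)
    fix j assume "coeff P j \<noteq> 0"
    then obtain u where "u \<in> UU" "of_rat (coeff P j) = z powi (int d * v2 (coeff P j)) * u"
      by (rule of_rat_decomp)
    then show "\<exists>u. u \<in> UU \<and> of_rat (coeff P j) * z ^ j = z powi (wt P j) * u"
      using z_nz by (intro exI[of _ u]) (simp add: wt_def power_int_add)
  qed
  then obtain u where u: "\<And>j. coeff P j \<noteq> 0 \<Longrightarrow> u j \<in> UU"
    "\<And>j. coeff P j \<noteq> 0 \<Longrightarrow> of_rat (coeff P j) * z ^ j = z powi (wt P j) * u j" by metis
  have "\<exists>a. a \<in> Ol \<and> of_rat (coeff P j) * z ^ j = z powi (wt P i) * (z * a)" if "j < d" "j \<noteq> i" for j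
  proof (cases "coeff P j = 0")
    case True
    then show ?thesis using Ol_0 by auto
  next
    case False
    have "wt P j \<noteq> wt P i"
    proof
      assume "wt P j = wt P i"
      then have "int j mod int d = int i mod int d" unfolding wt_def by (metis mod_mult_self4)
      then show False using that id by simp
    qed
    then have "wt P j - wt P i > 0" using i(2)[OF False] by simp
    then obtain a where "a \<in> Ol" "z powi (wt P j - wt P i) * u j = z * a"
      using z_powi_in_zOl u(1)[OF False] UU_sub by blast
    moreover have "z powi wt P j = z powi (wt P i) * z powi (wt P j - wt P i)"
      using z_nz by (simp flip: power_int_add)
    ultimately show ?thesis using u(2)[OF False] by (metis mult.assoc)
  qed
  then obtain a where a: "\<And>j. j < d \<Longrightarrow> j \<noteq> i \<Longrightarrow> a j \<in> Ol \<and> of_rat (coeff P j) * z ^ j = z powi (wt P i) * (z * a j)"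
    by metis
  have "x = (\<Sum>j<d. of_rat (coeff P j) * z ^ j)" using rc.ev_altdef P by metis
  also have "\<dots> = of_rat (coeff P i) * z ^ i + (\<Sum>j\<in>{..<d}-{i}. of_rat (coeff P j) * z ^ j)"
    using id by (subst sum.remove[of _ i]) auto
  also have "(\<Sum>j\<in>{..<d}-{i}. of_rat (coeff P j) * z ^ j) = (\<Sum>j\<in>{..<d}-{i}. z powi (wt P i) * (z * a j))"
    by (rule sum.cong) (use a in auto)
  also have "of_rat (coeff P i) * z ^ i + \<dots> = z powi (wt P i) * (u i + z * (\<Sum>j\<in>{..<d}-{i}. a j))"
    using u(2)[OF i(1)] by (simp add: sum_distrib_left algebra_simps)
  finally have x: "x = z powi (wt P i) * (u i + z * (\<Sum>j\<in>{..<d}-{i}. a j))" .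
  have "(\<Sum>j\<in>{..<d}-{i}. a j) \<in> Ol" by (rule Ol_sum) (use a in auto)
  from that[OF UU_plus[OF u(1)[OF i(1)] this] x] show ?thesis .
qed

lemma powi_UU_unique:
  assumes "u \<in> UU" "a \<in> Ol" "z powi k * u = z powi l * a" shows "l \<le> k"
proof (rule ccontr)
  assume "\<not> ?thesis"
  then have "l - k > 0" by simp
  then obtain b where b: "b \<in> Ol" "z powi (l - k) * a = z * b" using z_powi_in_zOl assms by metis
  have "z powi k * u = z powi k * (z powi (l - k) * a)"
    unfolding assms(3) using z_nz by (simp add: power_int_diff)
  then have "u = z * b" using z_nz b by simp
  moreover obtain c where "c \<in> Ol" "u = 1 + z * c" using assms by (auto simp: UU_def)
  ultimately have "z * (b + - c) = 1" by (simp add: algebra_simps)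
  then show False using one_notin_zOl Ol_add Ol_minus \<open>b \<in> Ol\<close> \<open>c \<in> Ol\<close> by blast
qed

section \<open>The discrete valuation of Q(z) and its finite residue rings\<close>

definition v :: "complex \<Rightarrow> int" where "v x = (THE k. \<exists>u\<in>UU. x = z powi k * u)"

lemma v_eq: assumes "u \<in> UU" shows "v (z powi k * u) = k"
  unfolding v_def
proof (rule the_equality)
  fix l assume "\<exists>w\<in>UU. z powi k * u = z powi l * w"
  then obtain w where "w \<in> UU" "z powi k * u = z powi l * w" by auto
  then show "l = k"
    using powi_UU_unique[OF assms subsetD[OF UU_sub], of w k l]
      powi_UU_unique[OF _ subsetD[OF UU_sub assms], of w l k] by simp
qed (use assms in auto)

lemma v_mult: assumes "x \<in> K" "y \<in> K" "x \<noteq> 0" "y \<noteq> 0" shows "v (x * y) = v x + v y"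
proof -
  obtain k u where 1: "u \<in> UU" "x = z powi k * u" using K_decomp assms by metis
  obtain l w where 2: "w \<in> UU" "y = z powi l * w" using K_decomp assms by metis
  have "x * y = z powi (k + l) * (u * w)" using 1 2 z_nz by (simp add: power_int_add)
  then show ?thesis using 1 2 v_eq UU_mult by metis
qed

lemma v_ge_iff: assumes "x \<in> K" "x \<noteq> 0" shows "k \<le> v x \<longleftrightarrow> (\<exists>a\<in>Ol. x = z powi k * a)"
proof -
  obtain l u where 1: "u \<in> UU" "x = z powi l * u" using K_decomp assms by metis
  then have vx: "v x = l" by (simp add: v_eq)
  show ?thesis
  proof
    assume "k \<le> v x"
    then have "k \<le> l" using vx by simp
    have "x = z powi k * (z powi (l - k) * u)" using 1 z_nz by (simp add: power_int_diff)
    moreover have "z powi (l - k) * u \<in> Ol"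
    proof (cases "l = k")
      case False
      then show ?thesis using \<open>k \<le> l\<close> z_powi_in_zOl[of "l - k" u] 1 UU_sub Ol_mult z_in_Ol
        by (metis diff_gt_0_iff_gt order_le_imp_less_or_eq subsetD)
    qed (use 1 UU_sub in auto)
    ultimately show "\<exists>a\<in>Ol. x = z powi k * a" by blast
  next
    assume "\<exists>a\<in>Ol. x = z powi k * a"
    then show "k \<le> v x" using powi_UU_unique 1 vx by metis
  qed
qed

lemma v_add: assumes "x \<in> K" "y \<in> K" "x \<noteq> 0" "y \<noteq> 0" "x + y \<noteq> 0" shows "min (v x) (v y) \<le> v (x + y)"
proof -
  let ?k = "min (v x) (v y)"
  obtain a b where "a \<in> Ol" "b \<in> Ol" "x = z powi ?k * a" "y = z powi ?k * b"
    using v_ge_iff[of x ?k] v_ge_iff[of y ?k] assms by auto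
  then have "x + y = z powi ?k * (a + b)" "a + b \<in> Ol" by (auto simp: distrib_left intro: Ol_add)
  then show ?thesis using v_ge_iff[of "x + y"] assms K_closed by blast
qed

lemma v_2: "v 2 = d"
proof -
  obtain u where "u \<in> UU" "2 = z powi d * u" by (rule two_eq)
  then show ?thesis using v_eq by metis
qed

text \<open>Binary digits: the residue field has two elements, so sums of powers of z with digits 0
  and 1 represent everything modulo z^n.\<close>

lemma Ol_net: "\<exists>S. finite S \<and> S \<subseteq> K \<and> (\<forall>x\<in>Ol. \<exists>s\<in>S. \<exists>a\<in>Ol. x = s + z ^ n * a)"
proof (induction n)
  case 0
  show ?case by (rule exI[of _ "{0}"]) (use of_rat_in_K[of 0] in auto)
next
  case (Suc n)
  then obtain S where S: "finite S" "S \<subseteq> K" "\<And>x. x \<in> Ol \<Longrightarrow> \<exists>s\<in>S. \<exists>a\<in>Ol. x = s + z ^ n * a" by metis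
  let ?S = "(\<lambda>s. z * s) ` S \<union> (\<lambda>s. 1 + z * s) ` S"
  have "\<exists>s\<in>?S. \<exists>a\<in>Ol. x = s + z ^ Suc n * a" if "x \<in> Ol" for x
  proof -
    obtain y where y: "y \<in> Ol" "x = z * y \<or> x = 1 + z * y" using Ol_residue \<open>x \<in> Ol\<close> by metis
    obtain s a where sa: "s \<in> S" "a \<in> Ol" "y = s + z ^ n * a" using S(3) y by blast
    have "x = z * s + z ^ Suc n * a \<or> x = (1 + z * s) + z ^ Suc n * a"
      using y(2) sa(3) by (auto simp: algebra_simps)
    then show ?thesis using sa by blast
  qed
  moreover have "?S \<subseteq> K" using S(2) K_closed z_in_K of_rat_in_K[of 1] by auto
  ultimately show ?case using S(1) by (intro exI[of _ ?S]) auto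
qed

lemma K_net:
  "\<exists>S. finite S \<and> S \<subseteq> K \<and> (\<forall>x\<in>K. (x \<noteq> 0 \<longrightarrow> v x \<ge> m) \<longrightarrow> (\<exists>s\<in>S. x = s \<or> v (x - s) \<ge> m + int n))"
proof -
  obtain S where S: "finite S" "S \<subseteq> K" "\<And>x. x \<in> Ol \<Longrightarrow> \<exists>s\<in>S. \<exists>a\<in>Ol. x = s + z ^ n * a"
    using Ol_net by metis
  have zK: "z powi m \<in> K"
  proof -
    have "y ^ k \<in> K" if "y \<in> K" for y k
      using that by (induction k) (use of_rat_in_K[of 1] K_closed in auto)
    then show ?thesis using z_in_K K_inverse[OF z_in_K] by (simp add: power_int_def)
  qed
  \<comment> \<open>\<open>v 0\<close> is junk, so x = 0 gets its own representative.\<close>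
  let ?S = "insert 0 ((\<lambda>s. z powi m * s) ` S)"
  have "\<exists>s\<in>?S. x = s \<or> v (x - s) \<ge> m + int n" if x: "x \<in> K" "x \<noteq> 0 \<longrightarrow> v x \<ge> m" for x
  proof (cases "x = 0")
    case False
    then obtain y where y: "y \<in> Ol" "x = z powi m * y" using v_ge_iff x by metis
    obtain s a where sa: "s \<in> S" "a \<in> Ol" "y = s + z ^ n * a" using S(3) y by blast
    have "x - z powi m * s = z powi (m + int n) * a"
      using y sa z_nz by (simp add: power_int_add algebra_simps)
    moreover have "x - z powi m * s \<in> K"
      using K_closed(1)[OF x(1) K_closed(3)[OF K_closed(2)[OF zK]]] S(2) sa by auto
    ultimately have "x = z powi m * s \<or> v (x - z powi m * s) \<ge> m + int n"
    proof (cases "x - z powi m * s = 0")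
      case False
      then show ?thesis using v_ge_iff[OF \<open>x - z powi m * s \<in> K\<close>] \<open>a \<in> Ol\<close>
          \<open>x - z powi m * s = z powi (m + int n) * a\<close> by blast
    qed simp
    then show ?thesis using sa by blast
  qed simp
  moreover have "?S \<subseteq> K" using S(2) K_closed zK of_rat_in_K[of 0] by auto
  ultimately show ?thesis using S(1) by (intro exI[of _ ?S]) auto
qed

end

section \<open>The group law on \<open>y\<^sup>2 = x\<^sup>3 + A x\<^sup>2 + B x\<close>\<close>

locale two_torsion_curve =
  fixes A B :: complex
  assumes B_nz: "B \<noteq> 0" and disc_nz: "A^2 \<noteq> 4*B"
begin

abbreviation cf :: wcoeffs where "cf \<equiv> (0, A, 0, B, 0)"

definition E :: "wpoint set" where
  "E = insert None {Some (x, y) |x y. y^2 = x^3 + A*x^2 + B*x}"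

abbreviation add :: "wpoint \<Rightarrow> wpoint \<Rightarrow> wpoint" (infixl "\<oplus>" 65) where
  "P \<oplus> Q \<equiv> wadd cf P Q"

fun neg :: "wpoint \<Rightarrow> wpoint" where
  "neg None = None"
| "neg (Some (x, y)) = Some (x, - y)"

fun xc :: "wpoint \<Rightarrow> complex" where
  "xc None = 0"
| "xc (Some (x, y)) = x"

lemma None_in_E [simp]: "None \<in> E"
  by (simp add: E_def)

lemma Some_in_E [simp]: "Some (x, y) \<in> E \<longleftrightarrow> y^2 = x^3 + A*x^2 + B*x"
  by (auto simp: E_def)

lemma neg_in_E [simp]: "P \<in> E \<Longrightarrow> neg P \<in> E"
  by (cases P rule: neg.cases) auto

lemma neg_neg [simp]: "neg (neg P) = P"
  by (cases P rule: neg.cases) auto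

lemma add_None_right [simp]: "P \<oplus> None = P"
  by (cases P) auto

lemma add_neg [simp]: "P \<oplus> neg P = None" "neg P \<oplus> P = None"
  by (cases P rule: neg.cases; simp)+

lemma add_chord:
  assumes "x1 \<noteq> x2" "y2 - y1 = l * (x2 - x1)"
  shows "Some (x1, y1) \<oplus> Some (x2, y2) =
           Some (l^2 - A - x1 - x2, - (l * (l^2 - A - x1 - x2 - x1) + y1))"
proof -
  have "(y2 - y1) / (x2 - x1) = l" using assms by simp
  then show ?thesis using assms(1) by (simp add: Let_def algebra_simps)
qed

lemma add_tangent:
  assumes "y \<noteq> 0" "3*x^2 + 2*A*x + B = l * (2*y)"
  shows "Some (x, y) \<oplus> Some (x, y) = Some (l^2 - A - x - x, - (l * (l^2 - A - x - x - x) + y))"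
proof -
  have "l = (3*x^2 + 2*A*x + B) / (2*y)" using assms by simp
  then have "Some (x, y) \<oplus> Some (x, y) = Some (l^2 - A - x - x, - l * (l^2 - A - x - x) - (y - l*x))"
    using assms(1) by (simp add: Let_def)
  then show ?thesis by (simp del: wadd.simps add: algebra_simps)
qed

text \<open>Coordinates centred at an affine point \<open>(x2, y2)\<close>: in terms of \<open>u = x - x2\<close> and the slope
  \<open>l\<close> of the line joining it to \<open>(x, y)\<close>, the curve becomes the conic \<open>base_rel\<close>, in which
  \<open>u = 0\<close> gives the tangent.\<close>

definition base_rel :: "complex \<Rightarrow> complex \<Rightarrow> complex \<Rightarrow> complex \<Rightarrow> bool" where
  "base_rel x2 y2 u l \<longleftrightarrow>
     l^2*u + 2*y2*l = u^2 + (3*x2 + A)*u + (3*x2^2 + 2*A*x2 + B) \<and> (u = 0 \<longrightarrow> y2 \<noteq> 0)"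

lemma base_relE:
  assumes "Some (x1, y1) \<in> E" "Some (x2, y2) \<in> E" "Some (x1, y1) \<noteq> neg (Some (x2, y2))"
  obtains u l where "x1 = x2 + u" "y1 = y2 + l*u" "base_rel x2 y2 u l"
proof (cases "x1 = x2")
  case True
  have "y1^2 = y2^2" using assms(1,2) True by simp
  then have "y1 = y2" using assms(3) True by (auto simp: power2_eq_iff)
  then have "y2 \<noteq> 0" using assms(3) True by auto
  show ?thesis
  proof (rule that)
    show "x1 = x2 + 0" "y1 = y2 + ((3*x2^2 + 2*A*x2 + B) / (2*y2)) * 0"
      using True \<open>y1 = y2\<close> by auto
    show "base_rel x2 y2 0 ((3*x2^2 + 2*A*x2 + B) / (2*y2))"
      using \<open>y2 \<noteq> 0\<close> by (simp add: base_rel_def)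
  qed
next
  case False
  define u where "u = x1 - x2"
  define l where "l = (y1 - y2) / u"
  have u: "u \<noteq> 0" "x1 = x2 + u" using False by (auto simp: u_def)
  have y: "y1 = y2 + l*u" using u by (simp add: l_def)
  have "(y2 + l*u)^2 - y2^2 = (x2+u)^3 + A*(x2+u)^2 + B*(x2+u) - (x2^3 + A*x2^2 + B*x2)"
    using assms(1,2) u(2) y by simp
  then have "u * (l^2*u + 2*y2*l) = u * (u^2 + (3*x2 + A)*u + (3*x2^2 + 2*A*x2 + B))"
    by (simp add: algebra_simps power2_eq_square power3_eq_cube)
  then have "l^2*u + 2*y2*l = u^2 + (3*x2 + A)*u + (3*x2^2 + 2*A*x2 + B)"
    using u by (metis mult_left_cancel)
  then show ?thesis using that u y by (auto simp: base_rel_def)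
qed

text \<open>Vieta: in the centred coordinate the line meets the cubic at 0, u and u', whose sum is
  l^2 - (3 x2 + A). From here on chord and tangent are treated alike.\<close>

lemma add_base:
  assumes "base_rel x2 y2 u l" "u' = l^2 - (3*x2 + A) - u"
  shows "Some (x2 + u, y2 + l*u) \<oplus> Some (x2, y2) = Some (x2 + u', - y2 - l*u')"
    and "Some (x2, y2) \<oplus> Some (x2 + u, y2 + l*u) = Some (x2 + u', - y2 - l*u')"
proof -
  show "Some (x2 + u, y2 + l*u) \<oplus> Some (x2, y2) = Some (x2 + u', - y2 - l*u')"
  proof (cases "u = 0")
    case True
    then have "y2 \<noteq> 0" "3*x2^2 + 2*A*x2 + B = l * (2*y2)"
      using assms(1) by (auto simp: base_rel_def algebra_simps)
    from add_tangent[OF this] show ?thesis unfolding True assms(2) by (simp del: wadd.simps add: algebra_simps)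
  next
    case False
    then show ?thesis
      using add_chord[of "x2+u" x2 y2 "y2+l*u" l] unfolding assms(2) by (simp del: wadd.simps add: algebra_simps)
  qed
  show "Some (x2, y2) \<oplus> Some (x2 + u, y2 + l*u) = Some (x2 + u', - y2 - l*u')"
  proof (cases "u = 0")
    case True
    then have "y2 \<noteq> 0" "3*x2^2 + 2*A*x2 + B = l * (2*y2)"
      using assms(1) by (auto simp: base_rel_def algebra_simps)
    from add_tangent[OF this] show ?thesis unfolding True assms(2) by (simp del: wadd.simps add: algebra_simps)
  next
    case False
    then show ?thesis
      using add_chord[of x2 "x2+u" "y2+l*u" y2 l] unfolding assms(2) by (simp del: wadd.simps add: algebra_simps)
  qed
qed

lemma add_comm: assumes "P \<in> E" "Q \<in> E" shows "P \<oplus> Q = Q \<oplus> P"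
proof (cases P rule: neg.cases)
  case (2 x1 y1)
  note P = this
  show ?thesis
  proof (cases Q rule: neg.cases)
    case (2 x2 y2)
    show ?thesis
    proof (cases "P = neg Q")
      case True
      then show ?thesis using add_neg[of Q] by simp
    next
      case False
      then obtain u l where "x1 = x2 + u" "y1 = y2 + l*u" "base_rel x2 y2 u l"
        using base_relE assms P 2 by metis
      then show ?thesis using add_base P 2 by metis
    qed
  qed (simp add: P)
qed simp

text \<open>The third intersection of the line with the cubic is again a solution of the conic
  equation for the same slope.\<close>

lemma add_in_E: assumes "P \<in> E" "Q \<in> E" shows "P \<oplus> Q \<in> E"
proof (cases P rule: neg.cases)
  case (2 x1 y1)
  note P = this
  show ?thesis
  proof (cases Q rule: neg.cases)
    case (2 x2 y2)
    show ?thesis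
    proof (cases "P = neg Q")
      case True
      then show ?thesis using add_neg[of Q] by simp
    next
      case False
      then obtain u l where ul: "x1 = x2 + u" "y1 = y2 + l*u" "base_rel x2 y2 u l"
        using base_relE assms P 2 by metis
      define u' where "u' = l^2 - (3*x2 + A) - u"
      have eq: "P \<oplus> Q = Some (x2 + u', - y2 - l*u')"
        using add_base[OF ul(3) u'_def] P 2 ul by metis
      have "l^2*u' + 2*y2*l = u'^2 + (3*x2 + A)*u' + (3*x2^2 + 2*A*x2 + B)"
        using ul(3) unfolding base_rel_def u'_def
        by (auto simp: algebra_simps power2_eq_square)
      moreover have "(- y2 - l*u')^2 = y2^2 + u' * (l^2*u' + 2*y2*l)"
        by (simp add: algebra_simps power2_eq_square)
      moreover have "y2^2 = x2^3 + A*x2^2 + B*x2" using assms 2 by simp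
      ultimately have "(- y2 - l*u')^2 =
          x2^3 + A*x2^2 + B*x2 + u' * (u'^2 + (3*x2 + A)*u' + (3*x2^2 + 2*A*x2 + B))"
        by simp
      also have "\<dots> = (x2+u')^3 + A*(x2+u')^2 + B*(x2+u')"
        by (simp add: algebra_simps power2_eq_square power3_eq_cube)
      finally show ?thesis unfolding eq by simp
    qed
  qed (use assms P in simp)
qed (use assms in simp)

text \<open>The slopes of the two last additions are \<open>k - l\<close> and \<open>k - m\<close> for the same \<open>k\<close>.\<close>

lemma assoc_generic:
  assumes Q: "Some (x2, y2) \<in> E" and bu: "base_rel x2 y2 u l" and bw: "base_rel x2 y2 w m"
    and w: "w \<noteq> 0"
    and u': "u' = l^2 - (3*x2 + A) - u" and w': "w' = m^2 - (3*x2 + A) - w"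
    and ne: "u' \<noteq> w" "w' \<noteq> u"
  shows "(Some (x2 + u, y2 + l*u) \<oplus> Some (x2, y2)) \<oplus> Some (x2 + w, y2 + m*w)
       = Some (x2 + u, y2 + l*u) \<oplus> (Some (x2, y2) \<oplus> Some (x2 + w, y2 + m*w))"
proof -
  define a where "a = 3*x2 + A"
  define p where "p = w - u'"
  define q where "q = u - w'"
  \<comment> \<open>Read off from the chord that joins P + Q to T: \<open>(k - l) * p\<close> is the
    rise along it.\<close>
  define k where "k = (2*y2 + w*(l+m)) / p"
  have p: "p \<noteq> 0" "q \<noteq> 0" using ne by (auto simp: p_def q_def)
  have pe: "p = u + w + a - l^2" "q = u + w + a - m^2" by (auto simp: p_def q_def u' w' a_def)
  \<comment> \<open>The difference of the two conic equations, in which their common constant term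
    drops out.\<close>
  have r1: "l^2*u + 2*y2*l - m^2*w - 2*y2*m = u^2 + a*u - w^2 - a*w"
  proof -
    have "(l^2*u + 2*y2*l) - (m^2*w + 2*y2*m) =
        (u^2 + a*u + (3*x2^2 + 2*A*x2 + B)) - (w^2 + a*w + (3*x2^2 + 2*A*x2 + B))"
      using bu bw unfolding base_rel_def a_def by simp
    then show ?thesis by (simp add: algebra_simps)
  qed
  have rel: "w*q - u*p + 2*y2*(l-m) = 0"
    unfolding pe using r1 by (simp add: algebra_simps power2_eq_square)
  have kp: "k*p = 2*y2 + w*(l+m)" using p by (simp add: k_def)
  have pq: "p - q = m^2 - l^2" using pe by simp
  have "(2*y2 + w*(l+m)) * q = 2*y2*q + (l+m)*(w*q)" by (simp add: algebra_simps)
  also have "w*q = u*p - 2*y2*(l-m)" using rel by (simp add: algebra_simps)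
  also have "2*y2*q + (l+m)*(u*p - 2*y2*(l-m)) = 2*y2*(q + (m^2 - l^2)) + (l+m)*(u*p)"
    by (simp add: algebra_simps power2_eq_square)
  also have "q + (m^2 - l^2) = p" by (simp flip: pq)
  finally have "(k*p)*q = (2*y2 + u*(l+m))*p" unfolding kp by (simp add: algebra_simps)
  then have "p*(k*q) = p*(2*y2 + u*(l+m))" by (simp only: mult_ac)
  then have kq: "k*q = 2*y2 + u*(l+m)" using p by (metis mult_left_cancel)
  have "p*(k*(l-m)) = (k*p)*(l-m)" by (simp add: mult_ac)
  also have "\<dots> = 2*y2*(l-m) + w*(l^2-m^2)" unfolding kp by (simp add: algebra_simps power2_eq_square)
  also have "\<dots> = (u*p - w*q) + w*(q-p)"
  proof -
    have "2*y2*(l-m) = u*p - w*q" using rel by (simp add: algebra_simps)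
    moreover have "l^2 - m^2 = q - p" using pq by (simp add: algebra_simps)
    ultimately show ?thesis by simp
  qed
  also have "\<dots> = p*(u-w)" by (simp add: algebra_simps)
  finally have kl: "k*(l-m) = u - w" using p by (metis mult_left_cancel)
  define X where "X = k^2 - 2*k*l + u - w"
  have X2: "X = k^2 - 2*k*m + w - u"
  proof -
    have "X - (k^2 - 2*k*m + w - u) = 2*(u-w) - 2*(k*(l-m))" by (simp add: X_def algebra_simps)
    then show ?thesis using kl by simp
  qed
  have L: "Some (x2 + u', - y2 - l*u') \<oplus> Some (x2 + w, y2 + m*w)
     = Some (x2 + X, - ((k-l)*(X-u') - y2 - l*u'))"
  proof -
    have 1: "x2 + u' \<noteq> x2 + w" using ne by simp
    have 2: "(y2 + m*w) - (- y2 - l*u') = (k-l) * ((x2 + w) - (x2 + u'))"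
      using kp by (simp add: p_def algebra_simps)
    have 3: "(k-l)^2 - A - (x2 + u') - (x2 + w) = x2 + X"
      by (simp add: X_def u' algebra_simps power2_eq_square)
    show ?thesis using add_chord[OF 1 2] unfolding 3 by (simp del: wadd.simps add: algebra_simps)
  qed
  have Rr: "Some (x2 + u, y2 + l*u) \<oplus> Some (x2 + w', - y2 - m*w')
     = Some (x2 + X, - ((k-m)*(X-u) + y2 + l*u))"
  proof -
    have 1: "x2 + u \<noteq> x2 + w'" using ne by simp
    have "k*(u - w') = 2*y2 + u*(l+m)" using kq by (simp add: q_def)
    then have 2: "(- y2 - m*w') - (y2 + l*u) = (k-m) * ((x2 + w') - (x2 + u))"
      by (simp add: algebra_simps)
    have 3: "(k-m)^2 - A - (x2 + u) - (x2 + w') = x2 + X"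
      by (simp add: X2 w' algebra_simps power2_eq_square)
    show ?thesis using add_chord[OF 1 2] unfolding 3 by (simp del: wadd.simps add: algebra_simps)
  qed
  have lu: "(k-l)*(w-u') = 2*y2 + m*w + l*u'"
    using kp by (simp add: p_def algebra_simps)
  have "(k-l)*(X-u') - y2 - l*u' = (k-l)*(X-w) + y2 + m*w"
    using lu by (simp add: algebra_simps)
  also have "\<dots> = (k-m)*(X-u) + y2 + l*u"
  proof -
    have "((k-l)*(X-w) + y2 + m*w) - ((k-m)*(X-u) + y2 + l*u)
       = - (l-m)*(k^2 - 2*k*l + u - w) - (l+m)*(u-w) + k*(u-w)"
      by (simp add: X_def algebra_simps)
    also have "\<dots> = - (k*(l-m))*(k - 2*l) - (l-m)*(u-w) - (l+m)*(u-w) + k*(u-w)"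
      by (simp add: algebra_simps power2_eq_square)
    also have "\<dots> = 0" unfolding kl by (simp add: algebra_simps)
    finally show ?thesis by (simp only: right_minus_eq)
  qed
  finally have fin: "(k-l)*(X-u') - y2 - l*u' = (k-m)*(X-u) + y2 + l*u" .
  show ?thesis
    by (simp only: add_base(1)[OF bu u'] add_base(2)[OF bw w'] L Rr fin)
qed

text \<open>Reflection in the x-axis maps the line through Q and T to the line through -Q and Q + T,
  so the second chord has slope -m and returns to T.\<close>

lemma cancel_generic:
  assumes Q: "Some (x2, y2) \<in> E" and bw: "base_rel x2 y2 w m" and w: "w \<noteq> 0"
    and w': "w' = m^2 - (3*x2 + A) - w" "w' \<noteq> 0"
  shows "neg (Some (x2, y2)) \<oplus> (Some (x2, y2) \<oplus> Some (x2 + w, y2 + m*w)) = Some (x2 + w, y2 + m*w)"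
proof -
  have "Some (x2, - y2) \<oplus> Some (x2 + w', - y2 - m*w') = Some (x2 + w, y2 + m*w)"
    using add_chord[of x2 "x2+w'" "- y2 - m*w'" "- y2" "- m"] w'(2) unfolding w'(1)
    by (simp del: wadd.simps add: algebra_simps)
  then show ?thesis using add_base[OF bw w'(1)] by (simp del: wadd.simps)
qed

text \<open>Associativity is first checked for a generic third summand \<open>T\<close>, where only chords occur apart
  from one possible tangent; the general case follows by adding \<open>T\<close> and cancelling it again.\<close>

definition generic :: "(wpoint \<Rightarrow> bool) \<Rightarrow> bool" where
  "generic P \<longleftrightarrow> finite {T \<in> E. \<not> P T}"

lemma generic_conj: "generic P \<Longrightarrow> generic Q \<Longrightarrow> generic (\<lambda>T. P T \<and> Q T)"
  unfolding generic_def
  by (rule finite_subset[of _ "{T \<in> E. \<not> P T} \<union> {T \<in> E. \<not> Q T}"]) auto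

lemma generic_mono: "generic P \<Longrightarrow> (\<And>T. T \<in> E \<Longrightarrow> P T \<Longrightarrow> Q T) \<Longrightarrow> generic Q"
  unfolding generic_def by (rule finite_subset[of _ "{T \<in> E. \<not> P T}"]) auto

lemma finite_fibre_x: "finite {T \<in> E. T \<noteq> None \<and> xc T = x}"
proof -
  let ?r = "csqrt (x^3 + A*x^2 + B*x)"
  have "T \<in> {Some (x, ?r), Some (x, - ?r)}" if *: "T \<in> E" "T \<noteq> None" "xc T = x" for T
  proof -
    obtain x' y where "T = Some (x', y)" using *(2) by auto
    then have T: "T = Some (x, y)" using *(3) by simp
    then have "y^2 = ?r^2" using *(1) by simp
    then show ?thesis unfolding T power2_eq_iff by auto
  qed
  then have "{T \<in> E. T \<noteq> None \<and> xc T = x} \<subseteq> {Some (x, ?r), Some (x, - ?r)}" by blast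
  then show ?thesis by (rule finite_subset) auto
qed

lemma generic_x:
  assumes "finite {x. \<not> P x}"
  shows "generic (\<lambda>T. T \<noteq> None \<and> P (xc T))"
proof -
  have "{T \<in> E. \<not> (T \<noteq> None \<and> P (xc T))} \<subseteq>
      insert None (\<Union>x\<in>{x. \<not> P x}. {T \<in> E. T \<noteq> None \<and> xc T = x})" by auto
  then show ?thesis unfolding generic_def
    by (rule finite_subset) (use assms finite_fibre_x in auto)
qed

text \<open>E is infinite, since over C every x is the abscissa of a point.\<close>

lemma generic_ex: assumes "generic P" obtains T where "T \<in> E" "P T"
proof -
  have "infinite E"
  proof
    assume "finite E"
    then have "finite (xc ` E)" by simp
    moreover have "x \<in> xc ` E" for x
      by (rule image_eqI[of _ _ "Some (x, csqrt (x^3 + A*x^2 + B*x))"]) auto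
    then have "xc ` E = UNIV" by auto
    ultimately show False by (simp add: infinite_UNIV_char_0)
  qed
  then have "E - {T \<in> E. \<not> P T} \<noteq> {}"
    using assms unfolding generic_def by (metis Diff_eq_empty_iff finite_subset)
  then show ?thesis using that by blast
qed

lemma nonsingular:
  assumes "Some (x, 0) \<in> E" shows "3*x^2 + 2*A*x + B \<noteq> 0"
proof
  assume 1: "3*x^2 + 2*A*x + B = 0"
  have "x * (x^2 + A*x + B) = 0"
    using assms by (simp add: algebra_simps power2_eq_square power3_eq_cube)
  then consider "x = 0" | "x \<noteq> 0" "x^2 + A*x + B = 0" by auto
  then show False
  proof cases
    case 2
    have "x * (2*x + A) = (3*x^2 + 2*A*x + B) - (x^2 + A*x + B)"
      by (simp add: algebra_simps power2_eq_square)
    then have "A = - 2*x" using 1 2 by (auto simp: add_eq_0_iff2)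
    with 2 have "B = x^2" by (simp add: algebra_simps power2_eq_square)
    then show False using disc_nz \<open>A = - 2*x\<close> by (simp add: power_mult_distrib)
  qed (use 1 B_nz in simp)
qed

lemma finite_poly_roots:
  fixes p :: "complex poly" assumes "p \<noteq> 0" "\<And>x. \<not> P x \<Longrightarrow> poly p x = 0"
  shows "finite {x. \<not> P x}"
  using poly_roots_finite[OF assms(1)] by (rule finite_subset[rotated]) (use assms(2) in auto)

lemma finite_shifted_roots:
  fixes p :: "complex poly" assumes "p \<noteq> 0"
  shows "finite {x. \<not> (poly p (x - z) \<noteq> 0 \<and> x \<noteq> z)}"
proof (rule finite_poly_roots)
  show "pcompose p [:-z, 1:] * [:-z, 1:] \<noteq> 0"
    using assms by (simp only: mult_eq_0_iff pcompose_eq_0_iff) (simp add: pcompose_eq_0_iff)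
qed (auto simp: poly_pcompose)

text \<open>Eliminating the slope from \<open>base_rel\<close> when \<open>x(B + T)\<close> is prescribed.\<close>

lemma fibre_eq:
  assumes "base_rel x2 y2 w m" "m^2 - (3*x2 + A) - w = u"
  shows "((3*x2^2 + 2*A*x2 + B) - u*w)^2 = (2*y2)^2 * ((3*x2 + A) + w + u)"
proof -
  define a b where "a = 3*x2 + A" and "b = 3*x2^2 + 2*A*x2 + B"
  have m2: "m^2 = a + w + u" using assms(2) by (simp add: a_def algebra_simps)
  have "m^2*w + 2*y2*m = w^2 + a*w + b" using assms(1) by (simp add: base_rel_def a_def b_def)
  then have "2*y2*m = b - u*w" unfolding m2 by (simp add: algebra_simps power2_eq_square)
  then have "(b - u*w)^2 = (2*y2)^2 * m^2" by (metis power_mult_distrib)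
  then show ?thesis unfolding m2 a_def b_def .
qed

lemma affine_generic:
  assumes "Some (x2, y2) \<in> E" "T \<in> E" "T \<noteq> None" "xc T \<noteq> x2"
  obtains w m where "T = Some (x2 + w, y2 + m*w)" "base_rel x2 y2 w m" "w \<noteq> 0"
proof -
  obtain x y where T: "T = Some (x, y)" using assms(3) by auto
  then have "Some (x, y) \<noteq> neg (Some (x2, y2))" using assms by auto
  then obtain w m where "x = x2 + w" "y = y2 + m*w" "base_rel x2 y2 w m"
    using base_relE[of x y x2 y2] assms T by metis
  then show ?thesis using that T assms(4) by auto
qed

text \<open>By \<open>fibre_eq\<close> an exceptional T makes x(T) - x2 a root of \<open>pl\<close>.
  If \<open>pl\<close> were zero, its coefficients would force y2 = 0 and b = 0, and the curve would
  be singular at (x2, y2).\<close>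

lemma generic_add_x_neq:
  assumes Q: "Some (x2, y2) \<in> E"
  shows "generic (\<lambda>T. Some (x2, y2) \<oplus> T \<noteq> None \<and> xc (Some (x2, y2) \<oplus> T) \<noteq> x)"
proof -
  define u where "u = x - x2"
  define a b where "a = 3*x2 + A" and "b = 3*x2^2 + 2*A*x2 + B"
  define pl where "pl = [:b, -u:]^2 - smult ((2*y2)^2) [:a + u, 1:]"
  have "pl \<noteq> 0"
  proof
    assume 0: "pl = 0"
    have "coeff pl 2 = u^2" "coeff pl 1 = - 2*b*u - (2*y2)^2" "coeff pl 0 = b^2 - (2*y2)^2*(a+u)"
      by (auto simp: pl_def power2_eq_square numeral_2_eq_2)
    with 0 have "u^2 = 0" "- 2*b*u - (2*y2)^2 = 0" "b^2 - (2*y2)^2*(a+u) = 0" by auto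
    then have "y2 = 0" "b = 0" by auto
    then show False using nonsingular Q b_def by auto
  qed
  from finite_shifted_roots[OF this] have "finite {x. \<not> (poly pl (x - x2) \<noteq> 0 \<and> x \<noteq> x2)}" .
  from generic_x[OF this] show ?thesis
  proof (rule generic_mono)
    fix T assume T: "T \<in> E" "T \<noteq> None \<and> poly pl (xc T - x2) \<noteq> 0 \<and> xc T \<noteq> x2"
    then obtain w m where wm: "T = Some (x2 + w, y2 + m*w)" "base_rel x2 y2 w m" "w \<noteq> 0"
      using affine_generic Q by metis
    have "m^2 - (3*x2 + A) - w \<noteq> u"
    proof
      assume "m^2 - (3*x2 + A) - w = u"
      from fibre_eq[OF wm(2) this] have "poly pl w = 0"
        by (simp add: pl_def a_def b_def algebra_simps)
      then show False using T wm by simp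
    qed
    then show "Some (x2, y2) \<oplus> T \<noteq> None \<and> xc (Some (x2, y2) \<oplus> T) \<noteq> x"
      using add_base(2)[OF wm(2) refl] wm(1) by (auto simp: u_def simp del: wadd.simps)
  qed
qed

text \<open>Translation by Q takes each abscissa only finitely often, so it pulls cofinite
  conditions back to cofinite ones.\<close>

lemma generic_add:
  assumes "Q \<in> E" "generic P" shows "generic (\<lambda>T. P (Q \<oplus> T))"
proof (cases Q rule: neg.cases)
  case 1
  then show ?thesis using assms by simp
next
  case (2 x2 y2)
  let ?S = "{T \<in> E. \<not> P T}"
  have fin: "generic (\<lambda>T. \<forall>x\<in>F. Q \<oplus> T \<noteq> None \<and> xc (Q \<oplus> T) \<noteq> x)" if "finite F" for F
    using that
  proof induction
    case empty
    then show ?case by (simp add: generic_def)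
  next
    case (insert x F)
    show ?case using generic_conj[OF insert(3) generic_add_x_neq[of x2 y2 x]] assms 2
      by (simp del: wadd.simps add: conj_commute)
  qed
  have 1: "generic (\<lambda>T. \<forall>x\<in>insert 0 (xc ` ?S). Q \<oplus> T \<noteq> None \<and> xc (Q \<oplus> T) \<noteq> x)"
    by (rule fin) (use assms(2) in \<open>simp add: generic_def\<close>)
  show ?thesis
    using 1
  proof (rule generic_mono)
    fix T assume T: "T \<in> E" "\<forall>x\<in>insert 0 (xc ` ?S). Q \<oplus> T \<noteq> None \<and> xc (Q \<oplus> T) \<noteq> x"
    have "Q \<oplus> T \<in> E" using add_in_E assms(1) T(1) .
    then show "P (Q \<oplus> T)" using T(2) by (metis (mono_tags, lifting) CollectI imageI insertI2)
  qed
qed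

lemma generic_assoc:
  assumes P: "P \<in> E" and Q: "Q \<in> E"
  shows "generic (\<lambda>T. (P \<oplus> Q) \<oplus> T = P \<oplus> (Q \<oplus> T))"
proof (cases P rule: neg.cases)
  case 1
  then show ?thesis by (simp add: generic_def)
next
  case P1: (2 x1 y1)
  show ?thesis
  proof (cases Q rule: neg.cases)
    case 1
    then show ?thesis by (simp add: generic_def)
  next
    case Q2: (2 x2 y2)
    have ne: "generic (\<lambda>T. T \<noteq> None \<and> xc T \<noteq> z)" for z
      by (rule generic_x) auto
    show ?thesis
    proof (cases "P = neg Q")
      case True
      from generic_conj[OF ne[of x2] generic_add_x_neq[of x2 y2 x2]] Q Q2
      have "generic (\<lambda>T. (T \<noteq> None \<and> xc T \<noteq> x2) \<and> Q \<oplus> T \<noteq> None \<and> xc (Q \<oplus> T) \<noteq> x2)"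
        by simp
      then show ?thesis
      proof (rule generic_mono)
        fix T assume T: "T \<in> E" "(T \<noteq> None \<and> xc T \<noteq> x2) \<and> Q \<oplus> T \<noteq> None \<and> xc (Q \<oplus> T) \<noteq> x2"
        then obtain w m where wm: "T = Some (x2 + w, y2 + m*w)" "base_rel x2 y2 w m" "w \<noteq> 0"
          using affine_generic Q Q2 by metis
        have "m^2 - (3*x2 + A) - w \<noteq> 0"
          using T add_base(2)[OF wm(2) refl] wm(1) Q2 by (auto simp del: wadd.simps)
        then have "neg Q \<oplus> (Q \<oplus> T) = T"
          using cancel_generic[OF _ wm(2,3) refl] Q Q2 wm(1) by blast
        then show "(P \<oplus> Q) \<oplus> T = P \<oplus> (Q \<oplus> T)" using True by simp
      qed
    next
      case False
      then obtain u l where ul: "x1 = x2 + u" "y1 = y2 + l*u" "base_rel x2 y2 u l"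
        using base_relE P Q P1 Q2 by metis
      define u' where "u' = l^2 - (3*x2 + A) - u"
      have "generic (\<lambda>T. (T \<noteq> None \<and> xc T \<noteq> x2) \<and> (T \<noteq> None \<and> xc T \<noteq> x2 + u') \<and>
           Q \<oplus> T \<noteq> None \<and> xc (Q \<oplus> T) \<noteq> x1)"
        using generic_conj[OF ne[of x2] generic_conj[OF ne[of "x2 + u'"] generic_add_x_neq[of x2 y2 x1]]]
        Q Q2 by simp
      then show ?thesis
      proof (rule generic_mono)
        fix T assume T: "T \<in> E" "(T \<noteq> None \<and> xc T \<noteq> x2) \<and> (T \<noteq> None \<and> xc T \<noteq> x2 + u') \<and>
           Q \<oplus> T \<noteq> None \<and> xc (Q \<oplus> T) \<noteq> x1"
        then obtain w m where wm: "T = Some (x2 + w, y2 + m*w)" "base_rel x2 y2 w m" "w \<noteq> 0"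
          using affine_generic Q Q2 by metis
        have 1: "m^2 - (3*x2 + A) - w \<noteq> u"
          using T add_base(2)[OF wm(2) refl] wm(1) Q2 ul by (auto simp del: wadd.simps)
        have 2: "u' \<noteq> w" using T wm by auto
        show "(P \<oplus> Q) \<oplus> T = P \<oplus> (Q \<oplus> T)"
          using assoc_generic[OF _ ul(3) wm(2,3) u'_def refl 2 1] Q
          unfolding P1 Q2 wm(1) ul(1,2) by blast
      qed
    qed
  qed
qed

text \<open>The line through U + T and -T is a chord unless both have the same abscissa. That
  condition is a quartic in x(T) - x2 with leading coefficient 1, so it has finitely many
  solutions.\<close>

lemma add_right_cancel_generic:
  assumes "U \<in> E" shows "generic (\<lambda>T. (U \<oplus> T) \<oplus> neg T = U)"
proof (cases U rule: neg.cases)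
  case 1
  then show ?thesis by (simp add: generic_def)
next
  case (2 x2 y2)
  define a b where "a = 3*x2 + A" and "b = 3*x2^2 + 2*A*x2 + B"
  define pl where "pl = [:b, 0, -1:]^2 - smult ((2*y2)^2) [:a, 2:]"
  have "coeff pl 4 = 1" by (simp add: pl_def power2_eq_square numeral_eq_Suc)
  then have "pl \<noteq> 0" by auto
  from finite_shifted_roots[OF this] have "finite {x. \<not> (poly pl (x - x2) \<noteq> 0 \<and> x \<noteq> x2)}" .
  from generic_x[OF this] show ?thesis
  proof (rule generic_mono)
    fix T assume T: "T \<in> E" "T \<noteq> None \<and> poly pl (xc T - x2) \<noteq> 0 \<and> xc T \<noteq> x2"
    then obtain w m where wm: "T = Some (x2 + w, y2 + m*w)" "base_rel x2 y2 w m" "w \<noteq> 0"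
      using affine_generic assms 2 by metis
    define w' where "w' = m^2 - (3*x2 + A) - w"
    have ne: "w' \<noteq> w"
    proof
      assume "w' = w"
      from fibre_eq[OF wm(2) this[unfolded w'_def]] have "poly pl w = 0"
        by (simp add: pl_def a_def b_def algebra_simps power2_eq_square)
      then show False using T wm by simp
    qed
    have "U \<oplus> T = Some (x2 + w', - y2 - m*w')" using add_base(2)[OF wm(2) w'_def] wm(1) 2 by simp
    moreover have "Some (x2 + w', - y2 - m*w') \<oplus> Some (x2 + w, - (y2 + m*w)) = Some (x2, y2)"
      using add_chord[of "x2+w'" "x2 + w" "- (y2 + m*w)" "- y2 - m*w'" "- m"] ne
      unfolding w'_def by (simp del: wadd.simps add: algebra_simps)
    ultimately show "(U \<oplus> T) \<oplus> neg T = U" using wm(1) 2 by simp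
  qed
qed

lemma add_assoc:
  assumes "P \<in> E" "Q \<in> E" "R \<in> E"
  shows "(P \<oplus> Q) \<oplus> R = P \<oplus> (Q \<oplus> R)"
proof -
  let ?U = "(P \<oplus> Q) \<oplus> R" and ?V = "P \<oplus> (Q \<oplus> R)"
  have UV: "?U \<in> E" "?V \<in> E" using assms add_in_E by blast+
  have "generic (\<lambda>T. (?U \<oplus> T = (P \<oplus> Q) \<oplus> (R \<oplus> T) \<and> (P \<oplus> Q) \<oplus> (R \<oplus> T) = P \<oplus> (Q \<oplus> (R \<oplus> T))) \<and>
      ((Q \<oplus> R) \<oplus> T = Q \<oplus> (R \<oplus> T) \<and> ?V \<oplus> T = P \<oplus> ((Q \<oplus> R) \<oplus> T)) \<and>
      (?U \<oplus> T) \<oplus> neg T = ?U \<and> (?V \<oplus> T) \<oplus> neg T = ?V)"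
    by (intro generic_conj generic_assoc add_right_cancel_generic UV assms add_in_E
        generic_add[OF assms(3) generic_assoc[OF assms(1,2)]])
  then obtain T where "(?U \<oplus> T = (P \<oplus> Q) \<oplus> (R \<oplus> T) \<and> (P \<oplus> Q) \<oplus> (R \<oplus> T) = P \<oplus> (Q \<oplus> (R \<oplus> T))) \<and>
      ((Q \<oplus> R) \<oplus> T = Q \<oplus> (R \<oplus> T) \<and> ?V \<oplus> T = P \<oplus> ((Q \<oplus> R) \<oplus> T)) \<and>
      (?U \<oplus> T) \<oplus> neg T = ?U \<and> (?V \<oplus> T) \<oplus> neg T = ?V"
    using generic_ex by blast
  then show ?thesis by metis
qed

section \<open>Multiples, torsion and the duplication formula\<close>

abbreviation mult :: "nat \<Rightarrow> wpoint \<Rightarrow> wpoint" where "mult n P \<equiv> wmult cf n P"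

lemma mult_in_E: "P \<in> E \<Longrightarrow> mult n P \<in> E"
  by (induction n) (auto intro: add_in_E)

lemma mult_add: assumes "P \<in> E" shows "mult (m + n) P = mult m P \<oplus> mult n P"
  by (induction m) (use assms add_assoc mult_in_E in auto)

lemma mult_double: "P \<in> E \<Longrightarrow> mult (2 * n) P = mult n P \<oplus> mult n P"
  using mult_add[of P n n] by (simp add: mult_2)

lemma add_left_commute:
  "P \<in> E \<Longrightarrow> Q \<in> E \<Longrightarrow> R \<in> E \<Longrightarrow> P \<oplus> (Q \<oplus> R) = Q \<oplus> (P \<oplus> R)"
  using add_assoc add_comm by metis

lemma mult_distrib:
  assumes "P \<in> E" "Q \<in> E" shows "mult n (P \<oplus> Q) = mult n P \<oplus> mult n Q"
proof (induction n)
  case (Suc n)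
  have E: "mult n P \<in> E" "mult n Q \<in> E" "mult n P \<oplus> mult n Q \<in> E" "Q \<oplus> mult n Q \<in> E"
    using assms mult_in_E add_in_E by blast+
  have "mult (Suc n) (P \<oplus> Q) = P \<oplus> (Q \<oplus> (mult n P \<oplus> mult n Q))"
    using Suc add_assoc[OF assms E(3)] by simp
  also have "\<dots> = (P \<oplus> mult n P) \<oplus> (Q \<oplus> mult n Q)"
    using add_left_commute[of Q "mult n P" "mult n Q"] add_assoc[of P "mult n P"] assms E by metis
  finally show ?case by simp
qed simp

lemma mult_None [simp]: "mult n None = None"
  by (induction n) auto

lemma mult_mult: assumes "P \<in> E" shows "mult m (mult n P) = mult (m * n) P"
  by (induction m) (use assms mult_add in auto)

lemma mult_neg: assumes "P \<in> E" shows "mult n (neg P) = neg (mult n P)"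
proof -
  have E: "mult n (neg P) \<in> E" "mult n P \<in> E" using assms mult_in_E by auto
  have "mult n P \<oplus> mult n (neg P) = None"
    using mult_distrib[of P "neg P" n] assms by simp
  then have "neg (mult n P) \<oplus> (mult n P \<oplus> mult n (neg P)) = neg (mult n P)" by simp
  then show ?thesis using add_assoc[of "neg (mult n P)" "mult n P" "mult n (neg P)"] E by simp
qed

definition torsion :: "wpoint \<Rightarrow> bool" where
  "torsion P \<longleftrightarrow> P \<in> E \<and> (\<exists>n>0. mult n P = None)"

lemma torsion_diff:
  assumes "torsion P" "torsion Q" shows "torsion (P \<oplus> neg Q)"
proof -
  obtain m n where mn: "m > 0" "n > 0" "mult m P = None" "mult n Q = None" and E: "P \<in> E" "Q \<in> E"
    using assms by (auto simp: torsion_def)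
  have "mult (m * n) P = None" using mult_mult[of P n m] mn E by (simp add: mult.commute)
  moreover have "mult (m * n) (neg Q) = None" using mult_mult[of Q m n] mn E by (simp add: mult_neg)
  ultimately have "mult (m * n) (P \<oplus> neg Q) = None" using mult_distrib E by simp
  then show ?thesis using mn E by (auto simp: torsion_def intro!: add_in_E exI[of _ "m*n"])
qed

text \<open>The multiples of a torsion point form a finite set, so its iterated doubles cannot be
  pairwise distinct.\<close>

lemma torsion_double_repeat:
  assumes "torsion P" obtains i j where "i < j" "mult (2^i) P = mult (2^j) P"
proof -
  obtain n where n: "n > 0" "mult n P = None" and P: "P \<in> E" using assms by (auto simp: torsion_def)
  have "mult (k * n) P = None" for k using mult_mult[of P k n] P n by simp
  then have per: "mult k P = mult (k mod n) P" for k
    using mult_add[of P "k mod n" "k div n * n"] P by simp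
  then have "range (\<lambda>i. mult (2^i) P) \<subseteq> (\<lambda>k. mult k P) ` {..<n}"
  proof clarify
    fix i show "mult (2^i) P \<in> (\<lambda>k. mult k P) ` {..<n}"
      by (subst per) (use n(1) in auto)
  qed
  then have "finite (range (\<lambda>i. mult (2^i) P))" by (rule finite_subset) simp
  then have "\<not> inj (\<lambda>i::nat. mult (2^i) P)" using finite_imageD infinite_UNIV_nat by blast
  then obtain i j :: nat where "i \<noteq> j" "mult (2^i) P = mult (2^j) P" by (auto simp: inj_def)
  then show ?thesis using that[of i j] that[of j i] by (cases "i < j") auto
qed

lemma double_affine:
  assumes "Some (x, y) \<in> E" "y \<noteq> 0"
  obtains y' where "Some (x, y) \<oplus> Some (x, y) = Some ((x^2 - B)^2 / (4*(x^3 + A*x^2 + B*x)), y')"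
proof -
  define l where "l = (3*x^2 + 2*A*x + B) / (2*y)"
  have l: "3*x^2 + 2*A*x + B = l * (2*y)" using assms by (simp add: l_def)
  have y2: "y^2 = x^3 + A*x^2 + B*x" using assms by simp
  have "(l^2 - A - x - x) * (4*y^2) = (l*(2*y))^2 - (A + 2*x) * (4*y^2)"
    by (simp add: algebra_simps power2_eq_square)
  also have "\<dots> = (x^2 - B)^2"
    unfolding l[symmetric] y2 by (simp add: algebra_simps power2_eq_square power3_eq_cube)
  finally have "l^2 - A - x - x = (x^2 - B)^2 / (4*y^2)" using assms(2) by (intro iffD2[OF nonzero_eq_divide_eq]) auto
  then show ?thesis using add_tangent[OF assms(2) l] that y2 by auto
qed

end

section \<open>Finiteness of torsion\<close>

text \<open>Besides the axioms of a discrete valuation with residue characteristic 2, \<open>net\<close> expresses that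
  the residue rings are finite. The value \<open>v 0\<close> is junk.\<close>

locale dvf =
  fixes F :: "complex set" and v :: "complex \<Rightarrow> int"
  assumes subfield: "is_subfield_C F"
    and v_mult: "\<And>x y. x \<in> F \<Longrightarrow> y \<in> F \<Longrightarrow> x \<noteq> 0 \<Longrightarrow> y \<noteq> 0 \<Longrightarrow> v (x * y) = v x + v y"
    and v_add: "\<And>x y. x \<in> F \<Longrightarrow> y \<in> F \<Longrightarrow> x \<noteq> 0 \<Longrightarrow> y \<noteq> 0 \<Longrightarrow> x + y \<noteq> 0 \<Longrightarrow> min (v x) (v y) \<le> v (x + y)"
    and v_two: "v 2 > 0"
    and net: "\<And>m n. \<exists>S. finite S \<and> S \<subseteq> F \<and>
       (\<forall>x\<in>F. (x \<noteq> 0 \<longrightarrow> v x \<ge> m) \<longrightarrow> (\<exists>s\<in>S. x = s \<or> v (x - s) \<ge> m + int n))"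
begin

lemma F_0 [simp]: "0 \<in> F" and F_1 [simp]: "1 \<in> F"
  using subfield by (auto simp: is_subfield_C_def)

lemma F_add: "x \<in> F \<Longrightarrow> y \<in> F \<Longrightarrow> x + y \<in> F" and F_mult: "x \<in> F \<Longrightarrow> y \<in> F \<Longrightarrow> x * y \<in> F"
  and F_minus: "x \<in> F \<Longrightarrow> - x \<in> F" and F_inverse: "x \<in> F \<Longrightarrow> inverse x \<in> F"
  using subfield by (auto simp: is_subfield_C_def)

lemma F_diff: "x \<in> F \<Longrightarrow> y \<in> F \<Longrightarrow> x - y \<in> F"
  using F_add[of x "- y"] F_minus[of y] by simp

lemma F_divide: "x \<in> F \<Longrightarrow> y \<in> F \<Longrightarrow> x / y \<in> F"
  unfolding divide_inverse by (intro F_mult F_inverse)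

lemma F_power: "x \<in> F \<Longrightarrow> x ^ n \<in> F"
  by (induction n) (auto intro: F_mult)

lemma F_numeral: "numeral n \<in> F"
proof -
  have "of_nat k \<in> F" for k by (induction k) (auto intro: F_add)
  from this[of "numeral n"] show ?thesis by simp
qed

lemmas F_closed = F_0 F_1 F_add F_mult F_minus F_inverse F_diff F_divide F_power F_numeral

lemma v_1: "v 1 = 0" using v_mult[of 1 1] by simp

lemma v_minus: assumes "x \<in> F" shows "v (- x) = v x"
proof (cases "x = 0")
  case False
  have "v (-1) + v (-1) = 0" using v_mult[of "-1" "-1"] v_1 by (simp add: F_closed)
  then have "v (-1) = 0" by simp
  then show ?thesis using v_mult[of "-1" x] assms False by (simp add: F_closed)
qed simp

lemma v_power: assumes "x \<in> F" "x \<noteq> 0" shows "v (x ^ n) = int n * v x"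
  by (induction n) (use assms v_1 in \<open>auto simp: v_mult F_closed algebra_simps\<close>)

lemma v_divide: assumes "x \<in> F" "y \<in> F" "x \<noteq> 0" "y \<noteq> 0" shows "v (x / y) = v x - v y"
  using v_mult[of "x / y" y] assms by (simp add: F_divide)

definition vg :: "int \<Rightarrow> complex \<Rightarrow> bool" where
  "vg k x \<longleftrightarrow> x \<in> F \<and> (x \<noteq> 0 \<longrightarrow> v x \<ge> k)"

lemma vg_mono: "vg k x \<Longrightarrow> l \<le> k \<Longrightarrow> vg l x" by (auto simp: vg_def)

lemma vg_add: "vg k x \<Longrightarrow> vg k y \<Longrightarrow> vg k (x + y)"
  using v_add[of x y] by (cases "x = 0"; cases "y = 0"; cases "x + y = 0") (auto simp: vg_def F_closed)

lemma vg_minus: "vg k x \<Longrightarrow> vg k (- x)"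
  by (auto simp: vg_def v_minus F_closed)

lemma vg_diff: "vg k x \<Longrightarrow> vg k y \<Longrightarrow> vg k (x - y)"
  using vg_add[of k x "- y"] vg_minus[of k y] by simp

lemma vg_mult: "vg k x \<Longrightarrow> vg l y \<Longrightarrow> m \<le> k + l \<Longrightarrow> vg m (x * y)"
  by (cases "x = 0"; cases "y = 0") (auto simp: vg_def v_mult F_closed)

lemma vg_numeral: "vg 0 (numeral n)"
proof -
  have "vg 0 (of_nat k)" for k
  proof (induction k)
    case (Suc k)
    have "vg 0 1" by (simp add: vg_def v_1)
    then show ?case using Suc vg_add[of 0 1 "of_nat k"] by simp
  qed (simp add: vg_def)
  from this[of "numeral n"] show ?thesis by simp
qed

lemma vg_numeral_mult: "vg k x \<Longrightarrow> vg k (numeral n * x)"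
  using vg_mult[OF vg_numeral] by simp

text \<open>The valuation is an integer, so half of k may be rounded up; this is the
  \<open>k + 1\<close>.\<close>

lemma vg_square_root: assumes "x \<in> F" "vg k (x^2)" "2 * l \<le> k + 1" shows "vg l x"
  using assms v_power[of x 2] by (auto simp: vg_def)

lemma v_add_dominant:
  assumes "x \<in> F" "x \<noteq> 0" "vg k y" "v x < k" shows "x + y \<noteq> 0" "v (x + y) = v x"
proof -
  have yF: "y \<in> F" using assms(3) by (simp add: vg_def)
  show nz: "x + y \<noteq> 0"
  proof
    assume "x + y = 0"
    then have "x = - y" by (simp add: eq_neg_iff_add_eq_0)
    then show False using assms vg_minus[OF assms(3)] by (auto simp: vg_def)
  qed
  have "vg (v x) (x + y)" using assms by (intro vg_add) (auto simp: vg_def)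
  moreover have "\<not> vg (v x + 1) (x + y)"
  proof
    assume "vg (v x + 1) (x + y)"
    then have "vg (v x + 1) ((x + y) - y)" using assms by (intro vg_diff) (auto elim: vg_mono)
    then show False using assms(2) by (simp add: vg_def)
  qed
  ultimately show "v (x + y) = v x" using nz yF assms(1) by (auto simp: vg_def F_closed)
qed

end

locale curve_over_dvf = two_torsion_curve A B + dvf F v for A B :: complex and F v +
  assumes A_in: "A \<in> F" and B_in: "B \<in> F"
begin

definition EF :: "wpoint set" where "EF = rat_points cf F"

lemma EF_Some: "Some (x, y) \<in> EF \<longleftrightarrow> x \<in> F \<and> y \<in> F \<and> Some (x, y) \<in> E"
  by (auto simp: EF_def rat_points_def on_curve_def)

lemma EF_None: "None \<in> EF" by (auto simp: EF_def rat_points_def)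

lemma EF_sub: "P \<in> EF \<Longrightarrow> P \<in> E"
  using EF_Some by (cases P) auto

lemma EF_neg: "P \<in> EF \<Longrightarrow> neg P \<in> EF"
  by (cases P rule: neg.cases) (auto simp: EF_Some EF_None F_closed)

lemma EF_add: assumes "P \<in> EF" "Q \<in> EF" shows "P \<oplus> Q \<in> EF"
proof (cases P rule: neg.cases)
  case P1: (2 x1 y1)
  show ?thesis
  proof (cases Q rule: neg.cases)
    case Q2: (2 x2 y2)
    have E: "P \<oplus> Q \<in> E" using add_in_E assms EF_sub by blast
    have xy: "x1 \<in> F" "y1 \<in> F" "x2 \<in> F" "y2 \<in> F" using assms P1 Q2 by (auto simp: EF_Some)
    obtain l where "l \<in> F" and "P \<oplus> Q = None \<or> P \<oplus> Q = Some (l^2 - A - x1 - x2, - (l * (l^2 - A - x1 - x2 - x1) + y1))"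
    proof -
      have 1: "(3 * x1\<^sup>2 + 2 * A * x1 + B) / (2 * y1) \<in> F" "(y2 - y1) / (x2 - x1) \<in> F"
        using xy A_in B_in by (auto intro!: F_closed)
      consider "P = neg Q" | "x1 = x2" "y1 \<noteq> 0" "y1 = y2" | "x1 \<noteq> x2"
      proof -
        have "y1 = y2 \<or> y1 = - y2" if "x1 = x2"
          using assms P1 Q2 that by (simp add: EF_Some flip: power2_eq_iff)
        moreover have "P = neg Q" if "x1 = x2" "y1 = - y2" using P1 Q2 that by simp
        moreover have "P = neg Q" if "x1 = x2" "y1 = y2" "y1 = 0" using P1 Q2 that by simp
        ultimately show thesis using that by blast
      qed
      then show thesis
      proof cases
        case 1
        then show thesis using that[of 0] by simp
      next
        case 2
        then have "3*x1^2 + 2*A*x1 + B = (3 * x1\<^sup>2 + 2 * A * x1 + B) / (2 * y1) * (2 * y1)" by simp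
        from add_tangent[OF 2(2) this] show thesis using that 1(1) 2 P1 Q2 by simp
      next
        case 3
        then have "y2 - y1 = (y2 - y1) / (x2 - x1) * (x2 - x1)" by simp
        from add_chord[OF 3 this] show thesis using that 1(2) P1 Q2 by simp
      qed
    qed
    then show ?thesis using E xy A_in by (auto simp: EF_Some EF_None intro!: F_closed simp del: Some_in_E)
  qed (use assms P1 in simp)
qed (use assms in simp)

lemma EF_mult: "P \<in> EF \<Longrightarrow> mult n P \<in> EF"
  by (induction n) (auto intro: EF_add EF_None)

definition TF :: "wpoint set" where "TF = {P \<in> EF. torsion P}"

lemma torsion_points_eq: "torsion_points cf F = TF"
  using EF_sub by (auto simp: torsion_points_def TF_def torsion_def EF_def)

lemma TF_diff: "P \<in> TF \<Longrightarrow> Q \<in> TF \<Longrightarrow> P \<oplus> neg Q \<in> TF"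
  by (simp add: TF_def EF_add EF_neg torsion_diff)

text \<open>The threshold below which x outweighs the coefficients, with A of weight 1 and B of
  weight 2. The 0 in the minimum lets a bound \<open>c0\<close> on B imply the bound
  \<open>2 * c0\<close>.\<close>

definition c0 :: int where "c0 = min 0 (min (v A) (v B))"

lemma vg_AB: "vg c0 A" "vg (2 * c0) B" and c0_le: "c0 \<le> 0"
  using A_in B_in by (auto simp: c0_def vg_def)

text \<open>Below \<open>c0\<close> the term x^2 dominates B, and x^3 dominates the rest of the
  cubic, so the duplication formula has valuation 4 v x - (2 v 2 + 3 v x).\<close>

lemma double_escapes:
  assumes "Some (x, y) \<in> EF" "x \<noteq> 0" "v x < c0"
  obtains x' y' where "Some (x, y) \<oplus> Some (x, y) = Some (x', y')" "x' \<noteq> 0" "v x' = v x - 2 * v 2"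
proof -
  have F: "x \<in> F" "y \<in> F" using assms by (auto simp: EF_Some)
  have vx2: "v (x^2) = 2 * v x" using v_power[of x 2] F assms by simp
  have 1: "x^2 - B \<noteq> 0" "v (x^2 - B) = 2 * v x"
    using v_add_dominant[of "x^2" "2*c0" "- B"] vg_minus[OF vg_AB(2)] F assms vx2 by (auto simp: F_closed)
  have "vg (c0 + v x) (A * x + B)"
  proof (rule vg_add)
    have "vg (v x) x" using F by (simp add: vg_def)
    then show "vg (c0 + v x) (A * x)" using vg_mult[OF vg_AB(1)] by simp
    show "vg (c0 + v x) B" using vg_AB(2) by (rule vg_mono) (use assms in simp)
  qed
  from v_add_dominant[OF _ _ this, of "x^2"]
  have 2: "x^2 + (A * x + B) \<noteq> 0" "v (x^2 + (A * x + B)) = 2 * v x"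
    using F assms vx2 by (auto simp: F_closed)
  have fx: "x^3 + A*x^2 + B*x = x * (x^2 + (A * x + B))"
    by (simp add: algebra_simps power2_eq_square power3_eq_cube)
  then have nz: "x^3 + A*x^2 + B*x \<noteq> 0" using 2 assms by simp
  have vf: "v (x^3 + A*x^2 + B*x) = 3 * v x"
    unfolding fx using 2 assms F A_in B_in by (subst v_mult) (auto simp: F_closed)
  have "y^2 = x^3 + A*x^2 + B*x" using assms by (simp add: EF_Some)
  then have y: "y \<noteq> 0" using nz by auto
  have fF: "x^3 + A*x^2 + B*x \<in> F" "x^2 - B \<in> F" using F A_in B_in by (auto intro!: F_closed)
  have v4: "v 4 = 2 * v 2" using v_mult[of 2 2] by (simp add: F_closed)
  have v4f: "v (4 * (x^3 + A*x^2 + B*x)) = 2 * v 2 + 3 * v x"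
    using v_mult[of 4 "x^3 + A*x^2 + B*x"] nz fF v4 vf by (simp add: F_closed)
  have vn: "v ((x^2 - B)^2) = 4 * v x" using v_power[of "x^2 - B" 2] fF 1 by simp
  define x' where "x' = (x^2 - B)^2 / (4*(x^3 + A*x^2 + B*x))"
  define q where "q = 4*(x^3 + A*x^2 + B*x)"
  have q: "q \<in> F" "q \<noteq> 0" "v q = 2 * v 2 + 3 * v x"
    unfolding q_def using nz fF v4f by (auto intro!: F_closed simp del: distrib_left_numeral)
  have "v x' = v x - 2 * v 2" "x' \<noteq> 0"
    using v_divide[of "(x^2 - B)^2" q] fF 1 q vn
    unfolding x'_def q_def[symmetric] by (auto simp: F_closed)
  moreover obtain y' where "Some (x, y) \<oplus> Some (x, y) = Some (x', y')"
    using double_affine[of x y] y assms unfolding x'_def EF_Some by metis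
  ultimately show ?thesis using that by blast
qed

text \<open>Otherwise every doubling would lower the valuation of the abscissa by 2 v 2 > 0, and no
  two iterated doubles could agree, against \<open>torsion_double_repeat\<close>.\<close>

lemma torsion_x_bound: assumes "Some (x, y) \<in> TF" shows "vg c0 x"
proof (rule ccontr)
  assume "\<not> ?thesis"
  then have x: "x \<noteq> 0" "v x < c0" using assms by (auto simp: vg_def TF_def EF_Some)
  let ?P = "Some (x, y)"
  have P: "?P \<in> EF" "?P \<in> E" "torsion ?P" using assms EF_sub by (auto simp: TF_def simp del: Some_in_E)
  have it: "\<exists>x' y'. mult (2^i) ?P = Some (x', y') \<and> x' \<noteq> 0 \<and> v x' = v x - 2 * int i * v 2" for i
  proof (induction i)
    case 0
    then show ?case using x by simp
  next
    case (Suc i)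
    then obtain x' y' where IH: "mult (2^i) ?P = Some (x', y')" "x' \<noteq> 0" "v x' = v x - 2 * int i * v 2"
      by blast
    have "v x' < c0" using IH x v_two by (simp add: add_strict_increasing2 less_le_trans diff_less_eq)
    moreover have "Some (x', y') \<in> EF" using IH(1) EF_mult[OF P(1), of "2^i"] by simp
    ultimately obtain x'' y'' where "Some (x', y') \<oplus> Some (x', y') = Some (x'', y'')" "x'' \<noteq> 0" "v x'' = v x' - 2 * v 2"
      using double_escapes IH by metis
    moreover have "mult (2 ^ Suc i) ?P = mult (2^i) ?P \<oplus> mult (2^i) ?P"
      using mult_double[OF P(2), of "2^i"] by simp
    ultimately show ?case using IH by (auto simp: algebra_simps)
  qed
  obtain i j where ij: "i < j" "mult (2^i) ?P = mult (2^j) ?P" using torsion_double_repeat P(3) by metis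
  then have "v x - 2 * int i * v 2 = v x - 2 * int j * v 2" using it[of i] it[of j] by auto
  then show False using ij v_two by simp
qed

lemma torsion_y_bound: assumes "Some (x, y) \<in> TF" shows "vg (2 * c0) y"
proof -
  have x: "vg c0 x" by (rule torsion_x_bound[OF assms])
  have F: "y \<in> F" "y^2 = x * x * x + A * (x * x) + B * x"
    using assms by (auto simp: TF_def EF_Some power2_eq_square power3_eq_cube)
  have "vg (3 * c0) (y^2)"
    unfolding F(2)
    by (intro vg_add vg_mult[of "2*c0" _ c0] vg_mult[of c0 _ "2*c0"] vg_mult[of c0 x c0 x "2*c0"] x vg_AB) auto
  from vg_square_root[OF F(1) this] show ?thesis using c0_le by simp
qed

text \<open>A Bezout relation between the cubic and its derivative: they cannot both be very small.\<close>

lemma disc_bezout: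
  "4*B^2*(A^2 - 4*B) =
     ((15*(A*B) - 4*(A*A*A)) - (6*(A*A) - 18*B)*x) * (4*(x^3 + A*x^2 + B*x)) +
     4*((2*(A*A) - 6*B)*(x*x) + (2*(A*A*A) - 7*(A*B))*x + (A*A - 4*B)*B) * (3*x^2 + 2*A*x + B)"
  by (simp add: algebra_simps power2_eq_square power3_eq_cube)

text \<open>The precision that contradicts \<open>disc_bezout\<close>: closeness to order L0 would
  give its left-hand side valuation at least L0 + 5 c0, which exceeds the actual one because c0
  \<le> 0.\<close>

definition L0 :: nat where "L0 = nat (v (4*B^2*(A^2 - 4*B)) - 6 * c0 + 1)"

text \<open>P - Q is torsion, so its abscissa is bounded, and with it the slope l of the line
  through P and -Q. Then y1 + y2 = l (x1 - x2) is small along with y1 - y2, hence so is 2 y1. Four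
  times the cubic and the derivative are then both small at x1, against
  \<open>disc_bezout\<close>.\<close>

lemma torsion_separated:
  assumes "Some (x1, y1) \<in> TF" "Some (x2, y2) \<in> TF" "x1 \<noteq> x2"
    and dx: "vg (int L0) (x1 - x2)" and dy: "vg (int L0) (y1 - y2)"
  shows False
proof -
  define L where "L = int L0"
  have L: "L \<ge> 0" "L > v (4*B^2*(A^2 - 4*B)) - 6 * c0" by (auto simp: L_def L0_def)
  note c0 = c0_le
  have x: "vg c0 x1" "vg c0 x2" using torsion_x_bound assms by auto
  have F: "x1 \<in> F" "x2 \<in> F" "y1 \<in> F" "y2 \<in> F" and E: "Some (x1, y1) \<in> E" "Some (x2, y2) \<in> E"
    using assms by (auto simp: TF_def EF_Some)
  define l where "l = (y1 + y2) / (x1 - x2)"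
  have l: "l * (x1 - x2) = y1 + y2" using assms by (simp add: l_def)
  have "Some (x1, y1) \<oplus> neg (Some (x2, y2)) \<in> TF" using TF_diff assms by blast
  moreover have "Some (x1, y1) \<oplus> Some (x2, - y2) = Some (l^2 - A - x1 - x2, - (l * (l^2 - A - x1 - x2 - x1) + y1))"
    using l by (intro add_chord[OF assms(3)]) (simp add: algebra_simps)
  ultimately have "vg c0 (l^2 - A - x1 - x2)" using torsion_x_bound by (metis neg.simps(2))
  then have "vg c0 ((l^2 - A - x1 - x2) + A + x1 + x2)" using x vg_AB by (intro vg_add)
  then have "vg c0 (l^2)" by simp
  moreover have "l \<in> F" using F unfolding l_def by (intro F_closed)
  ultimately have vl: "vg c0 l" using vg_square_root[of l c0 c0] c0 by simp
  have sum: "vg (L + c0) (y1 + y2)"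
    unfolding l[symmetric] by (rule vg_mult[OF vl dx]) (simp add: L_def)
  have diff: "vg (L + c0) (y1 - y2)" using dy by (rule vg_mono) (use c0 in \<open>simp add: L_def\<close>)
  have "vg (L + c0) ((y1 + y2) + (y1 - y2))" using sum diff by (rule vg_add)
  then have "vg (L + c0) (2 * y1)" by simp
  from vg_mult[OF this this] have "vg (2 * (L + c0)) ((2 * y1) * (2 * y1))" by simp
  also have "(2 * y1) * (2 * y1) = 4 * (x1^3 + A*x1^2 + B*x1)"
    using E by (simp add: power2_eq_square)
  finally have f: "vg (2 * (L + c0)) (4 * (x1^3 + A*x1^2 + B*x1))" .
  \<comment> \<open>The divided difference of the cubic at x1 and x2. It equals l (y1 - y2), and
    differs from the derivative at x1 by a multiple of x1 - x2.\<close>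
  define g where "g = x1^2 + x1*x2 + x2^2 + A*(x1+x2) + B"
  have "(x1 - x2) * g = (x1^3 + A*x1^2 + B*x1) - (x2^3 + A*x2^2 + B*x2)"
    by (simp add: g_def algebra_simps power2_eq_square power3_eq_cube)
  also have "\<dots> = y1^2 - y2^2" using E by simp
  also have "\<dots> = (y1 + y2) * (y1 - y2)" by (simp add: algebra_simps power2_eq_square)
  also have "\<dots> = (x1 - x2) * (l * (y1 - y2))" unfolding l[symmetric] by (simp add: mult_ac)
  finally have "g = l * (y1 - y2)" using assms(3) by simp
  then have g: "vg (L + c0) g" using vg_mult[OF vl dy] by (simp add: L_def)
  have "vg c0 (2 * x1 + x2 + A)" using x vg_AB vg_numeral_mult by (intro vg_add)
  then have "vg (L + c0) ((x1 - x2) * (2 * x1 + x2 + A))" by (intro vg_mult[OF dx]) (auto simp: L_def)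
  then have "vg (L + c0) (g + (x1 - x2) * (2 * x1 + x2 + A))" using g by (intro vg_add)
  also have "g + (x1 - x2) * (2 * x1 + x2 + A) = 3*x1^2 + 2*A*x1 + B"
    by (simp add: g_def algebra_simps power2_eq_square)
  finally have f': "vg (L + c0) (3*x1^2 + 2*A*x1 + B)" .
  have AA: "vg (2*c0) (A * A)" by (rule vg_mult[OF vg_AB(1) vg_AB(1)]) auto
  have AAA: "vg (3*c0) (A * A * A)" by (rule vg_mult[OF AA vg_AB(1)]) auto
  have AB: "vg (3*c0) (A * B)" by (rule vg_mult[OF vg_AB]) auto
  have XX: "vg (2*c0) (x1 * x1)" by (rule vg_mult[OF x(1) x(1)]) auto
  have U: "vg (3*c0) ((15*(A*B) - 4*(A*A*A)) - (6*(A*A) - 18*B)*x1)"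
  proof (rule vg_diff)
    show "vg (3*c0) (15*(A*B) - 4*(A*A*A))" by (intro vg_diff vg_numeral_mult AB AAA)
    have "vg (2*c0) (6*(A*A) - 18*B)" by (intro vg_diff vg_numeral_mult AA vg_AB)
    from vg_mult[OF this x(1)] show "vg (3*c0) ((6*(A*A) - 18*B)*x1)" by simp
  qed
  have V: "vg (4*c0) ((2*(A*A) - 6*B)*(x1*x1) + (2*(A*A*A) - 7*(A*B))*x1 + (A*A - 4*B)*B)"
  proof (intro vg_add)
    have "vg (2*c0) (2*(A*A) - 6*B)" by (intro vg_diff vg_numeral_mult AA vg_AB)
    from vg_mult[OF this XX] show "vg (4*c0) ((2*(A*A) - 6*B)*(x1*x1))" by simp
    have "vg (3*c0) (2*(A*A*A) - 7*(A*B))" by (intro vg_diff vg_numeral_mult AB AAA)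
    from vg_mult[OF this x(1)] show "vg (4*c0) ((2*(A*A*A) - 7*(A*B))*x1)" by simp
    have "vg (2*c0) (A*A - 4*B)" by (intro vg_diff vg_numeral_mult AA vg_AB)
    from vg_mult[OF this vg_AB(2)] show "vg (4*c0) ((A*A - 4*B)*B)" by simp
  qed
  have "vg (L + 5*c0) (4*B^2*(A^2 - 4*B))"
    unfolding disc_bezout[of x1]
  proof (rule vg_add)
    show "vg (L + 5*c0) (((15*(A*B) - 4*(A*A*A)) - (6*(A*A) - 18*B)*x1) * (4*(x1^3 + A*x1^2 + B*x1)))"
      by (rule vg_mult[OF U f]) (use L in simp)
    show "vg (L + 5*c0) (4*((2*(A*A) - 6*B)*(x1*x1) + (2*(A*A*A) - 7*(A*B))*x1 + (A*A - 4*B)*B) * (3*x1^2 + 2*A*x1 + B))"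
      by (rule vg_mult[OF vg_numeral_mult[OF V] f']) simp
  qed
  moreover have "4*B^2*(A^2 - 4*B) \<noteq> 0" using B_nz disc_nz by simp
  ultimately show False using L c0 by (simp add: vg_def)
qed

text \<open>The bounded coordinates fall into finitely many classes at precision L0. An infinite
  class contains two points with different abscissae, because a fibre of x is finite, and these
  contradict \<open>torsion_separated\<close>.\<close>

lemma finite_torsion: "finite (torsion_points cf F)"
proof (rule ccontr)
  assume "infinite (torsion_points cf F)"
  then have "infinite TF" by (simp add: torsion_points_eq)
  then have inf: "infinite (TF - {None})" by simp
  define n where "n = nat (int L0 - 2 * c0)"
  have n: "2 * c0 + int n \<ge> int L0" by (simp add: n_def)
  define S where "S k = (SOME S. finite S \<and> S \<subseteq> F \<and>
       (\<forall>x\<in>F. (x \<noteq> 0 \<longrightarrow> v x \<ge> k) \<longrightarrow> (\<exists>s\<in>S. x = s \<or> v (x - s) \<ge> k + int n)))" for k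
  have S: "finite (S k) \<and> S k \<subseteq> F \<and>
       (\<forall>x\<in>F. (x \<noteq> 0 \<longrightarrow> v x \<ge> k) \<longrightarrow> (\<exists>s\<in>S k. x = s \<or> v (x - s) \<ge> k + int n))" for k
    unfolding S_def using net[of k n] by (rule someI_ex)
  have "\<exists>s\<in>S (2*c0). vg (int L0) (x - s)" if "vg (2*c0) x" for x
  proof -
    have "x \<in> F" "x \<noteq> 0 \<longrightarrow> v x \<ge> 2*c0" using that by (auto simp: vg_def)
    then obtain s where "s \<in> S (2*c0)" "x = s \<or> v (x - s) \<ge> 2*c0 + int n"
      using S[of "2*c0"] by blast
    then show ?thesis using n that S[of "2*c0"] by (intro bexI[of _ s]) (auto simp: vg_def F_closed)
  qed
  then obtain r where r: "\<And>x. vg (2*c0) x \<Longrightarrow> r x \<in> S (2*c0) \<and> vg (int L0) (x - r x)" by metis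
  define R where "R = (\<lambda>P. case P of None \<Rightarrow> (0, 0) | Some (x, y) \<Rightarrow> (r x, r y))"
  have xy: "vg (2*c0) x" "vg (2*c0) y" if "Some (x, y) \<in> TF" for x y
    using torsion_x_bound[OF that] torsion_y_bound[OF that] c0_le by (auto elim: vg_mono)
  have "R ` (TF - {None}) \<subseteq> S (2*c0) \<times> S (2*c0)"
    using xy r by (auto simp: R_def)
  then have "finite (R ` (TF - {None}))" using S[of "2*c0"] finite_subset by blast
  from pigeonhole_infinite[OF inf this]
  obtain P where P: "P \<in> TF - {None}" and s: "infinite {Q \<in> TF - {None}. R Q = R P}" by blast
  have "\<not> {Q \<in> TF - {None}. R Q = R P} \<subseteq> {Q \<in> E. Q \<noteq> None \<and> xc Q = xc P}"
    using finite_subset[OF _ finite_fibre_x[of "xc P"]] s by blast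
  then obtain Q where Q: "Q \<in> TF" "Q \<noteq> None" "R Q = R P" "xc Q \<noteq> xc P"
    using EF_sub unfolding TF_def by (auto simp del: not_None_eq)
  obtain x1 y1 where P1: "P = Some (x1, y1)" using P by auto
  obtain x2 y2 where Q2: "Q = Some (x2, y2)" using Q by auto
  have req: "r x1 = r x2" "r y1 = r y2" using P Q P1 Q2 by (auto simp: R_def)
  have T: "Some (x1, y1) \<in> TF" "Some (x2, y2) \<in> TF" using P Q P1 Q2 by auto
  have "vg (int L0) (x1 - r x1)" "vg (int L0) (x2 - r x2)" "vg (int L0) (y1 - r y1)" "vg (int L0) (y2 - r y2)"
    using r xy[OF T(1)] xy[OF T(2)] by auto
  then have "vg (int L0) ((x1 - r x1) - (x2 - r x2))" "vg (int L0) ((y1 - r y1) - (y2 - r y2))"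
    by (blast intro: vg_diff)+
  then show False using torsion_separated[of x1 y1 x2 y2] P Q P1 Q2 req by auto
qed

end

section \<open>Functions with a single pole\<close>

text \<open>Gaussian elimination: the equation \<open>e\<close> is solved for a pivot unknown
  \<open>k\<close>, which is substituted into the remaining equations.\<close>

lemma underdetermined_system:
  fixes c :: "'e \<Rightarrow> 'i \<Rightarrow> 'a::field"
  assumes "finite Q" "finite I" "card Q < card I"
  shows "\<exists>\<alpha>. (\<exists>i\<in>I. \<alpha> i \<noteq> 0) \<and> (\<forall>e\<in>Q. (\<Sum>i\<in>I. c e i * \<alpha> i) = 0)"
  using assms
proof (induction Q arbitrary: I c rule: finite_induct)
  case empty
  then have "I \<noteq> {}" by auto
  then show ?case by (intro exI[of _ "\<lambda>_. 1"]) auto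
next
  case (insert e Q)
  show ?case
  proof (cases "\<forall>i\<in>I. c e i = 0")
    case True
    obtain \<alpha> where "\<exists>i\<in>I. \<alpha> i \<noteq> 0" "\<forall>e\<in>Q. (\<Sum>i\<in>I. c e i * \<alpha> i) = 0"
      using insert.IH[of I c] insert.prems insert.hyps by auto
    then show ?thesis using True by (intro exI[of _ \<alpha>]) auto
  next
    case False
    then obtain k where k: "k \<in> I" "c e k \<noteq> 0" by auto
    define I' where "I' = I - {k}"
    have I': "finite I'" "card Q < card I'" "k \<notin> I'" "I = insert k I'"
      using insert.prems insert.hyps k by (auto simp: I'_def)
    obtain \<alpha> where \<alpha>: "\<exists>i\<in>I'. \<alpha> i \<noteq> 0" "\<forall>e'\<in>Q. (\<Sum>i\<in>I'. (c e' i - c e' k * c e i / c e k) * \<alpha> i) = 0"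
      using insert.IH[OF I'(1,2), of "\<lambda>e' i. c e' i - c e' k * c e i / c e k"] by auto
    define \<beta> where "\<beta> = \<alpha>(k := - (\<Sum>i\<in>I'. c e i * \<alpha> i) / c e k)"
    have sum: "(\<Sum>i\<in>I. c e' i * \<beta> i) = (\<Sum>i\<in>I'. c e' i * \<alpha> i) - c e' k * (\<Sum>i\<in>I'. c e i * \<alpha> i) / c e k" for e'
    proof -
      have "(\<Sum>i\<in>I'. c e' i * \<beta> i) = (\<Sum>i\<in>I'. c e' i * \<alpha> i)"
        using I'(3) by (intro sum.cong) (auto simp: \<beta>_def)
      then show ?thesis using I' by (simp add: \<beta>_def)
    qed
    have "(\<Sum>i\<in>I. c e' i * \<beta> i) = 0" if "e' \<in> Q" for e'
    proof -
      have "(\<Sum>i\<in>I'. (c e' i - c e' k * c e i / c e k) * \<alpha> i) = 0" using \<alpha> that by blast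
      then show ?thesis unfolding sum by (simp add: left_diff_distrib sum_subtractf sum_distrib_left sum_divide_distrib mult.assoc)
    qed
    moreover have "(\<Sum>i\<in>I. c e i * \<beta> i) = 0" using k by (simp add: sum)
    moreover have "\<exists>i\<in>I. \<beta> i \<noteq> 0" using \<alpha>(1) I' by (auto simp: \<beta>_def intro!: bexI)
    ultimately show ?thesis by blast
  qed
qed

section \<open>Weighted polynomials and division with remainder\<close>

locale graded =
  fixes S :: "int \<Rightarrow> 'a::field set"
  assumes S_0: "0 \<in> S k" and S_add: "x \<in> S k \<Longrightarrow> y \<in> S k \<Longrightarrow> x + y \<in> S k"
    and S_minus: "x \<in> S k \<Longrightarrow> - x \<in> S k"
    and S_mult: "x \<in> S k \<Longrightarrow> y \<in> S l \<Longrightarrow> x * y \<in> S (k + l)"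
begin

text \<open>X has weight 1. With the constant family \<open>lo 0\<close> this is just integrality of
  the coefficients; with \<open>hi (c * k)\<close>, weight 0 means a polynomial in t^-c X over
  Q[1/t].\<close>

definition Gr :: "int \<Rightarrow> 'a poly set" where "Gr w = {g. \<forall>j. coeff g j \<in> S (w - int j)}"

lemma S_sum: "(\<And>i. i \<in> I \<Longrightarrow> f i \<in> S k) \<Longrightarrow> sum f I \<in> S k"
  by (induction I rule: infinite_finite_induct) (auto intro: S_0 S_add)

lemma Gr_0: "0 \<in> Gr w" by (simp add: Gr_def S_0)

lemma Gr_add: "g \<in> Gr w \<Longrightarrow> h \<in> Gr w \<Longrightarrow> g + h \<in> Gr w"
  by (simp add: Gr_def S_add)

lemma Gr_minus: "g \<in> Gr w \<Longrightarrow> - g \<in> Gr w"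
  by (simp add: Gr_def S_minus)

lemma Gr_diff: "g \<in> Gr w \<Longrightarrow> h \<in> Gr w \<Longrightarrow> g - h \<in> Gr w"
  using Gr_add[of g w "- h"] Gr_minus by simp

lemma Gr_mult: assumes "g \<in> Gr w" "h \<in> Gr u" shows "g * h \<in> Gr (w + u)"
  unfolding Gr_def
proof (intro CollectI allI)
  fix j
  have "coeff g i * coeff h (j - i) \<in> S (w + u - int j)" if "i \<le> j" for i
  proof -
    have "coeff g i * coeff h (j - i) \<in> S ((w - int i) + (u - int (j - i)))"
      using assms by (intro S_mult) (auto simp: Gr_def)
    moreover have "(w - int i) + (u - int (j - i)) = w + u - int j" using that by simp
    ultimately show ?thesis by (simp only:)
  qed
  then show "coeff (g * h) j \<in> S (w + u - int j)" unfolding coeff_mult by (intro S_sum) auto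
qed

lemma Gr_monom: "x \<in> S (w - int j) \<Longrightarrow> monom x j \<in> Gr w"
  by (auto simp: Gr_def S_0)

text \<open>Each step of the division by a monic H subtracts the leading coefficient times a shift
  of H, which has the same weight as the dividend.\<close>

lemma Gr_division:
  assumes H: "H \<in> Gr (int n)" "degree H = n" "coeff H n = 1" and g: "g \<in> Gr w"
  shows "g div H \<in> Gr (w - int n) \<and> g mod H \<in> Gr w"
  using g
proof (induction "degree g" arbitrary: g rule: less_induct)
  case less
  have H0: "H \<noteq> 0" using H by auto
  show ?case
  proof (cases "g = 0 \<or> degree g < n")
    case True
    then have "g div H = 0" "g mod H = g" using H by (auto simp: div_poly_less mod_poly_less)
    then show ?thesis using less Gr_0 by simp
  next
    case False
    define m where "m = degree g - n"
    define q where "q = monom (lead_coeff g) m"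
    have q: "q \<in> Gr (w - int n)"
      unfolding q_def
    proof (rule Gr_monom)
      have "w - int n - int m = w - int (degree g)" using False by (simp add: m_def)
      moreover have "lead_coeff g \<in> S (w - int (degree g))" using less.prems by (simp add: Gr_def)
      ultimately show "lead_coeff g \<in> S (w - int n - int m)" by (simp only:)
    qed
    define h where "h = g - q * H"
    have h: "h \<in> Gr w" unfolding h_def using Gr_mult[OF q H(1)] less.prems by (intro Gr_diff) auto
    have ch: "coeff h (degree g) = 0"
      using False H by (simp add: h_def q_def coeff_monom_mult m_def)
    have dq: "degree (q * H) = degree g"
      using False H H0 by (simp add: q_def degree_mult_eq monom_eq_0_iff degree_monom_eq m_def)
    then have "degree h \<le> degree g" unfolding h_def by (intro degree_diff_le) auto
    then have "h = 0 \<or> degree h < degree g"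
      using ch leading_coeff_0_iff by (metis le_neq_implies_less)
    then have IH: "h div H \<in> Gr (w - int n) \<and> h mod H \<in> Gr w"
      using less.hyps[OF _ h] Gr_0 by (cases "h = 0") auto
    have g: "g = h + q * H" by (simp add: h_def)
    have "g div H = h div H + q" "g mod H = h mod H"
      unfolding g using H0 by (simp_all add: add.commute)
    then show ?thesis using IH q Gr_add by simp
  qed
qed

end

type_synonym L = "rat fls"

text \<open>Laurent series have finite principal parts, so \<open>lo m\<close> is t^m Q[[t]] while
  \<open>hi m\<close> is t^m Q[1/t] and consists of Laurent polynomials.\<close>

definition lo :: "int \<Rightarrow> L set" where "lo m = {f. \<forall>i<m. fls_nth f i = 0}"
definition hi :: "int \<Rightarrow> L set" where "hi m = {f. \<forall>i>m. fls_nth f i = 0}"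

lemma lo_iff: "f \<in> lo m \<longleftrightarrow> f = 0 \<or> fls_subdegree f \<ge> m"
proof
  assume "f \<in> lo m"
  then show "f = 0 \<or> fls_subdegree f \<ge> m" by (auto simp: lo_def intro: fls_subdegree_geI)
next
  assume "f = 0 \<or> fls_subdegree f \<ge> m"
  then show "f \<in> lo m" by (auto simp: lo_def)
qed

lemma lo_mono: "f \<in> lo m \<Longrightarrow> l \<le> m \<Longrightarrow> f \<in> lo l" by (auto simp: lo_def)
lemma hi_mono: "f \<in> hi m \<Longrightarrow> m \<le> l \<Longrightarrow> f \<in> hi l" by (auto simp: hi_def)
lemma lo_add: "f \<in> lo m \<Longrightarrow> g \<in> lo m \<Longrightarrow> f + g \<in> lo m" by (simp add: lo_def)
lemma hi_add: "f \<in> hi m \<Longrightarrow> g \<in> hi m \<Longrightarrow> f + g \<in> hi m" by (simp add: hi_def)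
lemma lo_minus: "f \<in> lo m \<Longrightarrow> - f \<in> lo m" by (simp add: lo_def)
lemma hi_minus: "f \<in> hi m \<Longrightarrow> - f \<in> hi m" by (simp add: hi_def)
lemma lo_diff: "f \<in> lo m \<Longrightarrow> g \<in> lo m \<Longrightarrow> f - g \<in> lo m" by (simp add: lo_def)
lemma lo_0 [simp]: "0 \<in> lo m" and hi_0 [simp]: "0 \<in> hi m" by (auto simp: lo_def hi_def)

lemma lo_mult: "f \<in> lo m \<Longrightarrow> g \<in> lo l \<Longrightarrow> f * g \<in> lo (m + l)"
  unfolding lo_iff by (cases "f = 0"; cases "g = 0") auto

lemma lo_multI: "f \<in> lo m \<Longrightarrow> g \<in> lo l \<Longrightarrow> k \<le> m + l \<Longrightarrow> f * g \<in> lo k"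
  using lo_mult lo_mono by blast

lemma hi_mult: assumes "f \<in> hi m" "g \<in> hi l" shows "f * g \<in> hi (m + l)"
  unfolding hi_def
proof (intro CollectI allI impI)
  fix n assume n: "n > m + l"
  have "fls_nth f i * fls_nth g (n - i) = 0" for i
    using assms n by (cases "i > m") (auto simp: hi_def)
  then show "fls_nth (f * g) n = 0" unfolding fls_times_nth(2) by (intro sum.neutral) simp
qed

lemma hi_multI: "f \<in> hi m \<Longrightarrow> g \<in> hi l \<Longrightarrow> m + l \<le> k \<Longrightarrow> f * g \<in> hi k"
  using hi_mult hi_mono by blast

lemma lo_sum: "(\<And>i. i \<in> I \<Longrightarrow> f i \<in> lo m) \<Longrightarrow> sum f I \<in> lo m"
  by (induction I rule: infinite_finite_induct) (auto intro: lo_add)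

lemma fls_const_lo: "m \<le> 0 \<Longrightarrow> fls_const q \<in> lo m" and fls_const_hi: "0 \<le> m \<Longrightarrow> fls_const q \<in> hi m"
  by (auto simp: lo_def hi_def)

lemma lo_power: "f \<in> lo 0 \<Longrightarrow> f ^ n \<in> lo 0"
  by (induction n) (use fls_const_lo[of 0 1] lo_mult[of f 0 _ 0] in auto)

lemma lo_poly: assumes "\<And>j. coeff g j \<in> lo m" "x \<in> lo 0" shows "poly g x \<in> lo m"
  unfolding poly_altdef by (intro lo_sum lo_multI[OF assms(1) lo_power[OF assms(2)]]) auto

lemma X_inv_power_nth: "fls_nth (fls_X_inv ^ i) k = (if k = - int i then 1 else (0::rat))"
  by (simp add: fls_X_inv_power_conv_shift_1)

lemma X_power_nth: "fls_nth (fls_X ^ i) k = (if k = int i then 1 else (0::rat))"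
  by (simp add: fls_X_power_conv_shift_1)

interpretation fc: comm_ring_map "fls_const :: rat \<Rightarrow> L"
  by standard (auto simp flip: fls_const_mult_const fls_plus_const)

lemma transcendental_of_lo:
  assumes "f \<in> lo 1" "f \<noteq> 0" "fc.ev p f = 0" shows "p = 0"
  using assms(3)
proof (induction p)
  case (pCons a p)
  have "fc.ev p f \<in> lo 0"
    unfolding fc.ev_def using assms(1)
    by (intro lo_poly) (auto simp: coeff_map_poly fls_const_lo intro: lo_mono)
  then have "f * fc.ev p f \<in> lo 1" using lo_mult[OF assms(1)] by fastforce
  then have "fls_nth (fls_const a + f * fc.ev p f) 0 = a" by (simp add: lo_def)
  moreover have "fls_const a + f * fc.ev p f = 0" using pCons.prems by simp
  ultimately have "a = 0" by simp
  then have "f * fc.ev p f = 0" using pCons.prems by simp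
  then show ?case using pCons.IH assms(2) \<open>a = 0\<close> by simp
qed simp

text \<open>Models Q(t, \<zeta>) inside Q((t)) by the minimal polynomial of \<zeta>. The bounds
  \<open>\<Phi>_lo\<close> make \<zeta> and its conjugates integral over Q[[t]]; the bounds
  \<open>\<Phi>_hi\<close> make t^-c \<zeta> integral over Q[1/t].\<close>

locale function_field =
  fixes \<Phi> :: "L poly" and \<zeta> :: L and n :: nat and c :: nat
  assumes n_pos: "n > 0" and deg_\<Phi>: "degree \<Phi> = n" and monic_\<Phi>: "coeff \<Phi> n = 1"
    and \<Phi>_lo: "\<And>j. coeff \<Phi> j \<in> lo 0" and \<Phi>_hi: "\<And>j. j \<le> n \<Longrightarrow> coeff \<Phi> j \<in> hi (int (c * (n - j)))"
    and root: "poly \<Phi> \<zeta> = 0" and \<zeta>_lo: "\<zeta> \<in> lo 0"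
    and minimal: "\<And>g. (\<And>j. \<exists>m. coeff g j \<in> hi m) \<Longrightarrow> degree g < n \<Longrightarrow> poly g \<zeta> = 0 \<Longrightarrow> g = 0"
begin

lemma \<Phi>_nz [simp]: "\<Phi> \<noteq> 0" using monic_\<Phi> by auto

text \<open>Over Q((t)) its roots are the conjugates of \<zeta> that belong to the other places
  above t = 0.\<close>

definition \<Psi> :: "L poly" where "\<Psi> = \<Phi> div [:- \<zeta>, 1:]"

lemma \<Phi>_eq: "\<Phi> = [:- \<zeta>, 1:] * \<Psi>"
proof -
  have "[:- \<zeta>, 1:] dvd \<Phi>" using root by (simp add: poly_eq_0_iff_dvd)
  then show ?thesis unfolding \<Psi>_def by (rule dvd_mult_div_cancel[symmetric])
qed

lemma \<Psi>_nz: "\<Psi> \<noteq> 0" using \<Phi>_eq \<Phi>_nz by auto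

lemma deg_\<Psi>: "degree \<Psi> = n - 1"
  using deg_\<Phi> degree_mult_eq[of "[:- \<zeta>, 1:]" \<Psi>] \<Psi>_nz unfolding \<Phi>_eq[symmetric] by simp

lemma monic_\<Psi>: "coeff \<Psi> (n - 1) = 1"
  using lead_coeff_mult[of "[:- \<zeta>, 1:]" \<Psi>] unfolding \<Phi>_eq[symmetric] by (simp add: deg_\<Phi> monic_\<Phi> deg_\<Psi>)

sublocale lo: graded "\<lambda>_. lo 0"
  by standard (auto intro: lo_add lo_minus lo_multI)

sublocale hi: graded "\<lambda>k. hi (int c * k)"
proof
  fix x y :: L and k l assume "x \<in> hi (int c * k)" "y \<in> hi (int c * l)"
  then show "x * y \<in> hi (int c * (k + l))" by (rule hi_multI) (simp add: algebra_simps)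
qed (auto intro: hi_add hi_minus)

lemma \<Psi>_lo: "coeff \<Psi> j \<in> lo 0"
proof -
  have "\<Phi> \<in> lo.Gr 0" using \<Phi>_lo by (simp add: lo.Gr_def)
  moreover have "coeff [:- \<zeta>, 1:] j \<in> lo 0" for j
    using \<zeta>_lo fls_const_lo[of 0 1] by (cases j; cases "j - 1") (auto simp: lo_minus)
  then have "[:- \<zeta>, 1:] \<in> lo.Gr (int 1)" by (simp add: lo.Gr_def)
  ultimately have "\<Psi> \<in> lo.Gr (0 - int 1)"
    using lo.Gr_division[of "[:- \<zeta>, 1:]" 1 \<Phi> 0] unfolding \<Psi>_def by auto
  then show ?thesis by (simp add: lo.Gr_def)
qed

text \<open>The functions that are regular except possibly at the place \<open>t = 0\<close> corresponding to \<open>\<zeta>\<close>: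
  the condition \<open>hi\<close> says that they are integral over \<open>\<rat>[1/t]\<close>, and integrality modulo \<open>\<Psi>\<close> that
  they are bounded at the other places above \<open>t = 0\<close>.\<close>

definition G :: "int \<Rightarrow> L poly set" where
  "G m = {g \<in> hi.Gr 0. degree g < n \<and> (\<forall>j. coeff (g mod \<Psi>) j \<in> lo m)}"

definition R :: "L set" where "R = (\<lambda>g. poly g \<zeta>) ` G 0"

lemma mod_\<Psi>: assumes "degree g < n" shows "g mod \<Psi> = g - smult (coeff g (n - 1)) \<Psi>"
proof -
  let ?h = "g - smult (coeff g (n - 1)) \<Psi>"
  have "degree ?h \<le> n - 1" using assms deg_\<Psi> n_pos by (intro degree_diff_le) (auto intro: degree_smult_le[THEN order_trans])
  moreover have "coeff ?h (n - 1) = 0" using monic_\<Psi> by simp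
  ultimately have "?h = 0 \<or> degree ?h < degree \<Psi>"
    using deg_\<Psi> leading_coeff_0_iff[of ?h] by (metis le_neq_implies_less)
  then have "?h mod \<Psi> = ?h" by (auto simp: mod_poly_less)
  moreover have "g mod \<Psi> = (?h + [:coeff g (n - 1):] * \<Psi>) mod \<Psi>" by simp
  ultimately show ?thesis by (simp only: mod_mult_self3 mod_mult_self1)
qed

lemma G_hi: assumes "g \<in> G m" shows "coeff g j \<in> hi 0"
proof -
  have "coeff g j \<in> hi (int c * (0 - int j))" using assms by (auto simp: G_def hi.Gr_def)
  then show ?thesis by (rule hi_mono) simp
qed

lemma poly_G_eq_0: "g \<in> G m \<Longrightarrow> poly g \<zeta> = 0 \<Longrightarrow> g = 0"
  using minimal[of g] G_hi[of g m] by (auto simp: G_def)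

lemma \<Phi>_Gr: "\<Phi> \<in> hi.Gr (int n)"
  unfolding hi.Gr_def
proof (intro CollectI allI)
  fix j show "coeff \<Phi> j \<in> hi (int c * (int n - int j))"
  proof (cases "j \<le> n")
    case True
    then show ?thesis using \<Phi>_hi[OF True] by (simp add: of_nat_diff)
  next
    case False
    then have "coeff \<Phi> j = 0" by (intro coeff_eq_0) (simp add: deg_\<Phi>)
    then show ?thesis by simp
  qed
qed

lemma G_times:
  assumes "g * h \<in> hi.Gr 0" "\<And>j. coeff (g mod \<Psi>) j \<in> lo 0" "\<And>j. coeff (h mod \<Psi>) j \<in> lo 0"
  shows "(g * h) mod \<Phi> \<in> G 0" "poly ((g * h) mod \<Phi>) \<zeta> = poly g \<zeta> * poly h \<zeta>"
proof -
  have 1: "(g * h) mod \<Phi> \<in> hi.Gr 0"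
    using assms(1) hi.Gr_division[OF \<Phi>_Gr deg_\<Phi> monic_\<Phi>] by blast
  have 2: "degree ((g * h) mod \<Phi>) < n"
    using degree_mod_less[of \<Phi> "g * h"] n_pos by (auto simp: deg_\<Phi>)
  have "\<Psi> dvd \<Phi>" using \<Phi>_eq by (metis dvd_triv_right)
  then have "(g * h) mod \<Phi> mod \<Psi> = (g * h) mod \<Psi>" by (rule mod_mod_cancel)
  also have "\<dots> = ((g mod \<Psi>) * (h mod \<Psi>)) mod \<Psi>" by (simp add: mod_mult_eq)
  finally have eq: "(g * h) mod \<Phi> mod \<Psi> = ((g mod \<Psi>) * (h mod \<Psi>)) mod \<Psi>" .
  have "g mod \<Psi> \<in> lo.Gr 0" "h mod \<Psi> \<in> lo.Gr 0" "\<Psi> \<in> lo.Gr (int (n - 1))"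
    using assms(2,3) \<Psi>_lo by (auto simp: lo.Gr_def)
  then have "((g mod \<Psi>) * (h mod \<Psi>)) mod \<Psi> \<in> lo.Gr (0 + 0)"
    using lo.Gr_division[of \<Psi> "n - 1"] lo.Gr_mult[of "g mod \<Psi>" 0 "h mod \<Psi>" 0] deg_\<Psi> monic_\<Psi> by blast
  then show "(g * h) mod \<Phi> \<in> G 0" using 1 2 eq by (simp add: G_def lo.Gr_def)
  have "poly (g * h) \<zeta> = poly ((g * h) div \<Phi> * \<Phi> + (g * h) mod \<Phi>) \<zeta>" by simp
  then show "poly ((g * h) mod \<Phi>) \<zeta> = poly g \<zeta> * poly h \<zeta>"
    unfolding poly_add poly_mult root by simp
qed

lemma R_mult: "x \<in> R \<Longrightarrow> y \<in> R \<Longrightarrow> x * y \<in> R"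
proof -
  assume "x \<in> R" "y \<in> R"
  then obtain g h where "g \<in> G 0" "x = poly g \<zeta>" "h \<in> G 0" "y = poly h \<zeta>" unfolding R_def by blast
  then show ?thesis unfolding R_def using G_times[of g h] hi.Gr_mult[of g 0 h 0] by (intro image_eqI[of _ _ "(g * h) mod \<Phi>"]) (auto simp: G_def)
qed

lemma G_add: "g \<in> G m \<Longrightarrow> h \<in> G m \<Longrightarrow> g + h \<in> G m"
  by (simp add: G_def hi.Gr_add poly_mod_add_left lo_add degree_add_less)

lemma R_add: "x \<in> R \<Longrightarrow> y \<in> R \<Longrightarrow> x + y \<in> R"
proof -
  assume "x \<in> R" "y \<in> R"
  then obtain g h where "g \<in> G 0" "x = poly g \<zeta>" "h \<in> G 0" "y = poly h \<zeta>" unfolding R_def by blast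
  then show ?thesis unfolding R_def by (intro image_eqI[of _ _ "g + h"]) (auto intro: G_add)
qed

lemma R_const: "fls_const q \<in> R"
  unfolding R_def
proof (rule image_eqI[of _ _ "[:fls_const q:]"])
  have 1: "[:fls_const q:] \<in> hi.Gr 0"
    using fls_const_hi by (auto simp: hi.Gr_def coeff_pCons split: nat.splits)
  have "[:fls_const q:] \<in> lo.Gr 0"
    using fls_const_lo by (auto simp: lo.Gr_def coeff_pCons split: nat.splits)
  moreover have "\<Psi> \<in> lo.Gr (int (n - 1))" using \<Psi>_lo by (auto simp: lo.Gr_def)
  ultimately have "[:fls_const q:] mod \<Psi> \<in> lo.Gr 0"
    using lo.Gr_division[of \<Psi> "n - 1"] deg_\<Psi> monic_\<Psi> by blast
  then show "[:fls_const q:] \<in> G 0" using 1 n_pos by (simp add: G_def lo.Gr_def)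
qed simp

lemma R_ev: assumes "x \<in> R" shows "fc.ev p x \<in> R"
  by (induction p) (use R_const[of 0] assms in \<open>auto intro: R_add R_mult R_const\<close>)

text \<open>Separability: \<open>\<Psi>\<close> agrees with the derivative of \<open>\<Phi>\<close>
  at \<zeta>, and in characteristic 0 this derivative is a nonzero polynomial of degree below
  n.\<close>

lemma poly_\<Psi>_\<zeta>: "poly \<Psi> \<zeta> \<noteq> 0"
proof
  assume 0: "poly \<Psi> \<zeta> = 0"
  have "pderiv \<Phi> = \<Psi> + [:- \<zeta>, 1:] * pderiv \<Psi>"
  proof -
    have "pderiv \<Phi> = pderiv ([:- \<zeta>, 1:] * \<Psi>)" by (subst \<Phi>_eq) (rule refl)
    also have "\<dots> = \<Psi> + [:- \<zeta>, 1:] * pderiv \<Psi>" by (subst pderiv_mult) (simp add: pderiv_pCons)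
    finally show ?thesis .
  qed
  then have "poly (pderiv \<Phi>) \<zeta> = 0" using 0 by simp
  moreover have "\<exists>m. coeff (pderiv \<Phi>) j \<in> hi m" for j
  proof -
    obtain m where "coeff \<Phi> (Suc j) \<in> hi m"
      using \<Phi>_Gr unfolding hi.Gr_def by blast
    then have "fls_const (of_nat (Suc j)) * coeff \<Phi> (Suc j) \<in> hi (0 + m)" by (intro hi_mult fls_const_hi) auto
    then show ?thesis by (auto simp: coeff_pderiv fls_of_nat)
  qed
  moreover have "degree (pderiv \<Phi>) < n" using n_pos by (simp add: degree_pderiv deg_\<Phi>)
  ultimately have "pderiv \<Phi> = 0" using minimal by blast
  then have "coeff (pderiv \<Phi>) (n - 1) = 0" by simp
  then show False using n_pos monic_\<Phi> by (simp add: coeff_pderiv)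
qed

text \<open>Write g as its remainder plus l \<open>\<Psi>\<close>. Evaluating at \<zeta> bounds l
  times the value of \<open>\<Psi>\<close>, so the pole order of l is at most the order e of that
  value.\<close>

lemma bounded_coeffs:
  obtains e :: nat where "\<And>g j. g \<in> G 0 \<Longrightarrow> poly g \<zeta> \<in> lo 0 \<Longrightarrow> coeff g j \<in> lo (- int e)"
proof
  define e where "e = nat (fls_subdegree (poly \<Psi> \<zeta>))"
  have "poly \<Psi> \<zeta> \<in> lo 0" by (rule lo_poly[OF \<Psi>_lo \<zeta>_lo])
  then have e: "fls_subdegree (poly \<Psi> \<zeta>) = int e" using poly_\<Psi>_\<zeta> by (simp add: lo_iff e_def)
  fix g j assume g: "g \<in> G 0" "poly g \<zeta> \<in> lo 0"
  define l where "l = coeff g (n - 1)"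
  have md: "g mod \<Psi> = g - smult l \<Psi>" using mod_\<Psi>[of g] g by (simp add: G_def l_def)
  have "l * poly \<Psi> \<zeta> = poly g \<zeta> - poly (g mod \<Psi>) \<zeta>" unfolding md by simp
  also have "\<dots> \<in> lo 0" by (rule lo_diff[OF g(2) lo_poly[OF _ \<zeta>_lo]]) (use g in \<open>auto simp: G_def\<close>)
  finally have l: "l \<in> lo (- int e)" using poly_\<Psi>_\<zeta> e by (cases "l = 0") (auto simp: lo_iff)
  have "coeff g j = coeff (g mod \<Psi>) j + l * coeff \<Psi> j" unfolding md by simp
  also have "\<dots> \<in> lo (- int e)"
    using g l \<Psi>_lo by (intro lo_add lo_multI[OF l \<Psi>_lo]) (auto simp: G_def intro: lo_mono)
  finally show "coeff g j \<in> lo (- int e)" .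
qed

text \<open>A function without poles is constant: its powers lie in a finite-dimensional space.\<close>

lemma R_lo_1: assumes "x \<in> R" "x \<in> lo 1" shows "x = 0"
proof (rule ccontr)
  assume x: "x \<noteq> 0"
  obtain e :: nat where e: "\<And>g j. g \<in> G 0 \<Longrightarrow> poly g \<zeta> \<in> lo 0 \<Longrightarrow> coeff g j \<in> lo (- int e)"
    using bounded_coeffs by metis
  have "\<exists>g \<in> G 0. poly g \<zeta> = x ^ i" for i
  proof -
    have "x ^ i \<in> R" using R_ev[OF assms(1), of "monom 1 i"] by simp
    then show ?thesis by (auto simp: R_def)
  qed
  then obtain g where g: "\<And>i. g i \<in> G 0" "\<And>i. poly (g i) \<zeta> = x ^ i" by metis
  have xi: "x ^ i \<in> lo 0" for i using assms(2) by (intro lo_power) (auto intro: lo_mono)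
  \<comment> \<open>Coefficients in \<open>hi 0\<close> and \<open>lo (- int e)\<close> have
    exponents from -e to 0, so n (e + 1) linear conditions force h = 0; one more power of x than
    that is used.\<close>
  define Q where "Q = {..<n} \<times> {..e}"
  define I where "I = {..n * Suc e}"
  have "card Q < card I" by (simp add: Q_def I_def)
  then obtain \<alpha> where \<alpha>: "\<exists>i\<in>I. \<alpha> i \<noteq> 0"
    "\<forall>p\<in>Q. (\<Sum>i\<in>I. fls_nth (coeff (g i) (fst p)) (- int (snd p)) * \<alpha> i) = 0"
    using underdetermined_system[of Q I "\<lambda>p i. fls_nth (coeff (g i) (fst p)) (- int (snd p))"]
    by (auto simp: Q_def I_def)
  define p where "p = (\<Sum>i\<in>I. monom (\<alpha> i) i)"
  define h where "h = (\<Sum>i\<in>I. smult (fls_const (\<alpha> i)) (g i))"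
  have "h = 0"
  proof (intro poly_eqI fls_eqI)
    fix j k
    have nth: "fls_nth (coeff h j) k = (\<Sum>i\<in>I. fls_nth (coeff (g i) j) k * \<alpha> i)"
      by (simp add: h_def coeff_sum fls_nth_sum fls_mult_const_nth mult.commute)
    have "(\<Sum>i\<in>I. fls_nth (coeff (g i) j) k * \<alpha> i) = 0"
    proof (cases "j < n \<and> k \<le> 0 \<and> k \<ge> - int e")
      case True
      then have "(j, nat (- k)) \<in> Q" by (auto simp: Q_def)
      then show ?thesis using \<alpha>(2) True by force
    next
      case False
      have "fls_nth (coeff (g i) j) k = 0" for i
      proof -
        consider "j \<ge> n" | "k > 0" | "k < - int e" using False by linarith
        then show ?thesis
        proof cases
          case 1
          then have "coeff (g i) j = 0" using g(1)[of i] by (intro coeff_eq_0) (auto simp: G_def)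
          then show ?thesis by simp
        next
          case 2
          then show ?thesis using G_hi[OF g(1)[of i], of j] by (simp add: hi_def)
        next
          case 3
          then show ?thesis using e[OF g(1)[of i], of j] g(2) xi by (simp add: lo_def)
        qed
      qed
      then show ?thesis by simp
    qed
    then show "fls_nth (coeff h j) k = fls_nth (coeff 0 j) k" unfolding nth by simp
  qed
  have "fc.ev p x = poly h \<zeta>" by (simp add: p_def h_def fc.ev_sum poly_sum g)
  then have "p = 0" using transcendental_of_lo[OF assms(2) x] \<open>h = 0\<close> by simp
  moreover have "coeff p i = \<alpha> i" if "i \<in> I" for i
    using that by (simp add: p_def coeff_sum I_def)
  ultimately show False using \<alpha>(1) by (metis coeff_0)
qed

text \<open>Dimension count of Riemann type. The unknowns are the coefficients of t^-i X^j with j <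
  n and c n \<le> i \<le> k, where the lower bound on i secures \<open>hi.Gr 0\<close>; their number
  is n (k + 1) - c n^2. The conditions are the vanishing of n - 1 coefficients of g mod
  \<open>\<Psi>\<close> at the exponents from -k to m - 1, and one more for each element of
  D.\<close>

lemma G_exists:
  fixes m k :: nat
  assumes D: "finite D" and k: "c * n \<le> k" and less: "card D + (n - 1) * (k + m) + c * n * n < n * (k + 1)"
  obtains g where "g \<in> G (int m)" "g \<noteq> 0" "poly g \<zeta> \<in> lo (- int k)"
    "\<And>i. i \<in> D \<Longrightarrow> fls_nth (poly g \<zeta>) (- int i) = 0"
proof -
  define I where "I = {..<n} \<times> {c*n..k}"
  have finI: "finite I" by (simp add: I_def)
  define Bm where "Bm = (\<lambda>p. monom (fls_X_inv ^ snd p :: L) (fst p))"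
  \<comment> \<open>The coefficients of g mod \<open>\<Psi>\<close> in a form linear in g, by
    \<open>mod_\<Psi>\<close>. The one at n - 1 vanishes automatically because \<open>\<Psi>\<close>
    is monic.\<close>
  define M where "M = (\<lambda>g j. coeff g j - coeff g (n - 1) * coeff \<Psi> j)"
  define Q :: "(nat \<times> nat + nat) set" where "Q = Inl ` ({..<n-1} \<times> {..<k+m}) \<union> Inr ` D"
  define E where "E = (\<lambda>e p. case e of Inl (j, q) \<Rightarrow> fls_nth (M (Bm p) j) (int q - int k)
     | Inr i \<Rightarrow> fls_nth (poly (Bm p) \<zeta>) (- int i))"
  have "card Q \<le> (n-1) * (k+m) + card D"
    unfolding Q_def using D by (intro order_trans[OF card_Un_le] add_mono) (auto simp: card_image_le[THEN order_trans] card_image inj_on_def)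
  moreover have "card I = n * (k + 1 - c*n)" by (simp add: I_def)
  moreover have "n * (k + 1 - c*n) = n * (k + 1) - c * n * n" by (simp add: diff_mult_distrib2 mult_ac)
  ultimately have "card Q < card I" using less by linarith
  then obtain \<alpha> where \<alpha>: "\<exists>p\<in>I. \<alpha> p \<noteq> 0" "\<forall>e\<in>Q. (\<Sum>p\<in>I. E e p * \<alpha> p) = 0"
    using underdetermined_system[of Q I E] D finI by (auto simp: Q_def)
  define g where "g = (\<Sum>p\<in>I. smult (fls_const (\<alpha> p)) (Bm p))"
  have cg: "coeff g j = (\<Sum>p\<in>I. fls_const (\<alpha> p) * coeff (Bm p) j)" for j
    by (simp add: g_def coeff_sum)
  have nth_g: "fls_nth (coeff g j) i = (\<Sum>p\<in>I. if p = (j, nat (-i)) \<and> i \<le> 0 then \<alpha> p else 0)" for i j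
    unfolding cg by (auto simp: fls_nth_sum fls_mult_const_nth Bm_def X_inv_power_nth prod_eq_iff intro!: sum.cong)
  have nth_in: "fls_nth (coeff g j) i = \<alpha> (j, nat (-i))" if "(j, nat (-i)) \<in> I" "i \<le> 0" for i j
    unfolding nth_g using that finI by simp
  have nth_out: "fls_nth (coeff g j) i = 0" if "(j, nat (-i)) \<notin> I \<or> i > 0" for i j
    unfolding nth_g using that by (intro sum.neutral) auto
  have g0: "g \<noteq> 0"
  proof
    assume "g = 0"
    obtain p where p: "p \<in> I" "\<alpha> p \<noteq> 0" using \<alpha>(1) by blast
    then show False using nth_in[of "fst p" "- int (snd p)"] \<open>g = 0\<close> by simp
  qed
  have hiG: "g \<in> hi.Gr 0"
    unfolding hi.Gr_def
  proof (intro CollectI allI)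
    fix j show "coeff g j \<in> hi (int c * (0 - int j))"
      unfolding hi_def
    proof (intro CollectI allI impI)
    fix i assume i: "int c * (0 - int j) < i"
    show "fls_nth (coeff g j) i = 0"
    proof (rule nth_out, rule ccontr)
      assume "\<not> ((j, nat (-i)) \<notin> I \<or> i > 0)"
      then have "j < n" "c * n \<le> nat (- i)" "i \<le> 0" by (auto simp: I_def)
      then have "int (c * n) \<le> - i" by (simp only: le_nat_iff)
      moreover have "int c * int j \<le> int (c * n)" using \<open>j < n\<close> by (simp flip: of_nat_mult)
      ultimately show False using i by simp
    qed
    qed
  qed
  have lok: "coeff g j \<in> lo (- int k)" for j
    unfolding lo_def
  proof (intro CollectI allI impI)
    fix i assume i: "i < - int k"
    show "fls_nth (coeff g j) i = 0" by (rule nth_out) (use i in \<open>auto simp: I_def\<close>)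
  qed
  have degg: "degree g < n"
  proof (rule ccontr)
    assume "\<not> ?thesis"
    then have "coeff g (degree g) = 0"
    proof (intro fls_eqI)
      fix i show "fls_nth (coeff g (degree g)) i = fls_nth 0 i"
        using nth_out[of "degree g" i] \<open>\<not> degree g < n\<close> by (simp add: I_def)
    qed
    then show False using g0 by simp
  qed
  have "coeff (g mod \<Psi>) j = M g j" for j unfolding mod_\<Psi>[OF degg] by (simp add: M_def)
  moreover have "M g j \<in> lo (int m)" for j
    unfolding lo_def
  proof (intro CollectI allI impI)
    fix i assume i: "i < int m"
    show "fls_nth (M g j) i = 0"
    proof (cases "j < n - 1")
      case False
      then consider "j = n - 1" | "j \<ge> n" by linarith
      then have "M g j = 0"
      proof cases
        case 2
        then have "coeff g j = 0" "coeff \<Psi> j = 0" using degg deg_\<Psi> n_pos by (auto intro!: coeff_eq_0)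
        then show ?thesis by (simp add: M_def)
      qed (simp add: M_def monic_\<Psi>[simplified])
      then show ?thesis by simp
    next
      case j: True
      show ?thesis
      proof (cases "i < - int k")
        case True
        have "M g j \<in> lo (- int k)" unfolding M_def
          by (intro lo_diff lok lo_multI[OF lok \<Psi>_lo]) simp
        then show ?thesis using True by (simp add: lo_def)
      next
        case False
        define q where "q = nat (i + int k)"
        have q: "int q - int k = i" "q < k + m" using False i by (auto simp: q_def)
        have "Inl (j, q) \<in> Q" using j q by (auto simp: Q_def)
        then have "(\<Sum>p\<in>I. E (Inl (j, q)) p * \<alpha> p) = 0" using \<alpha>(2) by blast
        moreover have "M g j = (\<Sum>p\<in>I. fls_const (\<alpha> p) * M (Bm p) j)"
        proof -
          have "coeff g (n - 1) * coeff \<Psi> j = (\<Sum>p\<in>I. fls_const (\<alpha> p) * (coeff (Bm p) (n - 1) * coeff \<Psi> j))"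
            by (simp only: cg sum_distrib_right mult.assoc)
          then show ?thesis by (simp only: M_def cg[of j] sum_subtractf right_diff_distrib)
        qed
        then have "fls_nth (M g j) i = (\<Sum>p\<in>I. \<alpha> p * fls_nth (M (Bm p) j) i)"
          by (simp only: fls_nth_sum fls_mult_const_nth)
        then have "fls_nth (M g j) i = (\<Sum>p\<in>I. E (Inl (j, q)) p * \<alpha> p)"
          by (simp only: E_def sum.case prod.case q(1) mult.commute)
        ultimately show ?thesis by simp
      qed
    qed
  qed
  ultimately have "g \<in> G (int m)" using hiG degg by (simp add: G_def)
  moreover have "poly g \<zeta> \<in> lo (- int k)" by (rule lo_poly[OF lok \<zeta>_lo])
  moreover have "fls_nth (poly g \<zeta>) (- int i) = 0" if "i \<in> D" for i
  proof -
    have "(\<Sum>p\<in>I. E (Inr i) p * \<alpha> p) = 0" using \<alpha>(2) that by (auto simp: Q_def)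
    moreover have "poly g \<zeta> = (\<Sum>p\<in>I. fls_const (\<alpha> p) * poly (Bm p) \<zeta>)" by (simp add: g_def poly_sum)
    then have "fls_nth (poly g \<zeta>) (- int i) = (\<Sum>p\<in>I. E (Inr i) p * \<alpha> p)"
      by (simp only: fls_nth_sum fls_mult_const_nth E_def sum.case mult.commute)
    ultimately show ?thesis by simp
  qed
  ultimately show ?thesis using that[of g] g0 by blast
qed

lemma G_mono: "g \<in> G m \<Longrightarrow> l \<le> m \<Longrightarrow> g \<in> G l"
  by (auto simp: G_def intro: lo_mono)

text \<open>If \<open>D\<close> consists of all pole orders up to \<open>k\<close> that occur, a function whose coefficients of
  orders in \<open>D\<close> all vanish cannot exist; so by \<open>G_exists\<close> few orders are missing.\<close>

lemma finite_gaps: "finite {d::nat. \<not> (\<exists>x\<in>R. x \<noteq> 0 \<and> fls_subdegree x = - int d)}" (is "finite ?M")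
proof (rule ccontr)
  assume "infinite ?M"
  \<comment> \<open>With c n^2 + 1 gaps up to k the set D has k - c n^2 elements, and the inequality
    of \<open>G_exists\<close> for m = 0 becomes n k < n (k + 1).\<close>
  then have "\<exists>M. finite M \<and> card M = c * n * n + 1 \<and> M \<subseteq> ?M"
    by (rule infinite_arbitrarily_large)
  then obtain M where M: "M \<subseteq> ?M" "finite M" "card M = c * n * n + 1" by (elim exE conjE)
  define k where "k = Max (insert (c * n) M)"
  have k: "c * n \<le> k" "M \<subseteq> {..k}" using M(2) by (auto simp: k_def)
  define D where "D = {..k} - M"
  have cD: "card D = k + 1 - (c * n * n + 1)" using M k by (simp add: D_def card_Diff_subset)
  have "c * n * n + 1 \<le> k + 1" using card_mono[OF _ k(2)] M by simp
  then have "card D + (n - 1) * (k + 0) + c * n * n < n * (k + 1)"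
    using n_pos unfolding cD by (cases n) auto
  from G_exists[OF _ k(1) this] obtain g where g: "g \<in> G (int 0)" "g \<noteq> 0" "poly g \<zeta> \<in> lo (- int k)"
    "\<And>i. i \<in> D \<Longrightarrow> fls_nth (poly g \<zeta>) (- int i) = 0" by (auto simp: D_def)
  let ?x = "poly g \<zeta>"
  have x: "?x \<in> R" "?x \<noteq> 0" using g poly_G_eq_0[of g 0] by (auto simp: R_def)
  have "\<not> 1 \<le> fls_subdegree ?x" using R_lo_1[OF x(1)] x(2) by (auto simp: lo_iff)
  then have "fls_subdegree ?x \<le> 0" by simp
  then obtain d where d: "fls_subdegree ?x = - int d" by (metis nonpos_int_cases)
  have "d \<le> k" using g(3) x(2) d by (simp add: lo_iff)
  have "d \<notin> M" using M(1) x d by auto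
  then have "d \<in> D" using \<open>d \<le> k\<close> by (simp add: D_def)
  from g(4)[OF this] have "fls_nth ?x (fls_subdegree ?x) = 0" by (simp add: d)
  then show False using x(2) by simp
qed

text \<open>Exhibits 1/t and t^-c \<zeta> as quotients of elements of R. A function r whose
  remainder modulo \<open>\<Psi>\<close> is divisible by t^(c+1) absorbs the poles that the factors
  1/t and t^-c create at the other places above t = 0.\<close>

lemma R_fractions:
  obtains r where "r \<in> R" "r \<noteq> 0" "fls_X_inv * r \<in> R" "fls_X_inv ^ c * \<zeta> * r \<in> R"
proof -
  \<comment> \<open>Large enough for the count with D empty and m = c + 1; the summand c n secures
    the condition c n \<le> k.\<close>
  define k where "k = (n - 1) * (c + 1) + c * n * n + c * n"
  have "card {} + (n - 1) * (k + (c + 1)) + c * n * n < n * (k + 1)"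
  proof -
    obtain n' where n': "n = Suc n'" using n_pos by (cases n) auto
    have "n' * (c + 1) + c * n * n \<le> k" by (simp add: k_def n')
    then show ?thesis unfolding n' by (simp add: algebra_simps)
  qed
  from G_exists[OF _ _ this] obtain g where g: "g \<in> G (int (c + 1))" "g \<noteq> 0" by (auto simp: k_def)
  have g0: "g \<in> G 0" using G_mono[OF g(1)] by simp
  have "poly g \<zeta> \<in> R" "poly g \<zeta> \<noteq> 0" using g0 g(2) poly_G_eq_0 by (auto simp: R_def)
  have s_lo: "(fls_X_inv ^ i :: L) \<in> lo (- int i)" and s_hi: "(fls_X_inv ^ i :: L) \<in> hi (- int i)" for i
    by (auto simp: lo_def hi_def X_inv_power_nth)
  have sm: "coeff (smult (fls_X_inv ^ i) g mod \<Psi>) j \<in> lo 0" if "i \<le> c + 1" for i j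
  proof -
    have "coeff (g mod \<Psi>) j \<in> lo (int (c + 1))" using g by (auto simp: G_def)
    then have "fls_X_inv ^ i * coeff (g mod \<Psi>) j \<in> lo 0"
      using that by (intro lo_multI[OF s_lo]) auto
    then show ?thesis by (simp add: mod_smult_left)
  qed
  have "smult fls_X_inv g \<in> hi.Gr 0"
    unfolding hi.Gr_def
  proof (intro CollectI allI)
    fix j
    have "coeff g j \<in> hi (int c * (0 - int j))" using g by (auto simp: G_def hi.Gr_def)
    then show "coeff (smult fls_X_inv g) j \<in> hi (int c * (0 - int j))"
      using hi_multI[OF s_hi[of 1], of "coeff g j"] by simp
  qed
  then have "smult fls_X_inv g \<in> G 0"
    using g sm[of 1] by (auto simp: G_def intro: le_less_trans[OF degree_smult_le])
  then have "poly (smult fls_X_inv g) \<zeta> \<in> R" unfolding R_def by (rule imageI)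
  then have 1: "fls_X_inv * poly g \<zeta> \<in> R" by simp
  have "[:0, fls_X_inv ^ c:] \<in> hi.Gr 0"
    unfolding hi.Gr_def
  proof (intro CollectI allI)
    fix j show "coeff [:0, fls_X_inv ^ c:] j \<in> hi (int c * (0 - int j))"
      using s_hi[of c] by (cases j; cases "j - 1") auto
  qed
  then have "[:0, fls_X_inv ^ c:] * g \<in> hi.Gr (0 + 0)" using g by (intro hi.Gr_mult) (auto simp: G_def)
  moreover have eq: "[:0, fls_X_inv ^ c:] * g = [:0, 1:] * smult (fls_X_inv ^ c) g" by simp
  ultimately have "[:0, 1:] * smult (fls_X_inv ^ c) g \<in> hi.Gr 0" by simp
  moreover have "coeff ([:0, 1:] mod \<Psi>) j \<in> lo 0" for j
  proof -
    have "coeff [:0, 1 :: L:] j \<in> lo 0" for j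
      using fls_const_lo[of 0 1] by (cases j; cases "j - 1") auto
    then have "[:0, 1:] mod \<Psi> \<in> lo.Gr 0"
      using lo.Gr_division[of \<Psi> "n - 1" "[:0, 1:]" 0] \<Psi>_lo deg_\<Psi> monic_\<Psi> by (auto simp: lo.Gr_def)
    then show ?thesis by (simp add: lo.Gr_def)
  qed
  ultimately have mem: "([:0, 1:] * smult (fls_X_inv ^ c) g) mod \<Phi> \<in> G 0" and
    val: "poly (([:0, 1:] * smult (fls_X_inv ^ c) g) mod \<Phi>) \<zeta> = poly [:0, 1:] \<zeta> * poly (smult (fls_X_inv ^ c) g) \<zeta>"
    using G_times[of "[:0, 1:]" "smult (fls_X_inv ^ c) g"] sm[of c] by auto
  from imageI[OF mem, of "\<lambda>g. poly g \<zeta>"] have "fls_X_inv ^ c * \<zeta> * poly g \<zeta> \<in> R"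
    unfolding R_def val by (simp add: mult_ac)
  then show ?thesis using that 1 \<open>poly g \<zeta> \<in> R\<close> \<open>poly g \<zeta> \<noteq> 0\<close> by blast
qed

end

section \<open>Algebra over Q(f) by comparison of pole orders\<close>

lemma subdegree_add_dominant:
  fixes x y :: L
  assumes "x \<noteq> 0" "y \<in> lo (fls_subdegree x + 1)"
  shows "x + y \<noteq> 0" "fls_subdegree (x + y) = fls_subdegree x"
proof -
  have "fls_nth (x + y) (fls_subdegree x) = fls_nth x (fls_subdegree x)" using assms(2) by (simp add: lo_def)
  then have nz: "fls_nth (x + y) (fls_subdegree x) \<noteq> 0" using assms(1) by simp
  then show "x + y \<noteq> 0" by (metis fls_zero_nth)
  show "fls_subdegree (x + y) = fls_subdegree x"
    using nz by (rule fls_subdegree_eqI) (use assms(2) in \<open>auto simp: lo_def\<close>)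
qed

lemma sum_dominant:
  fixes x :: "'i \<Rightarrow> L"
  assumes "finite I" "k \<in> I" "x k \<noteq> 0" "\<And>i. i \<in> I \<Longrightarrow> i \<noteq> k \<Longrightarrow> x i \<in> lo (fls_subdegree (x k) + 1)"
  shows "sum x I \<noteq> 0"
proof -
  have "sum x I = x k + sum x (I - {k})" using assms by (simp add: sum.remove)
  moreover have "sum x (I - {k}) \<in> lo (fls_subdegree (x k) + 1)" using assms by (intro lo_sum) auto
  ultimately show ?thesis using subdegree_add_dominant(1)[OF assms(3)] by metis
qed

lemma ev_subdegree:
  assumes "d > 0" "fls_subdegree f = - int d" "p \<noteq> 0"
  shows "fc.ev p f \<noteq> 0 \<and> fls_subdegree (fc.ev p f) = - int (d * degree p)"
  using assms(3)
proof (induction p)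
  case (pCons a p)
  have f: "f \<noteq> 0" using assms by auto
  show ?case
  proof (cases "p = 0")
    case True
    then show ?thesis using pCons by simp
  next
    case False
    then have IH: "fc.ev p f \<noteq> 0" "fls_subdegree (fc.ev p f) = - int (d * degree p)" using pCons.IH by auto
    have sd: "fls_subdegree (f * fc.ev p f) = - int (d * Suc (degree p))" using IH f assms by simp
    have "d * Suc (degree p) > 0" using assms(1) by simp
    then have "- int (d * Suc (degree p)) + 1 \<le> 0" by linarith
    then have "fls_const a \<in> lo (fls_subdegree (f * fc.ev p f) + 1)" unfolding sd by (rule fls_const_lo)
    then have "f * fc.ev p f + fls_const a \<noteq> 0"
        "fls_subdegree (f * fc.ev p f + fls_const a) = - int (d * Suc (degree p))"
      using subdegree_add_dominant[of "f * fc.ev p f" "fls_const a"] IH f sd by auto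
    then show ?thesis using False by (simp add: add.commute)
  qed
qed simp

locale pole_ring =
  fixes R :: "L set"
  assumes R_const: "\<And>q. fls_const q \<in> R" and R_add: "\<And>x y. x \<in> R \<Longrightarrow> y \<in> R \<Longrightarrow> x + y \<in> R"
    and R_mult: "\<And>x y. x \<in> R \<Longrightarrow> y \<in> R \<Longrightarrow> x * y \<in> R"
    and R_lo_1: "\<And>x. x \<in> R \<Longrightarrow> x \<in> lo 1 \<Longrightarrow> x = 0"
begin

lemma R_sum: "(\<And>i. i \<in> I \<Longrightarrow> x i \<in> R) \<Longrightarrow> sum x I \<in> R"
  by (induction I rule: infinite_finite_induct) (use R_const[of 0] R_add in auto)

lemma R_power: "x \<in> R \<Longrightarrow> x ^ n \<in> R"
  by (induction n) (use R_const[of 1] R_mult in auto)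

lemma R_ev: "x \<in> R \<Longrightarrow> fc.ev p x \<in> R"
  by (induction p) (use R_const[of 0] in \<open>auto intro: R_add R_mult R_const\<close>)

end

locale pole_pair = pole_ring +
  fixes d :: nat and f x :: L
  assumes d_pos: "d > 0" and f_R: "f \<in> R" and x_R: "x \<in> R"
    and sd_f: "fls_subdegree f = - int d" and sd_x: "fls_subdegree x = - int (d + 1)"
begin

lemma f_nz: "f \<noteq> 0" and x_nz: "x \<noteq> 0" using d_pos sd_f sd_x by auto

text \<open>Combinations of f-degree at most k have (d + 1)(k + 1) coefficients and pole order at
  most N = k d + e. Killing the N + 1 Laurent coefficients at exponents -N to 0 leaves a nonzero
  choice as soon as k + d > e, and what remains has positive order and is 0 by
  \<open>R_lo_1\<close>.\<close>

lemma dependent: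
  assumes r: "\<forall>i\<le>d. r i \<in> R"
  shows "\<exists>c. (\<exists>i\<le>d. c i \<noteq> 0) \<and> (\<Sum>i\<le>d. fc.ev (c i) f * r i) = 0"
proof -
  define e where "e = Max (insert 0 ((\<lambda>i. nat (- fls_subdegree (r i))) ` {..d}))"
  have e: "r i \<in> lo (- int e)" if "i \<le> d" for i
  proof -
    have "nat (- fls_subdegree (r i)) \<le> e" unfolding e_def using that by (intro Max_ge) auto
    then show ?thesis by (auto simp: lo_iff)
  qed
  define k where "k = e + 1"
  define N where "N = k * d + e"
  define I where "I = {..d} \<times> {..k}"
  have "card {..N} < card I" by (simp add: I_def N_def k_def)
  then obtain \<alpha> where \<alpha>: "\<exists>p\<in>I. \<alpha> p \<noteq> 0"
    "\<forall>q\<in>{..N}. (\<Sum>p\<in>I. fls_nth (f ^ snd p * r (fst p)) (- int q) * \<alpha> p) = 0"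
    using underdetermined_system[of "{..N}" I "\<lambda>q p. fls_nth (f ^ snd p * r (fst p)) (- int q)"]
    by (auto simp: I_def)
  define c where "c = (\<lambda>i. \<Sum>q\<le>k. monom (\<alpha> (i, q)) q)"
  have cc: "coeff (c i) q = \<alpha> (i, q)" if "q \<le> k" for i q using that by (simp add: c_def coeff_sum)
  have "\<exists>i\<le>d. c i \<noteq> 0"
  proof -
    obtain i q where "i \<le> d" "q \<le> k" "\<alpha> (i, q) \<noteq> 0" using \<alpha>(1) by (auto simp: I_def)
    then have "coeff (c i) q \<noteq> 0" by (simp add: cc)
    then have "c i \<noteq> 0" by auto
    then show ?thesis using \<open>i \<le> d\<close> by blast
  qed
  moreover have "(\<Sum>i\<le>d. fc.ev (c i) f * r i) = 0" (is "?s = 0")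
  proof (rule R_lo_1)
    show "?s \<in> R" using r f_R by (intro R_sum R_mult R_ev) auto
    have s: "?s = (\<Sum>p\<in>I. fls_const (\<alpha> p) * (f ^ snd p * r (fst p)))"
      by (simp add: c_def fc.ev_sum sum_distrib_right sum.cartesian_product I_def mult.assoc case_prod_beta)
    have nth: "fls_nth ?s j = (\<Sum>p\<in>I. fls_nth (f ^ snd p * r (fst p)) j * \<alpha> p)" for j
      unfolding s by (simp add: fls_nth_sum fls_mult_const_nth mult.commute)
    have loN: "f ^ snd p * r (fst p) \<in> lo (- int N)" if "p \<in> I" for p
    proof (rule lo_multI)
      show "f ^ snd p \<in> lo (- int (snd p * d))" using sd_f by (auto simp: lo_iff fls_subdegree_pow)
      show "r (fst p) \<in> lo (- int e)" using e that by (auto simp: I_def)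
      have "snd p * d \<le> k * d" using that by (auto simp: I_def)
      then show "- int N \<le> - int (snd p * d) + - int e" unfolding N_def by linarith
    qed
    show "?s \<in> lo 1"
      unfolding lo_def
    proof (intro CollectI allI impI)
      fix j :: int assume "j < 1"
      show "fls_nth ?s j = 0"
      proof (cases "j < - int N")
        case True
        then have "fls_nth (f ^ snd p * r (fst p)) j = 0" if "p \<in> I" for p
          using loN[OF that] by (simp add: lo_def)
        then show ?thesis unfolding nth by (intro sum.neutral) simp
      next
        case False
        then have "nat (- j) \<in> {..N}" "j = - int (nat (- j))" using \<open>j < 1\<close> by auto
        then show ?thesis unfolding nth using \<alpha>(2) by metis
      qed
    qed
  qed
  ultimately show ?thesis by blast
qed

text \<open>Bivariate polynomials \<open>G\<close> are evaluated at \<open>(f, x)\<close>, with coefficients in the variable of \<open>f\<close>.\<close>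

sublocale ff: comm_ring_map "\<lambda>p. fc.ev p f"
  by standard auto

lemma term_subdegree:
  assumes "p \<noteq> 0"
  shows "fc.ev p f * x ^ i \<noteq> 0" "fls_subdegree (fc.ev p f * x ^ i) = - int (d * degree p + (d + 1) * i)"
proof -
  note ev = ev_subdegree[OF d_pos sd_f assms]
  show "fc.ev p f * x ^ i \<noteq> 0" using ev x_nz by simp
  have "fls_subdegree (fc.ev p f * x ^ i) = - int (d * degree p) + int i * - int (d + 1)"
    using ev x_nz by (simp only: fls_subdegree_mult fls_subdegree_pow sd_x power_not_zero simp_thms)
  then show "fls_subdegree (fc.ev p f * x ^ i) = - int (d * degree p + (d + 1) * i)"
    by (simp add: algebra_simps)
qed

definition wgt :: "rat poly poly \<Rightarrow> nat \<Rightarrow> nat" where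
  "wgt G i = d * degree (coeff G i) + (d + 1) * i"

text \<open>The weight of the i-th term is i modulo d; this is what the orders d and d + 1 are
  chosen for.\<close>

lemma wgt_cong: assumes "wgt G i = wgt G j" shows "i mod d = j mod d"
proof -
  have "wgt G i mod d = i mod d" for i
  proof -
    have "wgt G i = i + d * (degree (coeff G i) + i)" by (simp add: wgt_def algebra_simps)
    then show ?thesis by simp
  qed
  then show ?thesis using assms by metis
qed

text \<open>Weights are pole orders, so a term of maximal weight cannot occur alone in a relation.\<close>

lemma max_weight_twice:
  assumes "G \<noteq> 0" "ff.ev G x = 0"
  obtains i j where "i \<noteq> j" "coeff G i \<noteq> 0" "coeff G j \<noteq> 0" "wgt G i = wgt G j"
    "\<And>k. coeff G k \<noteq> 0 \<Longrightarrow> wgt G k \<le> wgt G i"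
proof -
  define I where "I = {i. coeff G i \<noteq> 0}"
  have I: "finite I" "I \<noteq> {}"
  proof -
    show "finite I" by (rule finite_subset[of _ "{..degree G}"]) (auto simp: I_def intro: le_degree)
    show "I \<noteq> {}" using assms(1) by (auto simp: I_def poly_eq_iff)
  qed
  have "Max (wgt G ` I) \<in> wgt G ` I" using I by (intro Max_in) auto
  then obtain i where i: "i \<in> I" "wgt G i = Max (wgt G ` I)" by auto
  have le: "wgt G k \<le> wgt G i" if "k \<in> I" for k using I that i by simp
  have ev: "ff.ev G x = (\<Sum>k\<in>I. fc.ev (coeff G k) f * x ^ k)"
  proof -
    have "ff.ev G x = (\<Sum>k<Suc (degree G). fc.ev (coeff G k) f * x ^ k)" by (rule ff.ev_altdef) simp
    also have "\<dots> = (\<Sum>k\<in>I. fc.ev (coeff G k) f * x ^ k)"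
      by (rule sum.mono_neutral_right) (auto simp: I_def le_degree less_Suc_eq_le)
    finally show ?thesis .
  qed
  have "\<exists>j\<in>I. j \<noteq> i \<and> wgt G j = wgt G i"
  proof (rule ccontr)
    assume "\<not> ?thesis"
    then have lt: "wgt G j < wgt G i" if "j \<in> I" "j \<noteq> i" for j using le that le_neq_implies_less by blast
    have "(\<Sum>k\<in>I. fc.ev (coeff G k) f * x ^ k) \<noteq> 0"
    proof (rule sum_dominant[OF I(1) i(1)])
      show "fc.ev (coeff G i) f * x ^ i \<noteq> 0" using term_subdegree(1) i by (simp add: I_def)
      fix j assume j: "j \<in> I" "j \<noteq> i"
      have "fls_subdegree (fc.ev (coeff G i) f * x ^ i) = - int (wgt G i)"
        "fls_subdegree (fc.ev (coeff G j) f * x ^ j) = - int (wgt G j)"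
        using term_subdegree(2)[of "coeff G i" i, folded wgt_def] term_subdegree(2)[of "coeff G j" j, folded wgt_def]
          i(1) j(1) by (auto simp only: I_def mem_Collect_eq)
      then show "fc.ev (coeff G j) f * x ^ j \<in> lo (fls_subdegree (fc.ev (coeff G i) f * x ^ i) + 1)"
        using lt[OF j] by (simp add: lo_iff)
    qed
    then show False using assms(2) ev by simp
  qed
  then obtain j where "j \<in> I" "j \<noteq> i" "wgt G j = wgt G i" by blast
  then show ?thesis using that[of i j] i(1) le by (simp only: I_def mem_Collect_eq) metis
qed

lemma independent: assumes "ff.ev G x = 0" "degree G < d" shows "G = 0"
proof (rule ccontr)
  assume "G \<noteq> 0"
  then obtain i j where ij: "i \<noteq> j" "coeff G i \<noteq> 0" "coeff G j \<noteq> 0" "wgt G i = wgt G j"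
    using max_weight_twice[OF _ assms(1)] by metis
  then have "i < d" "j < d" using assms(2) le_degree by (meson le_less_trans)+
  then show False using wgt_cong[OF ij(4)] ij(1) by simp
qed

text \<open>Among 0, ..., d only 0 and d agree modulo d, so exactly these two indices share the
  maximal weight of a relation between 1, x, ..., x^d. Equating their weights gives the degree jump
  d + 1.\<close>

lemma relation_exists:
  obtains H where "degree H = d" "ff.ev H x = 0" "coeff H 0 \<noteq> 0"
    "degree (coeff H 0) = degree (coeff H d) + (d + 1)"
    "\<And>i. 0 < i \<Longrightarrow> i < d \<Longrightarrow> coeff H i \<noteq> 0 \<Longrightarrow> wgt H i < wgt H d"
proof -
  obtain c where c: "\<exists>i\<le>d. c i \<noteq> 0" "(\<Sum>i\<le>d. fc.ev (c i) f * x ^ i) = 0"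
    using dependent[of "\<lambda>i. x ^ i"] R_power[OF x_R] by blast
  define H where "H = (\<Sum>i\<le>d. monom (c i) i)"
  have cH: "coeff H i = (if i \<le> d then c i else 0)" for i by (simp add: H_def coeff_sum)
  have evH: "ff.ev H x = 0" using c(2) by (simp add: H_def ff.ev_sum)
  have H0: "H \<noteq> 0" using c(1) cH by (metis coeff_0)
  obtain i j where ij: "i \<noteq> j" "coeff H i \<noteq> 0" "coeff H j \<noteq> 0" "wgt H i = wgt H j"
    "\<And>k. coeff H k \<noteq> 0 \<Longrightarrow> wgt H k \<le> wgt H i"
    using max_weight_twice[OF H0 evH] by metis
  have le: "i \<le> d" "j \<le> d" using ij(2,3) cH by metis+
  have md: "a = 0 \<and> b = d \<or> a = d \<and> b = 0" if "a \<le> d" "b \<le> d" "a \<noteq> b" "wgt H a = wgt H b" for a b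
    using wgt_cong[OF that(4)] that(1-3) d_pos
    by (cases "a = d"; cases "b = d") auto
  from md[OF le ij(1,4)] have nz: "coeff H 0 \<noteq> 0" "coeff H d \<noteq> 0" and w: "wgt H 0 = wgt H d" "wgt H i = wgt H d"
    using ij by auto
  have deg: "degree H = d"
    using nz(2) cH by (intro antisym degree_le le_degree) auto
  have "d * degree (coeff H 0) = d * (degree (coeff H d) + (d + 1))"
    using w(1) by (simp add: wgt_def algebra_simps)
  then have "degree (coeff H 0) = degree (coeff H d) + (d + 1)"
    using d_pos by (simp only: nat_mult_eq_cancel1)
  moreover have "wgt H k < wgt H d" if "0 < k" "k < d" "coeff H k \<noteq> 0" for k
  proof -
    have "wgt H k \<le> wgt H d" using ij(5) that(3) w by metis
    moreover have "wgt H k \<noteq> wgt H d" using md[of k d] that by auto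
    ultimately show ?thesis by simp
  qed
  ultimately show ?thesis using that deg evH nz by blast
qed

text \<open>The field Q(f, x). Denominators are kept free of x, so that regularity at a
  specialisation only asks for a nonzero value at the rational number substituted for f.\<close>

definition Kf :: "L set" where
  "Kf = {u. \<exists>D G. D \<noteq> 0 \<and> fc.ev D f * u = ff.ev G x}"

lemma KfI: "D \<noteq> 0 \<Longrightarrow> fc.ev D f * u = ff.ev G x \<Longrightarrow> u \<in> Kf"
  unfolding Kf_def by blast

lemma ev_f_nz: "D \<noteq> 0 \<Longrightarrow> fc.ev D f \<noteq> 0"
  using ev_subdegree[OF d_pos sd_f] by blast

text \<open>In a dependency between 1, x, ..., x^(d-1) and y the coefficient of y cannot vanish, by
  \<open>independent\<close>.\<close>

lemma R_sub_Kf: assumes "y \<in> R" shows "y \<in> Kf"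
proof -
  define r where "r = (\<lambda>i. if i < d then x ^ i else y)"
  have "\<forall>i\<le>d. r i \<in> R" using R_power x_R assms by (simp add: r_def)
  from dependent[OF this]
  obtain c where c: "\<exists>i\<le>d. c i \<noteq> 0" "(\<Sum>i\<le>d. fc.ev (c i) f * r i) = 0" by blast
  define G where "G = (\<Sum>i<d. monom (c i) i)"
  have cG: "coeff G i = (if i < d then c i else 0)" for i by (simp add: G_def coeff_sum)
  have "ff.ev G x = (\<Sum>i<d. fc.ev (c i) f * r i)" by (simp add: G_def ff.ev_sum r_def)
  moreover have "(\<Sum>i\<le>d. fc.ev (c i) f * r i) = (\<Sum>i<d. fc.ev (c i) f * r i) + fc.ev (c d) f * y"
    by (simp add: r_def lessThan_Suc_atMost[symmetric])
  ultimately have eq: "ff.ev G x + fc.ev (c d) f * y = 0" using c(2) by simp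
  have "c d \<noteq> 0"
  proof
    assume 0: "c d = 0"
    have "degree G < d" using d_pos cG by (intro degree_lessI) auto
    then have "G = 0" using eq 0 by (intro independent) auto
    then have "c i = 0" if "i \<le> d" for i using cG[of i] 0 that by (cases "i = d") auto
    then show False using c(1) by auto
  qed
  moreover have "fc.ev (c d) f * y = ff.ev (- G) x" using eq by (simp add: eq_neg_iff_add_eq_0 add.commute)
  ultimately show ?thesis by (rule KfI)
qed

lemma ff_ev_in_R: "ff.ev G x \<in> R"
  by (induction G) (use R_const[of 0] in \<open>auto intro: R_add R_mult R_ev f_R x_R\<close>)

lemma Kf_mult: assumes "u \<in> Kf" "w \<in> Kf" shows "u * w \<in> Kf"
proof -
  obtain D G D' G' where 1: "D \<noteq> 0" "fc.ev D f * u = ff.ev G x" "D' \<noteq> 0" "fc.ev D' f * w = ff.ev G' x"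
    using assms by (auto simp: Kf_def)
  have "fc.ev (D * D') f * (u * w) = (fc.ev D f * u) * (fc.ev D' f * w)" by (simp add: mult_ac)
  also have "\<dots> = ff.ev (G * G') x" using 1 by simp
  finally have "fc.ev (D * D') f * (u * w) = ff.ev (G * G') x" .
  from KfI[OF _ this] show ?thesis using 1 by simp
qed

lemma Kf_add: assumes "u \<in> Kf" "w \<in> Kf" shows "u + w \<in> Kf"
proof -
  obtain D G D' G' where 1: "D \<noteq> 0" "fc.ev D f * u = ff.ev G x" "D' \<noteq> 0" "fc.ev D' f * w = ff.ev G' x"
    using assms by (auto simp: Kf_def)
  have "fc.ev (D * D') f * (u + w) = fc.ev D' f * (fc.ev D f * u) + fc.ev D f * (fc.ev D' f * w)"
    by (simp add: algebra_simps)
  also have "\<dots> = ff.ev (smult D' G + smult D G') x" using 1 by simp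
  finally have "fc.ev (D * D') f * (u + w) = ff.ev (smult D' G + smult D G') x" .
  from KfI[OF _ this] show ?thesis using 1 by simp
qed

text \<open>The numerator g of u satisfies a polynomial over Q[f] with nonzero constant coefficient
  a, so a / g is a polynomial in g.\<close>

lemma Kf_inverse: assumes "u \<in> Kf" shows "inverse u \<in> Kf"
proof (cases "u = 0")
  case True
  then show ?thesis using assms by simp
next
  case False
  obtain D G where DG: "D \<noteq> 0" "fc.ev D f * u = ff.ev G x" using assms by (auto simp: Kf_def)
  define g where "g = ff.ev G x"
  have g: "g \<noteq> 0" using DG False ev_f_nz[OF DG(1)] by (auto simp: g_def)
  obtain c where c: "\<exists>i\<le>d. c i \<noteq> 0" "(\<Sum>i\<le>d. fc.ev (c i) f * g ^ i) = 0"
    using dependent[of "\<lambda>i. g ^ i"] R_power[OF ff_ev_in_R[of G], folded g_def] by blast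
  define P0 where "P0 = (\<Sum>i\<le>d. monom (c i) i)"
  have "coeff P0 i = (if i \<le> d then c i else 0)" for i by (simp add: P0_def coeff_sum)
  then have P0: "P0 \<noteq> 0" using c(1) by (metis coeff_0)
  have evP0: "ff.ev P0 g = 0" using c(2) by (simp add: P0_def ff.ev_sum)
  \<comment> \<open>Factors X of the relation can be cancelled because g is nonzero.\<close>
  have "\<exists>a P. a \<noteq> 0 \<and> ff.ev (pCons a P) g = 0"
    using P0 evP0
  proof (induction P0)
    case (pCons a P)
    show ?case
    proof (cases "a = 0")
      case True
      then show ?thesis using pCons g by auto
    qed (use pCons in blast)
  qed simp
  then obtain a P where aP: "a \<noteq> 0" "ff.ev (pCons a P) g = 0" by blast
  have "\<exists>Q. ff.ev P g = ff.ev Q x"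
  proof (induction P)
    case (pCons b P)
    then obtain Q where "ff.ev P g = ff.ev Q x" by blast
    then have "ff.ev (pCons b P) g = ff.ev ([:b:] + G * Q) x" by (simp add: g_def)
    then show ?case by blast
  qed (auto intro: exI[of _ 0])
  then obtain Q where Q: "ff.ev P g = ff.ev Q x" by blast
  have "fc.ev a f + g * ff.ev P g = 0" using aP by simp
  then have ga: "fc.ev a f = - (g * ff.ev Q x)" unfolding Q by (simp add: eq_neg_iff_add_eq_0)
  have "fc.ev a f * inverse u = - (g * ff.ev Q x) * inverse u" unfolding ga ..
  also have "g = fc.ev D f * u" using DG by (simp add: g_def)
  also have "- (fc.ev D f * u * ff.ev Q x) * inverse u = ff.ev (- smult D Q) x" using False by simp
  finally have "fc.ev a f * inverse u = ff.ev (- smult D Q) x" .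
  from KfI[OF aP(1) this] show ?thesis .
qed

end

section \<open>Specialisation to number fields\<close>

lemma of_rat_powi: "of_rat (2 powi k) = (2::complex) powi k"
  by (simp add: power_int_def of_rat_power of_rat_inverse of_rat_divide)

lemma v2_half_power: "v2 ((1/2) ^ r) = - int r"
  using v2_powi[of "- int r"] by (simp add: power_int_minus power_one_over inverse_eq_divide)

lemma vge_poly: "\<exists>\<beta>. \<forall>r. vge (\<beta> - int (r * degree h)) (poly h ((1/2) ^ r))"
proof -
  define \<beta> where "\<beta> = Min (insert 0 ((\<lambda>i. v2 (coeff h i)) ` {..degree h}))"
  have \<beta>: "vge \<beta> (coeff h i)" for i
  proof (cases "i \<le> degree h")
    case True
    then have "\<beta> \<le> v2 (coeff h i)" unfolding \<beta>_def by (intro Min_le) auto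
    then show ?thesis by (simp add: vge_def)
  qed (simp add: coeff_eq_0)
  have "vge (\<beta> - int (r * degree h)) (poly h ((1/2) ^ r))" for r
    unfolding poly_altdef
  proof (intro vge_sum vge_multI[OF \<beta>])
    fix i assume "i \<in> {..degree h}"
    then have "r * i \<le> r * degree h" by simp
    then show "\<beta> - int (r * degree h) \<le> \<beta> + - int (r * i)" by linarith
    show "vge (- int (r * i)) (((1/2) ^ r) ^ i)" by (simp add: vge_def v2_half_power flip: power_mult)
  qed
  then show ?thesis by blast
qed

text \<open>2^-r is 2-adically large, so the top term dominates for large r. Degrees in f thereby
  become 2-adic valuations.\<close>

lemma v2_poly_lead:
  assumes "h \<noteq> 0"
  shows "eventually (\<lambda>r. poly h ((1/2) ^ r) \<noteq> 0 \<and> v2 (poly h ((1/2) ^ r)) = v2 (lead_coeff h) - int (r * degree h)) sequentially"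
proof (cases "degree h = 0")
  case True
  then obtain a where "h = [:a:]" by (rule degree_eq_zeroE)
  then show ?thesis using assms by simp
next
  case False
  define m where "m = monom (lead_coeff h) (degree h)"
  define h' where "h' = h - m"
  have dh': "degree h' \<le> degree h - 1"
    using False by (intro degree_le) (auto simp: h'_def m_def coeff_eq_0 not_le)
  obtain \<beta> where \<beta>: "\<And>r. vge (\<beta> - int (r * degree h')) (poly h' ((1/2) ^ r))" using vge_poly by blast
  have lc: "lead_coeff h \<noteq> 0" using assms by simp
  have "poly h ((1/2) ^ r) \<noteq> 0 \<and> v2 (poly h ((1/2) ^ r)) = v2 (lead_coeff h) - int (r * degree h)"
    if r: "r \<ge> nat (v2 (lead_coeff h) + 1 - \<beta>)" for r
  proof -
    define y where "y = poly m ((1/2) ^ r)"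
    have y: "y \<noteq> 0" "v2 y = v2 (lead_coeff h) - int (r * degree h)"
      using lc by (auto simp: y_def m_def poly_monom v2_mult v2_half_power simp flip: power_mult)
    have "r * degree h' + r \<le> r * degree h"
    proof -
      have "r * (degree h' + 1) \<le> r * degree h" using dh' False by (intro mult_left_mono) auto
      then show ?thesis by simp
    qed
    then have "v2 y + 1 \<le> \<beta> - int (r * degree h')" using r y(2) by linarith
    then have "vge (v2 y + 1) (poly h' ((1/2) ^ r))" using \<beta> vge_mono by blast
    from v2_add_eq[OF y(1) this] show ?thesis using y(2) by (simp add: y_def h'_def)
  qed
  then show ?thesis unfolding eventually_sequentially by blast
qed

locale pole_relation = pole_pair +
  fixes H :: "rat poly poly"
  assumes deg_H: "degree H = d" and H_rel: "ff.ev H x = 0" and H_0: "coeff H 0 \<noteq> 0"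
    and deg_H0: "degree (coeff H 0) = degree (coeff H d) + (d + 1)"
    and wgt_H: "\<And>i. 0 < i \<Longrightarrow> i < d \<Longrightarrow> coeff H i \<noteq> 0 \<Longrightarrow> wgt H i < wgt H d"
begin

lemma H_d: "coeff H d \<noteq> 0"
  using deg_H d_pos H_0 by (metis coeff_0 leading_coeff_0_iff)

end

section \<open>The specialisation homomorphism f -> T0, x -> x0\<close>

locale specialisation = pole_relation +
  fixes T0 :: rat and x0 :: complex
  assumes Hd_T0: "poly (coeff H d) T0 \<noteq> 0"
    and root: "poly (map_poly (\<lambda>p. of_rat (poly p T0)) H) x0 = 0"
begin

sublocale sp: comm_ring_map "\<lambda>p. of_rat (poly p T0) :: complex"
  by standard (auto simp: of_rat_add of_rat_mult)

text \<open>Pseudo-division by H: the remainder has degree below d and vanishes by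
  \<open>independent\<close>, so a power of the leading coefficient of H times G is a multiple of H,
  and that coefficient is nonzero at T0. Values of functions at (T0, x0) are therefore well
  defined.\<close>

lemma transport: assumes "ff.ev G x = 0" shows "sp.ev G x0 = 0"
proof -
  have H_nz: "H \<noteq> 0" using H_0 by auto
  obtain q r where qr: "pseudo_divmod G H = (q, r)" by fastforce
  define k where "k = Suc (degree G) - degree H"
  have eq: "smult (coeff H d ^ k) G = H * q + r" and r: "r = 0 \<or> degree r < d"
    using pseudo_divmod[OF H_nz qr] by (auto simp: k_def deg_H)
  have "ff.ev (H * q + r) x = 0" unfolding eq[symmetric] using assms by simp
  then have "ff.ev r x = 0" using H_rel by simp
  then have "r = 0" using r independent by blast
  have "sp.ev (smult (coeff H d ^ k) G) x0 = sp.ev H x0 * sp.ev q x0"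
    unfolding eq \<open>r = 0\<close> by simp
  also have "sp.ev H x0 = 0" using root by (simp add: sp.ev_def)
  finally show ?thesis using Hd_T0 by simp
qed

definition Bd :: "L set" where
  "Bd = {u. \<exists>D G. poly D T0 \<noteq> 0 \<and> fc.ev D f * u = ff.ev G x}"

definition \<phi> :: "L \<Rightarrow> complex" where
  "\<phi> u = (SOME y. \<exists>D G. poly D T0 \<noteq> 0 \<and> fc.ev D f * u = ff.ev G x \<and> y = sp.ev G x0 / of_rat (poly D T0))"

lemma Bd_I: "poly D T0 \<noteq> 0 \<Longrightarrow> fc.ev D f * u = ff.ev G x \<Longrightarrow> u \<in> Bd"
  unfolding Bd_def by blast

lemma \<phi>_eq:
  assumes "poly D T0 \<noteq> 0" "fc.ev D f * u = ff.ev G x"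
  shows "\<phi> u = sp.ev G x0 / of_rat (poly D T0)"
proof -
  have "\<exists>y D G. poly D T0 \<noteq> 0 \<and> fc.ev D f * u = ff.ev G x \<and> y = sp.ev G x0 / of_rat (poly D T0)"
    using assms by blast
  then have "\<exists>D G. poly D T0 \<noteq> 0 \<and> fc.ev D f * u = ff.ev G x \<and> \<phi> u = sp.ev G x0 / of_rat (poly D T0)"
    unfolding \<phi>_def by (rule someI_ex)
  then obtain D' G' where 1: "poly D' T0 \<noteq> 0" "fc.ev D' f * u = ff.ev G' x"
    "\<phi> u = sp.ev G' x0 / of_rat (poly D' T0)" by blast
  have "ff.ev (smult D' G - smult D G') x = fc.ev D' f * (fc.ev D f * u) - fc.ev D f * (fc.ev D' f * u)"
    using assms 1 by simp
  also have "\<dots> = 0" by (simp add: mult_ac)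
  finally have "sp.ev (smult D' G - smult D G') x0 = 0" by (rule transport)
  then have "of_rat (poly D' T0) * sp.ev G x0 = of_rat (poly D T0) * sp.ev G' x0" by simp
  then show ?thesis unfolding 1(3) using 1(1) assms(1) by (subst frac_eq_eq) (auto simp: mult.commute)
qed

lemma Bd_add: assumes "u \<in> Bd" "w \<in> Bd" shows "u + w \<in> Bd" "\<phi> (u + w) = \<phi> u + \<phi> w"
proof -
  obtain D G D' G' where 1: "poly D T0 \<noteq> 0" "fc.ev D f * u = ff.ev G x"
    "poly D' T0 \<noteq> 0" "fc.ev D' f * w = ff.ev G' x" using assms by (auto simp: Bd_def)
  have "fc.ev (D * D') f * (u + w) = fc.ev D' f * (fc.ev D f * u) + fc.ev D f * (fc.ev D' f * w)"
    by (simp add: algebra_simps)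
  also have "\<dots> = ff.ev (smult D' G + smult D G') x" using 1 by simp
  finally have eq: "fc.ev (D * D') f * (u + w) = ff.ev (smult D' G + smult D G') x" .
  have nz: "poly (D * D') T0 \<noteq> 0" using 1 by simp
  show "u + w \<in> Bd" using nz eq by (rule Bd_I)
  show "\<phi> (u + w) = \<phi> u + \<phi> w"
    unfolding \<phi>_eq[OF nz eq] \<phi>_eq[OF 1(1,2)] \<phi>_eq[OF 1(3,4)] using 1(1,3)
    by (subst add_frac_eq) (auto simp: of_rat_mult mult.commute)
qed

lemma Bd_mult: assumes "u \<in> Bd" "w \<in> Bd" shows "u * w \<in> Bd" "\<phi> (u * w) = \<phi> u * \<phi> w"
proof -
  obtain D G D' G' where 1: "poly D T0 \<noteq> 0" "fc.ev D f * u = ff.ev G x"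
    "poly D' T0 \<noteq> 0" "fc.ev D' f * w = ff.ev G' x" using assms by (auto simp: Bd_def)
  have "fc.ev (D * D') f * (u * w) = (fc.ev D f * u) * (fc.ev D' f * w)" by (simp add: mult_ac)
  also have "\<dots> = ff.ev (G * G') x" using 1 by simp
  finally have eq: "fc.ev (D * D') f * (u * w) = ff.ev (G * G') x" .
  have nz: "poly (D * D') T0 \<noteq> 0" using 1 by simp
  show "u * w \<in> Bd" using nz eq by (rule Bd_I)
  show "\<phi> (u * w) = \<phi> u * \<phi> w"
    using \<phi>_eq[OF nz eq] \<phi>_eq[OF 1(1,2)] \<phi>_eq[OF 1(3,4)] by (simp add: of_rat_mult)
qed

lemma Bd_const: "fls_const q \<in> Bd" "\<phi> (fls_const q) = of_rat q"
proof -
  have 1: "poly 1 T0 \<noteq> 0" "fc.ev 1 f * fls_const q = ff.ev [:[:q:]:] x" by auto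
  show "fls_const q \<in> Bd" using 1 by (rule Bd_I)
  show "\<phi> (fls_const q) = of_rat q" using \<phi>_eq[OF 1] by simp
qed

end

context pole_relation
begin

text \<open>With \<open>T0 = 2 ^ (- r)\<close>, the Newton polygon at 2 of \<open>H(T0, X)\<close> is a single segment of slope \<open>\<kappa> + 1 / d\<close>;
  rescaling \<open>X\<close> by \<open>2 ^ \<kappa>\<close> makes the polynomial Eisenstein.\<close>

lemma eisenstein_specialisation:
  "\<exists>r\<ge>r0. \<exists>z H' \<kappa>. eisenstein2 H' d z \<and>
     specialisation R d f x H ((1/2) ^ r) (2 powi \<kappa> * z)"
proof -
  define a b j where "a = v2 (lead_coeff (coeff H d))" and "b = v2 (lead_coeff (coeff H 0))"
    and "j = degree (coeff H d)"
  \<comment> \<open>Valuation exactly 1 for the constant coefficient of the rescaled monic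
    polynomial means d \<kappa> = m - r (d + 1).\<close>
  define m where "m = b - a - 1"
  have "\<forall>i. \<exists>\<beta>. \<forall>r. vge (\<beta> - int (r * degree (coeff H i))) (poly (coeff H i) ((1/2) ^ r))"
    using vge_poly by blast
  then obtain \<beta>' where \<beta>': "\<And>i r. vge (\<beta>' i - int (r * degree (coeff H i))) (poly (coeff H i) ((1/2) ^ r))"
    by metis
  define \<beta> where "\<beta> = Min (\<beta>' ` {..d})"
  have \<beta>: "vge (\<beta> - int (r * degree (coeff H i))) (poly (coeff H i) ((1/2) ^ r))" if "i \<le> d" for i r
  proof -
    have "\<beta> \<le> \<beta>' i" unfolding \<beta>_def using that by (intro Min_le) auto
    then show ?thesis using vge_mono[OF \<beta>'[of i r]] by simp
  qed
  have "eventually (\<lambda>r. (poly (coeff H d) ((1/2) ^ r) \<noteq> 0 \<and> v2 (poly (coeff H d) ((1/2) ^ r)) = a - int (r * j)) \<and>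
     (poly (coeff H 0) ((1/2) ^ r) \<noteq> 0 \<and> v2 (poly (coeff H 0) ((1/2) ^ r)) = b - int (r * degree (coeff H 0)))) sequentially"
    unfolding a_def b_def j_def by (intro eventually_conj v2_poly_lead H_d H_0)
  then obtain r1 where r1: "\<And>r. r \<ge> r1 \<Longrightarrow> poly (coeff H d) ((1/2) ^ r) \<noteq> 0" "\<And>r. r \<ge> r1 \<Longrightarrow> v2 (poly (coeff H d) ((1/2) ^ r)) = a - int (r * j)"
     "\<And>r. r \<ge> r1 \<Longrightarrow> poly (coeff H 0) ((1/2) ^ r) \<noteq> 0" "\<And>r. r \<ge> r1 \<Longrightarrow> v2 (poly (coeff H 0) ((1/2) ^ r)) = b - int (r * degree (coeff H 0))"
    unfolding eventually_sequentially by blast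
  \<comment> \<open>The middle coefficients fall short of valuation 1 by an amount bounded
    independently of r, while the strict weight inequality gains r / d; from this threshold on the
    gain prevails.\<close>
  define r2 where "r2 = nat (int d * (1 + a - \<beta> + \<bar>m\<bar>))"
  define N where "N = r0 + r1 + r2 + nat \<bar>m\<bar>"
  \<comment> \<open>\<open>\<kappa>\<close> has to be an integer, so r is taken congruent to m
    modulo d.\<close>
  define r where "r = nat (m + int d * int N)"
  have "int N \<le> int d * int N" using d_pos by (simp add: mult_le_cancel_right1)
  then have ri: "int r = m + int d * int N" "r \<ge> r0" "r \<ge> r1" "r \<ge> r2"
    by (auto simp: r_def N_def)
  have r_ge: "int r \<ge> int d * (1 + a - \<beta> + \<bar>m\<bar>)" using ri(4) unfolding r2_def by linarith
  define \<kappa> where "\<kappa> = - int N - int r"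
  have \<kappa>: "int d * \<kappa> = m - int r * int (d + 1)"
    using ri(1) by (simp add: \<kappa>_def algebra_simps)
  define T0 :: rat where "T0 = (1/2) ^ r"
  define hd where "hd = poly (coeff H d) T0"
  have hd: "hd \<noteq> 0" "v2 hd = a - int (r * j)" using r1 ri by (auto simp: hd_def T0_def)
  define cf where "cf = (\<lambda>i. poly (coeff H i) T0 * (2 powi (\<kappa> * int i) / (hd * 2 powi (\<kappa> * int d))))"
  have v2_inv: "v2 (1 / y) = - v2 y" if "y \<noteq> 0" for y
    using v2_mult[of y "1/y"] that by simp
  have vs: "v2 (2 powi (\<kappa> * int i) / (hd * 2 powi (\<kappa> * int d))) = \<kappa> * int i - (a - int (r * j)) - \<kappa> * int d"
    "2 powi (\<kappa> * int i) / (hd * 2 powi (\<kappa> * int d)) \<noteq> 0" for i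
  proof -
    have "2 powi (\<kappa> * int i) / (hd * 2 powi (\<kappa> * int d)) = 2 powi (\<kappa> * int i) * (1 / (hd * 2 powi (\<kappa> * int d)))" by simp
    also have "v2 \<dots> = \<kappa> * int i - (a - int (r * j)) - \<kappa> * int d"
      using hd by (subst v2_mult) (auto simp: v2_inv v2_mult)
    finally show "v2 (2 powi (\<kappa> * int i) / (hd * 2 powi (\<kappa> * int d))) = \<kappa> * int i - (a - int (r * j)) - \<kappa> * int d" .
  qed (use hd in simp)
  define H' where "H' = (\<Sum>i\<le>d. monom (cf i) i)"
  have cH': "coeff H' i = (if i \<le> d then cf i else 0)" for i by (simp add: H'_def coeff_sum)
  have cfd: "cf d = 1" using hd by (simp add: cf_def hd_def)
  have degH': "degree H' = d"
    by (intro antisym degree_le le_degree) (auto simp: cH' cfd)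
  have cf0: "cf 0 \<noteq> 0" "v2 (cf 0) = 1"
  proof -
    have h0: "poly (coeff H 0) T0 \<noteq> 0" "v2 (poly (coeff H 0) T0) = b - int (r * (j + (d + 1)))"
      using r1 ri deg_H0 by (auto simp: T0_def j_def)
    show "cf 0 \<noteq> 0" using h0 vs(2)[of 0] unfolding cf_def by simp
    have "v2 (cf 0) = b - int (r * (j + (d + 1))) + (\<kappa> * int 0 - (a - int (r * j)) - \<kappa> * int d)"
      unfolding cf_def using v2_mult[OF h0(1) vs(2)[of 0]] h0(2) vs(1)[of 0] by simp
    also have "\<dots> = b - a - (int r * int (d + 1) + int d * \<kappa>)" by (simp add: algebra_simps)
    also have "\<dots> = 1" unfolding \<kappa> by (simp add: m_def)
    finally show "v2 (cf 0) = 1" .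
  qed
  have cfi: "vge 1 (cf i)" if i: "0 < i" "i < d" for i
  proof (cases "coeff H i = 0")
    case True
    then show ?thesis by (simp add: cf_def)
  next
    case False
    define \<delta> where "\<delta> = degree (coeff H i)"
    have "d * \<delta> + (d + 1) * i + 1 \<le> d * j + (d + 1) * d"
      using wgt_H[OF i False] by (simp add: wgt_def \<delta>_def j_def)
    then have "int (d * \<delta> + (d + 1) * i + 1) \<le> int (d * j + (d + 1) * d)" by (rule zle_int[THEN iffD2])
    \<comment> \<open>The final 1 expresses strictness of the weight inequality between integers;
      multiplied by r it yields the gain.\<close>
    then have w: "int d * (int j - int \<delta>) \<ge> int (d + 1) * (int i - int d) + 1" by (simp add: algebra_simps)
    define V where "V = (\<beta> - int (r * \<delta>)) + (\<kappa> * int i - (a - int (r * j)) - \<kappa> * int d)"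
    have "int d * V = int d * (\<beta> - a) + int r * (int d * (int j - int \<delta>)) - (int d * \<kappa>) * (int d - int i)"
      by (simp add: V_def algebra_simps)
    also have "\<dots> \<ge> int d * (\<beta> - a) + int r * (int (d + 1) * (int i - int d) + 1) - (int d * \<kappa>) * (int d - int i)"
      using mult_left_mono[OF w, of "int r"] by simp
    also have "int d * (\<beta> - a) + int r * (int (d + 1) * (int i - int d) + 1) - (int d * \<kappa>) * (int d - int i)
        = int d * (\<beta> - a) + int r - m * (int d - int i)"
      unfolding \<kappa> by (simp add: algebra_simps)
    finally have 1: "int d * V \<ge> int d * (\<beta> - a) + int r - m * (int d - int i)" .
    have "m * (int d - int i) \<le> \<bar>m\<bar> * (int d - int i)" using i by (intro mult_right_mono) auto
    also have "\<dots> \<le> \<bar>m\<bar> * int d" using i by (intro mult_left_mono) auto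
    finally have "m * (int d - int i) \<le> int d * \<bar>m\<bar>" by (simp add: mult.commute)
    then have "int d * V \<ge> int d * 1" using 1 r_ge by (simp add: algebra_simps)
    then have V: "V \<ge> 1" using d_pos by simp
    have "vge V (cf i)"
      unfolding cf_def V_def
    proof (rule vge_mult)
      show "vge (\<beta> - int (r * \<delta>)) (poly (coeff H i) T0)" using \<beta>[of i r] i by (simp add: T0_def \<delta>_def)
      show "vge (\<kappa> * int i - (a - int (r * j)) - \<kappa> * int d) (2 powi (\<kappa> * int i) / (hd * 2 powi (\<kappa> * int d)))"
        unfolding vs(1)[symmetric] by (rule vge_self)
    qed
    then show ?thesis using V vge_mono by blast
  qed
  have "degree (map_poly of_rat H' :: complex poly) = d" by (simp add: degree_map_poly degH')
  then have "\<not> constant (poly (map_poly of_rat H' :: complex poly))"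
    using d_pos by (simp add: constant_degree)
  then obtain z where z: "poly (map_poly of_rat H') z = (0::complex)"
    using fundamental_theorem_of_algebra by blast
  then have evz: "rc.ev H' z = 0" by (simp add: rc.ev_def)
  have "eisenstein2 H' d z"
  proof
    fix i assume "i < d"
    then show "vge 1 (coeff H' i)" using cfi[of i] cf0 by (cases "i = 0") (auto simp: cH' vge_def)
  qed (use d_pos degH' cH' cfd cf0 evz in auto)
  moreover have "specialisation R d f x H T0 (2 powi \<kappa> * z)"
  proof (intro specialisation.intro pole_relation_axioms specialisation_axioms.intro)
    show "poly (coeff H d) T0 \<noteq> 0" using hd by (simp add: hd_def)
    interpret s: comm_ring_map "\<lambda>p. of_rat (poly p T0) :: complex"
      by standard (auto simp: of_rat_add of_rat_mult)
    have "poly (map_poly (\<lambda>p. of_rat (poly p T0)) H) (2 powi \<kappa> * z) = s.ev H (2 powi \<kappa> * z)"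
      by (simp add: s.ev_def)
    also have "\<dots> = (\<Sum>i<Suc d. of_rat (poly (coeff H i) T0) * (2 powi \<kappa> * z) ^ i)"
      by (rule s.ev_altdef) (simp add: deg_H)
    also have "\<dots> = (\<Sum>i<Suc d. of_rat (hd * 2 powi (\<kappa> * int d)) * (of_rat (coeff H' i) * z ^ i))"
    proof (rule sum.cong[OF refl])
      fix i assume "i \<in> {..<Suc d}"
      then have "hd * 2 powi (\<kappa> * int d) * coeff H' i = poly (coeff H i) T0 * 2 powi (\<kappa> * int i)"
        using hd by (simp add: cH' cf_def)
      then have "of_rat (hd * 2 powi (\<kappa> * int d)) * of_rat (coeff H' i) = (of_rat (poly (coeff H i) T0 * 2 powi (\<kappa> * int i)) :: complex)"
        by (metis of_rat_mult)
      also have "\<dots> = of_rat (poly (coeff H i) T0) * (2 powi \<kappa>) ^ i"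
        by (simp only: of_rat_mult of_rat_power of_rat_powi power_int_mult power_int_of_nat)
      finally show "of_rat (poly (coeff H i) T0) * (2 powi \<kappa> * z) ^ i =
          of_rat (hd * 2 powi (\<kappa> * int d)) * (of_rat (coeff H' i) * z ^ i)"
        by (simp add: power_mult_distrib mult.assoc)
    qed
    also have "\<dots> = of_rat (hd * 2 powi (\<kappa> * int d)) * rc.ev H' z"
      by (subst rc.ev_altdef[of _ "Suc d"]) (simp_all only: degH' lessI sum_distrib_left)
    finally show "poly (map_poly (\<lambda>p. of_rat (poly p T0)) H) (2 powi \<kappa> * z) = 0" by (simp add: evz)
  qed
  ultimately show ?thesis using ri(2) unfolding T0_def by blast
qed

text \<open>Each of the finitely many denominators is nonzero at 2^-r for all large r, and
  Eisenstein specialisations occur for arbitrarily large r. The result is stated free of the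
  construction: field, valuation, and a homomorphism on a ring containing U.\<close>

lemma specialisation_exists:
  assumes "finite U" "U \<subseteq> Kf"
  obtains K v Bd and \<phi> :: "L \<Rightarrow> complex" where "number_field_of_degree K d" "dvf K v" "U \<subseteq> Bd"
    "\<And>u w. u \<in> Bd \<Longrightarrow> w \<in> Bd \<Longrightarrow> u + w \<in> Bd \<and> \<phi> (u + w) = \<phi> u + \<phi> w"
    "\<And>u w. u \<in> Bd \<Longrightarrow> w \<in> Bd \<Longrightarrow> u * w \<in> Bd \<and> \<phi> (u * w) = \<phi> u * \<phi> w"
    "\<And>q. fls_const q \<in> Bd \<and> \<phi> (fls_const q) = of_rat q" "\<And>u. u \<in> Bd \<Longrightarrow> \<phi> u \<in> K"
proof -
  have "\<forall>u\<in>U. eventually (\<lambda>r. \<exists>D G. poly D ((1/2) ^ r) \<noteq> 0 \<and> fc.ev D f * u = ff.ev G x) sequentially"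
  proof
    fix u assume "u \<in> U"
    then obtain D G where "D \<noteq> 0" "fc.ev D f * u = ff.ev G x" using assms by (auto simp: Kf_def)
    then show "eventually (\<lambda>r. \<exists>D G. poly D ((1/2) ^ r) \<noteq> 0 \<and> fc.ev D f * u = ff.ev G x) sequentially"
      using v2_poly_lead[of D] by (auto elim!: eventually_mono)
  qed
  then have "eventually (\<lambda>r. \<forall>u\<in>U. \<exists>D G. poly D ((1/2) ^ r) \<noteq> 0 \<and> fc.ev D f * u = ff.ev G x) sequentially"
    using assms(1) by (simp add: eventually_ball_finite)
  then obtain r0 where r0: "\<And>r u. r \<ge> r0 \<Longrightarrow> u \<in> U \<Longrightarrow> \<exists>D G. poly D ((1/2) ^ r) \<noteq> 0 \<and> fc.ev D f * u = ff.ev G x"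
    unfolding eventually_sequentially by blast
  obtain r z H' \<kappa> where r: "r \<ge> r0" and e: "eisenstein2 H' d z"
    and s: "specialisation R d f x H ((1/2) ^ r) (2 powi \<kappa> * z)"
    using eisenstein_specialisation[of r0] by blast
  interpret e: eisenstein2 H' d z by (rule e)
  interpret s: specialisation R d f x H "(1/2) ^ r" "2 powi \<kappa> * z" by (rule s)
  interpret K: dvf e.K e.v
  proof
    show "is_subfield_C e.K" using e.number_field by (simp add: number_field_of_degree_def)
    show "0 < e.v 2" using e.v_2 e.d_pos by simp
  qed (use e.v_mult e.v_add e.K_net in auto)
  have "(2::complex) powi \<kappa> \<in> e.K"
    using e.of_rat_in_K[of "2 powi \<kappa>"] unfolding of_rat_powi .
  then have x0: "2 powi \<kappa> * z \<in> e.K" using e.z_in_K by (rule K.F_mult)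
  have ev: "s.sp.ev G (2 powi \<kappa> * z) \<in> e.K" for G
    by (induction G) (auto intro!: K.F_add K.F_mult e.of_rat_in_K x0 simp del: mult.assoc)
  show ?thesis
  proof (rule that)
    show "number_field_of_degree e.K d" by (rule e.number_field)
    show "dvf e.K e.v" by (rule K.dvf_axioms)
    show "U \<subseteq> s.Bd" using r0[OF r] unfolding s.Bd_def by blast
    show "u + w \<in> s.Bd \<and> s.\<phi> (u + w) = s.\<phi> u + s.\<phi> w" if "u \<in> s.Bd" "w \<in> s.Bd" for u w
      using s.Bd_add that by blast
    show "u * w \<in> s.Bd \<and> s.\<phi> (u * w) = s.\<phi> u * s.\<phi> w" if "u \<in> s.Bd" "w \<in> s.Bd" for u w
      using s.Bd_mult that by blast
    show "fls_const q \<in> s.Bd \<and> s.\<phi> (fls_const q) = of_rat q" for q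
      using s.Bd_const by blast
    fix u assume "u \<in> s.Bd"
    then obtain D G where "poly D ((1/2) ^ r) \<noteq> 0" "fc.ev D f * u = ff.ev G x" unfolding s.Bd_def by blast
    from s.\<phi>_eq[OF this] show "s.\<phi> u \<in> e.K" using ev e.of_rat_in_K by (auto intro: K.F_divide)
  qed
qed

end

section \<open>A point of order \<open>2\<^sup>k\<close> over the Laurent series\<close>

text \<open>Halving on \<open>y\<^sup>2 = x(x+1)(x+b)\<close>: if \<open>x\<close>, \<open>x + 1\<close> and \<open>x + b\<close> are the squares of \<open>r\<close>, \<open>s\<close>
  and \<open>t\<close>, then \<open>(r + s)(r + t)\<close> is the abscissa of half the point.\<close>

lemma halving:
  fixes r s t :: "'a::comm_ring_1"
  assumes "s^2 = r^2 + 1" "t^2 = r^2 + b"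
  defines "x \<equiv> (r + s) * (r + t)"
  shows "(x^2 - b)^2 = 4 * (x * (x + 1) * (x + b)) * r^2"
proof -
  have 1: "x + 1 = (s + r) * (s + t)"
  proof -
    have "x + 1 = r^2 + 1 + r*t + s*r + s*t" by (simp add: x_def algebra_simps power2_eq_square)
    also have "\<dots> = s^2 + r*t + s*r + s*t" using assms by simp
    finally show ?thesis by (simp add: algebra_simps power2_eq_square)
  qed
  have b: "x + b = (t + r) * (t + s)"
  proof -
    have "x + b = r^2 + b + r*t + s*r + s*t" by (simp add: x_def algebra_simps power2_eq_square)
    also have "\<dots> = t^2 + r*t + s*r + s*t" using assms by simp
    finally show ?thesis by (simp add: algebra_simps power2_eq_square)
  qed
  have "x^2 - b = x * x + r^2 - t^2" using assms by (simp add: power2_eq_square)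
  also have "\<dots> = (r + t) * ((r + s)^2 * (r + t) + r - t)"
    by (simp add: x_def algebra_simps power2_eq_square)
  also have "(r + s)^2 = 2 * r * (r + s) + 1"
  proof -
    have "(r + s)^2 = r^2 + 2*r*s + s^2" by (simp add: algebra_simps power2_eq_square)
    then show ?thesis using assms by (simp add: algebra_simps power2_eq_square)
  qed
  also have "(2 * r * (r + s) + 1) * (r + t) + r - t = 2 * r * ((r + s) * (r + t) + 1)"
    by (simp add: algebra_simps)
  also have "(r + s) * (r + t) + 1 = (s + r) * (s + t)" using 1 by (simp add: x_def)
  finally have "(x^2 - b)^2 = ((r + t) * (2 * r * ((s + r) * (s + t))))^2" by simp
  also have "\<dots> = 4 * (((r + s) * (r + t)) * ((s + r) * (s + t)) * ((t + r) * (t + s))) * r^2"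
    by (simp add: power2_eq_square algebra_simps)
  finally show ?thesis unfolding 1 b by (simp add: x_def)
qed

text \<open>The root function handed to \<open>fps_radical\<close> only has to return a square root
  of the constant coefficient 1, so it may return its argument.\<close>

lemma fps_sqrt_exists:
  fixes f :: "rat fps" assumes "fps_nth f 0 = 1"
  obtains g where "g^2 = f" "fps_nth g 0 = 1"
proof
  let ?g = "fps_radical (\<lambda>n x. x) 2 f"
  show "fps_nth ?g 0 = 1" using assms by simp
  show "?g^2 = f"
    using power_radical[of f "\<lambda>n x. x" 1] assms by (simp add: numeral_2_eq_2)
qed

text \<open>A point of order \<open>2^(k+1)\<close> over \<open>\<rat>((t))\<close> near the cusp \<open>t = 0\<close>. The constant 16 makes the
  leading coefficients of all the radicands squares.\<close>

lemma halving_chain: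
  fixes k :: nat
  defines "b \<equiv> (fps_const 16 * fps_X ^ (2^k) :: rat fps)"
  obtains x :: "nat \<Rightarrow> rat fps" where
    "x 0 = 0"
    "\<And>j. 1 \<le> j \<Longrightarrow> j \<le> k \<Longrightarrow> \<exists>u. fps_nth u 0 = 1 \<and> x j = fps_const 4 * fps_X ^ (2^(k - j)) * u"
    "\<And>j. j < k \<Longrightarrow> ((x (Suc j))^2 - b)^2 = 4 * (x (Suc j) * (x (Suc j) + 1) * (x (Suc j) + b)) * x j"
proof -
  let ?P = "\<lambda>j x. (j = 0 \<longrightarrow> x = 0) \<and>
    (1 \<le> j \<and> j \<le> k \<longrightarrow> (\<exists>u. fps_nth u 0 = 1 \<and> x = fps_const 4 * fps_X ^ (2^(k - j)) * u))"
  let ?Q = "\<lambda>j x y. j < k \<longrightarrow> (y^2 - b)^2 = 4 * (y * (y + 1) * (y + b)) * x"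
  have "\<exists>f. \<forall>j. ?P j (f j) \<and> ?Q j (f j) (f (Suc j))"
  proof (rule dependent_nat_choice)
    show "\<exists>x. ?P 0 x" by (rule exI[of _ 0]) simp
  next
    fix x :: "rat fps" and j assume x: "?P j x"
    show "\<exists>y. ?P (Suc j) y \<and> ?Q j x y"
    proof (cases "j < k")
      case False
      then show ?thesis by (intro exI[of _ 0]) auto
    next
      case True
      \<comment> \<open>The nonzero radicands among x and x + b have order 2 m, so their roots have
        order m. That 2^k can be halved k times is the reason for the exponent of b.\<close>
      define m where "m = (2::nat) ^ (k - Suc j)"
      have mm: "(2::nat) ^ (k - j) = 2 * m" using True by (simp add: m_def flip: power_Suc Suc_diff_Suc)
      have m0: "m > 0" by (simp add: m_def)
      have "\<exists>r t u. r^2 = x \<and> t^2 = x + b \<and> r + t = fps_const 4 * fps_X ^ m * u \<and> fps_nth u 0 = 1 \<and> fps_nth r 0 = 0"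
      proof (cases "j = 0")
        case True
        then have "x = 0" using x by simp
        moreover have "(fps_const 4 * fps_X ^ m)^2 = b"
        proof -
          have c: "(fps_const 4)^2 = (fps_const 16 :: rat fps)" by (simp add: power2_eq_square)
          have "(2::nat) ^ k = m * 2" using mm True by simp
          then show ?thesis unfolding b_def by (simp only: power_mult_distrib c power_mult)
        qed
        ultimately show ?thesis by (intro exI[of _ 0] exI[of _ "fps_const 4 * fps_X ^ m"] exI[of _ 1]) auto
      next
        case False
        then obtain u where u: "fps_nth u 0 = 1" "x = fps_const 4 * fps_X ^ (2^(k - j)) * u"
          using x \<open>j < k\<close> by auto
        have xu: "x = fps_const 4 * fps_X ^ (2 * m) * u" using u mm by simp
        obtain g where g: "g^2 = u" "fps_nth g 0 = 1" using fps_sqrt_exists u by metis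
        \<comment> \<open>For j > 0 the order 2^k = 2 m + 2 m e of b exceeds the order 2 m of x, so
          x and x + b have the same leading term 4 t^(2 m), a square.\<close>
        obtain e where e: "(2::nat) ^ j = e + 1" by (metis Suc_eq_plus1 not0_implies_Suc power_not_zero zero_neq_numeral)
        have "(2::nat)^j > 1" using False one_less_power[of "2::nat" j] by auto
        then have "e > 0" using e by simp
        have "(2::nat)^k = 2^(k - j) * 2^j" using \<open>j < k\<close> by (simp flip: power_add)
        also have "\<dots> = 2 * m + 2 * m * e" using mm e by simp
        finally obtain n where n: "(2::nat)^k = 2 * m + n" "n = 2 * m * e" by blast
        have "n > 0" using m0 n \<open>e > 0\<close> by simp
        define w where "w = u + fps_const 4 * fps_X ^ n"
        have "fps_nth w 0 = 1" using u \<open>n > 0\<close> by (simp add: w_def)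
        then obtain h where h: "h^2 = w" "fps_nth h 0 = 1" using fps_sqrt_exists by metis
        have c: "(fps_const 2)^2 = (fps_const 4 :: rat fps)" by (simp add: power2_eq_square)
        have "x + b = fps_const 4 * fps_X ^ (2 * m) * w"
        proof -
          have "fps_const 16 = (fps_const 4 * fps_const 4 :: rat fps)" by simp
          then show ?thesis unfolding xu b_def w_def n(1) by (simp only: power_add algebra_simps)
        qed
        then have "(fps_const 2 * fps_X ^ m * h)^2 = x + b"
          by (simp only: power_mult_distrib h c power_mult[symmetric] mult.commute)
        moreover have "(fps_const 2 * fps_X ^ m * g)^2 = x"
          unfolding xu by (simp only: power_mult_distrib g c power_mult[symmetric] mult.commute)
        \<comment> \<open>Roots of equal sign are taken, so the leading coefficients add up to 2 + 2
          = 4 and the shape of the abscissa is reproduced.\<close>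
        moreover have "fps_const 2 * fps_X ^ m * g + fps_const 2 * fps_X ^ m * h
            = fps_const 4 * fps_X ^ m * (fps_const (1/2) * (g + h))"
        proof -
          have "fps_const 2 = (fps_const 4 * fps_const (1/2) :: rat fps)" by simp
          then show ?thesis by (simp only: algebra_simps)
        qed
        moreover have "fps_nth (fps_const (1/2) * (g + h)) 0 = 1" using g h by simp
        moreover have "fps_nth (fps_const 2 * fps_X ^ m * g) 0 = 0" using m0 by (simp add: fps_mult_nth_0)
        ultimately show ?thesis by blast
      qed
      then obtain r t u where r: "r^2 = x" "t^2 = x + b" "r + t = fps_const 4 * fps_X ^ m * u" "fps_nth u 0 = 1" "fps_nth r 0 = 0"
        by blast
      have "fps_nth (x + 1) 0 = 1" using r by (auto simp: power2_eq_square fps_mult_nth_0 simp flip: r(1))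
      then obtain s where s: "s^2 = x + 1" "fps_nth s 0 = 1" using fps_sqrt_exists by metis
      define y where "y = (r + s) * (r + t)"
      have "(y^2 - b)^2 = 4 * (y * (y + 1) * (y + b)) * r^2"
        unfolding y_def by (rule halving) (use r s in auto)
      then have "?Q j x y" using r by simp
      moreover have "y = fps_const 4 * fps_X ^ m * (u * (r + s))" "fps_nth (u * (r + s)) 0 = 1"
        using r s by (auto simp: y_def fps_mult_nth_0 mult_ac)
      then have "?P (Suc j) y" unfolding m_def by auto
      ultimately show ?thesis by blast
    qed
  qed
  then obtain f where "\<And>j. ?P j (f j) \<and> ?Q j (f j) (f (Suc j))" by blast
  then show ?thesis using that[of f] by blast
qed

section \<open>Algebraicity over Q(t) and the passage to function fields\<close>

definition tpoly :: "L set" where "tpoly = {f \<in> lo 0. \<exists>m. f \<in> hi m}"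

lemma tpoly_add: "f \<in> tpoly \<Longrightarrow> g \<in> tpoly \<Longrightarrow> f + g \<in> tpoly"
proof -
  assume "f \<in> tpoly" "g \<in> tpoly"
  then obtain m l where "f \<in> lo 0" "g \<in> lo 0" "f \<in> hi m" "g \<in> hi l" by (auto simp: tpoly_def)
  then show ?thesis using hi_mono[of f m "max m l"] hi_mono[of g l "max m l"]
    by (auto simp: tpoly_def intro!: lo_add hi_add)
qed

lemma tpoly_mult: "f \<in> tpoly \<Longrightarrow> g \<in> tpoly \<Longrightarrow> f * g \<in> tpoly"
proof -
  assume "f \<in> tpoly" "g \<in> tpoly"
  then obtain m l where "f \<in> lo 0" "g \<in> lo 0" "f \<in> hi m" "g \<in> hi l" by (auto simp: tpoly_def)
  then have "f * g \<in> lo 0" "f * g \<in> hi (m + l)" by (auto intro: lo_multI[of f 0 g 0] hi_mult)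
  then show ?thesis by (auto simp: tpoly_def)
qed

lemma tpoly_const: "fls_const q \<in> tpoly"
  using fls_const_lo[of 0 q] fls_const_hi[of 0 q] by (auto simp: tpoly_def)

lemma tpoly_0: "0 \<in> tpoly" and tpoly_1: "1 \<in> tpoly"
  using tpoly_const[of 0] tpoly_const[of 1] by auto

lemma tpoly_minus: "f \<in> tpoly \<Longrightarrow> - f \<in> tpoly"
  using tpoly_mult[OF tpoly_const[of "-1"], of f] by simp

lemma tpoly_power: "f \<in> tpoly \<Longrightarrow> f ^ n \<in> tpoly"
  by (induction n) (auto intro: tpoly_1 tpoly_mult)

lemma tpoly_X: "fls_X ^ n \<in> tpoly"
proof -
  have "(fls_X ^ n :: L) \<in> lo 0" "(fls_X ^ n :: L) \<in> hi (int n)"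
    by (auto simp: lo_def hi_def X_power_nth)
  then show ?thesis by (auto simp: tpoly_def)
qed

lemma tpoly_numeral: "numeral n \<in> tpoly"
  using tpoly_const[of "numeral n"] by simp

definition TP :: "L poly set" where "TP = {g. \<forall>j. coeff g j \<in> tpoly}"

lemma TP_add: "g \<in> TP \<Longrightarrow> h \<in> TP \<Longrightarrow> g + h \<in> TP"
  by (simp add: TP_def tpoly_add)

lemma TP_minus: "g \<in> TP \<Longrightarrow> - g \<in> TP"
  by (simp add: TP_def tpoly_minus)

lemma TP_diff: "g \<in> TP \<Longrightarrow> h \<in> TP \<Longrightarrow> g - h \<in> TP"
  using TP_add[of g "- h"] TP_minus by simp

lemma TP_mult: assumes "g \<in> TP" "h \<in> TP" shows "g * h \<in> TP"
proof -
  have sum: "sum f I \<in> tpoly" if "\<And>i. i \<in> I \<Longrightarrow> f i \<in> tpoly" for f and I :: "nat set"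
    using that by (induction I rule: infinite_finite_induct) (auto intro: tpoly_0 tpoly_add)
  have "coeff (g * h) j \<in> tpoly" for j
    unfolding coeff_mult by (intro sum tpoly_mult) (use assms in \<open>auto simp: TP_def\<close>)
  then show ?thesis by (simp add: TP_def)
qed

lemma TP_1: "1 \<in> TP"
proof -
  have "coeff [:1 :: L:] j \<in> tpoly" for j by (cases j) (simp_all add: tpoly_1 tpoly_0)
  then show ?thesis by (simp add: TP_def one_pCons)
qed

lemma TP_power: "g \<in> TP \<Longrightarrow> g ^ n \<in> TP"
  by (induction n) (auto intro: TP_mult TP_1)

lemma TP_smult: "f \<in> tpoly \<Longrightarrow> g \<in> TP \<Longrightarrow> smult f g \<in> TP"
  by (simp add: TP_def tpoly_mult)

text \<open>The iterated duplication formula: \<open>fst / snd\<close> is the abscissa of the \<open>2^i\<close>-fold point.\<close>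

fun dup :: "L \<Rightarrow> nat \<Rightarrow> L poly \<times> L poly" where
  "dup b 0 = ([:0, 1:], 1)"
| "dup b (Suc i) = (case dup b i of (N, M) \<Rightarrow>
     ((N^2 - smult b (M^2))^2, smult 4 (N * M * (N + M) * (N + smult b M))))"

lemma dup_TP: assumes "b \<in> tpoly" shows "fst (dup b i) \<in> TP \<and> snd (dup b i) \<in> TP"
proof (induction i)
  case 0
  have "coeff [:0, 1 :: L:] j \<in> tpoly" for j by (cases j; cases "j - 1") (simp_all add: tpoly_0 tpoly_1)
  then show ?case by (simp add: TP_1) (simp add: TP_def)
next
  case (Suc i)
  obtain N M where "dup b i = (N, M)" by fastforce
  then show ?case using Suc assms
    by (simp add: TP_power TP_diff TP_smult TP_mult TP_add tpoly_numeral)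
qed

text \<open>The numerator has the larger degree at each stage, so it never vanishes; this turns the
  relation of \<open>dup_eval\<close> into a nontrivial equation.\<close>

lemma dup_degree:
  "degree (snd (dup b i)) < 4 ^ i \<and> degree (fst (dup b i)) = 4 ^ i \<and> fst (dup b i) \<noteq> 0"
proof (induction i)
  case (Suc i)
  obtain N M where NM: "dup b i = (N, M)" by fastforce
  define n where "n = (4::nat) ^ i"
  have IH: "degree M < n" "degree N = n" "N \<noteq> 0" using Suc NM by (auto simp: n_def)
  have "degree (smult b (M^2)) \<le> 2 * degree M"
    by (rule order_trans[OF degree_smult_le]) (simp add: degree_power_eq[of M 2] degree_power_le mult.commute)
  also have "\<dots> < degree (N^2)" using IH by (simp add: degree_power_eq)
  finally have lt: "degree (- smult b (M^2)) < degree (N^2)" by simp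
  then have dg: "degree (N^2 - smult b (M^2)) = 2 * n"
    using degree_add_eq_left[OF lt] IH by (simp add: degree_power_eq)
  then have nz: "N^2 - smult b (M^2) \<noteq> 0" using IH by auto
  have d1: "degree (fst (dup b (Suc i))) = 4 ^ Suc i" "fst (dup b (Suc i)) \<noteq> 0"
    using dg nz by (auto simp: NM degree_power_eq n_def)
  have "degree (N + M) \<le> n" "degree (N + smult b M) \<le> n"
    using IH degree_smult_le[of b M] by (auto intro!: degree_add_le)
  then have "degree (N * M * (N + M) * (N + smult b M)) \<le> n + degree M + n + n"
    using IH by (intro order_trans[OF degree_mult_le] add_mono) auto
  then have "degree (snd (dup b (Suc i))) \<le> n + degree M + n + n"
    using order_trans[OF degree_smult_le] by (simp add: NM)
  also have "\<dots> < 4 ^ Suc i" using IH by (simp add: n_def)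
  finally show ?case using d1 by simp
qed simp

text \<open>Stated without division. For i = k and \<open>x 0 = 0\<close> it exhibits x k as a root
  of \<open>fst (dup b k)\<close>.\<close>

lemma dup_eval:
  assumes "\<And>j. j < k \<Longrightarrow> ((x (Suc j))^2 - b)^2 = 4 * (x (Suc j) * (x (Suc j) + 1) * (x (Suc j) + b)) * x j"
    and "i \<le> k"
  shows "poly (fst (dup b i)) (x k) = x (k - i) * poly (snd (dup b i)) (x k)"
  using assms(2)
proof (induction i)
  case (Suc i)
  obtain N M where NM: "dup b i = (N, M)" by fastforce
  define j where "j = k - Suc i"
  have j: "k - i = Suc j" "j < k" using Suc.prems by (auto simp: j_def)
  define y m where "y = x (Suc j)" and "m = poly M (x k)"
  have IH: "poly N (x k) = y * m" using Suc NM j by (simp add: y_def m_def)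
  have "poly (fst (dup b (Suc i))) (x k) = ((y * m)^2 - b * m^2)^2" by (simp add: NM IH m_def)
  also have "\<dots> = m^4 * (y^2 - b)^2" by (simp add: power2_eq_square power4_eq_xxxx algebra_simps)
  also have "\<dots> = m^4 * (4 * (y * (y + 1) * (y + b)) * x j)" using assms(1)[OF j(2)] by (simp add: y_def)
  also have "\<dots> = x j * (4 * ((y * m) * m * (y * m + m) * (y * m + b * m)))"
    by (simp add: power4_eq_xxxx algebra_simps)
  also have "\<dots> = x j * poly (snd (dup b (Suc i))) (x k)" by (simp add: NM IH m_def)
  finally show ?case by (simp add: j_def)
qed simp

text \<open>A relation of least degree over Q[t] plays the role of the minimal polynomial of \<eta>;
  multiplying \<eta> by its leading coefficient a makes it integral.\<close>

lemma integral_generator: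
  assumes "\<eta> \<in> lo 0" "P \<in> TP" "P \<noteq> 0" "poly P \<eta> = 0"
  obtains a \<Phi> n c where "a \<in> tpoly" "a \<noteq> 0" "function_field \<Phi> (a * \<eta>) n c"
proof -
  define Q where "Q = (\<lambda>m. \<exists>g\<in>TP. g \<noteq> 0 \<and> poly g \<eta> = 0 \<and> degree g = m)"
  define n where "n = (LEAST m. Q m)"
  have "Q (degree P)" using assms by (auto simp: Q_def)
  then have "Q n" unfolding n_def by (rule LeastI)
  then obtain g where g: "g \<in> TP" "g \<noteq> 0" "poly g \<eta> = 0" "degree g = n" by (auto simp: Q_def)
  have least: "h = 0" if "h \<in> TP" "poly h \<eta> = 0" "degree h < n" for h
    using not_less_Least[of "degree h" Q] that unfolding n_def[symmetric] by (auto simp: Q_def)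
  have n_pos: "n > 0"
  proof (rule ccontr)
    assume "\<not> n > 0"
    then obtain q where "g = [:q:]" using g(4) degree_eq_zeroE by blast
    then show False using g by simp
  qed
  define a where "a = coeff g n"
  have a: "a \<in> tpoly" "a \<noteq> 0" using g by (auto simp: a_def TP_def)
  \<comment> \<open>The coefficients of the monic polynomial a^(n-1) g(X / a).\<close>
  define cf where "cf = (\<lambda>i. if i < n then coeff g i * a ^ (n - 1 - i) else if i = n then 1 else 0)"
  define \<Phi> where "\<Phi> = (\<Sum>i\<le>n. monom (cf i) i)"
  have c\<Phi>: "coeff \<Phi> i = cf i" for i by (auto simp: \<Phi>_def coeff_sum cf_def)
  have cf_t: "cf i \<in> tpoly" for i
    using g(1) a by (auto simp: cf_def TP_def intro!: tpoly_mult tpoly_power tpoly_0 tpoly_1)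
  have deg: "degree \<Phi> = n"
    by (intro antisym degree_le le_degree) (auto simp: c\<Phi> cf_def)
  have root: "poly \<Phi> (a * \<eta>) = 0"
  proof -
    have "poly \<Phi> (a * \<eta>) = (\<Sum>i\<le>n. cf i * (a * \<eta>) ^ i)" by (simp add: \<Phi>_def poly_sum poly_monom)
    also have "\<dots> = (\<Sum>i\<le>n. a ^ (n - 1) * (coeff g i * \<eta> ^ i))"
    proof (rule sum.cong[OF refl])
      fix i assume "i \<in> {..n}"
      show "cf i * (a * \<eta>) ^ i = a ^ (n - 1) * (coeff g i * \<eta> ^ i)"
      proof (cases "i < n")
        case True
        then have "a ^ (n - 1) = a ^ (n - 1 - i) * a ^ i" by (simp flip: power_add)
        then show ?thesis using True by (simp add: cf_def power_mult_distrib mult_ac)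
      next
        case False
        then have "i = n" using \<open>i \<in> {..n}\<close> by simp
        moreover have "a ^ n = a ^ (n - 1) * a" using n_pos by (simp flip: power_Suc2)
        ultimately show ?thesis by (simp add: cf_def a_def power_mult_distrib mult_ac)
      qed
    qed
    also have "\<dots> = a ^ (n - 1) * poly g \<eta>" using g(4) by (simp add: poly_altdef sum_distrib_left)
    finally show ?thesis using g(3) by simp
  qed
  have "\<forall>i. \<exists>m. cf i \<in> hi (int m)"
  proof
    fix i
    obtain m where "cf i \<in> hi m" using cf_t[of i] by (auto simp: tpoly_def)
    then have "cf i \<in> hi (int (nat m))" by (rule hi_mono) simp
    then show "\<exists>m. cf i \<in> hi (int m)" ..
  qed
  then obtain m where m: "\<And>i. cf i \<in> hi (int (m i))" by metis
  \<comment> \<open>A bound for all degrees in t; below the top n - i is at least 1, so c (n - i) is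
    a bound as well.\<close>
  define c where "c = Max (m ` {..n})"
  have c: "cf i \<in> hi (int (c * (n - i)))" if "i \<le> n" for i
  proof (cases "i = n")
    case True
    then show ?thesis using fls_const_hi[of 0 1] by (simp add: cf_def)
  next
    case False
    have "m i \<le> c" unfolding c_def using that by (intro Max_ge) auto
    also have "c = c * 1" by simp
    also have "c * 1 \<le> c * (n - i)" using False that by (intro mult_left_mono) auto
    finally have "int (m i) \<le> int (c * (n - i))" by (simp only: of_nat_le_iff)
    with m show ?thesis by (rule hi_mono)
  qed
  have "function_field \<Phi> (a * \<eta>) n c"
  proof
    show "0 < n" "degree \<Phi> = n" "coeff \<Phi> n = 1" by (auto simp: n_pos deg c\<Phi> cf_def)
    show "coeff \<Phi> j \<in> lo 0" for j using cf_t[of j] by (simp add: c\<Phi> tpoly_def)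
    show "coeff \<Phi> j \<in> hi (int (c * (n - j)))" if "j \<le> n" for j using c that by (simp add: c\<Phi>)
    show "poly \<Phi> (a * \<eta>) = 0" by (rule root)
    show "a * \<eta> \<in> lo 0" using a assms(1) by (intro lo_multI[of a 0 \<eta> 0]) (auto simp: tpoly_def)
  next
    fix h :: "L poly" assume h: "\<And>j. \<exists>m. coeff h j \<in> hi m" "degree h < n" "poly h (a * \<eta>) = 0"
    define e where "e = Max (insert 0 ((\<lambda>i. nat (- fls_subdegree (coeff h i))) ` {..degree h}))"
    have e: "coeff h i \<in> lo (- int e)" for i
    proof (cases "i \<le> degree h")
      case True
      then have "nat (- fls_subdegree (coeff h i)) \<le> e" unfolding e_def by (intro Max_ge) auto
      then show ?thesis by (auto simp: lo_iff)
    qed (simp add: coeff_eq_0)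
    \<comment> \<open>The factor t^e clears the poles at t = 0 and the substitution of a X turns a
      relation for a \<eta> into one for \<eta>, so that the minimality of n applies.\<close>
    define h' where "h' = smult (fls_X ^ e) (pcompose h [:0, a:])"
    have ch': "coeff h' i = fls_X ^ e * coeff h i * a ^ i" for i
      by (simp add: h'_def coeff_pcompose_linear mult_ac)
    have "h' \<in> TP"
      unfolding TP_def
    proof (intro CollectI allI, subst ch', rule tpoly_mult)
      fix i
      show "a ^ i \<in> tpoly" by (rule tpoly_power[OF a(1)])
      have X: "(fls_X ^ e :: L) \<in> lo (int e)" "(fls_X ^ e :: L) \<in> hi (int e)"
        by (auto simp: lo_def hi_def X_power_nth)
      obtain m where "coeff h i \<in> hi m" using h(1) by blast
      then have "fls_X ^ e * coeff h i \<in> hi (int e + m)" by (rule hi_mult[OF X(2)])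
      moreover have "fls_X ^ e * coeff h i \<in> lo 0" by (rule lo_multI[OF X(1) e]) simp
      ultimately show "fls_X ^ e * coeff h i \<in> tpoly" by (auto simp: tpoly_def)
    qed
    moreover have "poly h' \<eta> = 0" using h(3) by (simp add: h'_def poly_pcompose mult.commute)
    moreover have "degree h' < n"
    proof (rule le_less_trans[OF _ h(2)], rule degree_le, intro allI impI)
      fix i assume "degree h < i"
      then show "coeff h' i = 0" by (simp add: ch' coeff_eq_0)
    qed
    ultimately have "h' = 0" by (rule least)
    then have "coeff h i = 0" for i using ch'[of i] a(2) by simp
    then show "h = 0" by (simp add: poly_eq_iff)
  qed
  with a that show ?thesis by blast
qed

lemma (in pole_pair) tpoly_Kf:
  assumes "fls_X \<in> Kf" "u \<in> tpoly" shows "u \<in> Kf"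
proof -
  obtain m where m: "u \<in> hi m" "u \<in> lo 0" using assms by (auto simp: tpoly_def)
  have const: "fls_const q \<in> Kf" for q by (rule R_sub_Kf[OF R_const])
  have sum: "sum g I \<in> Kf" if "\<And>i. i \<in> I \<Longrightarrow> g i \<in> Kf" for g and I :: "nat set"
    using that by (induction I rule: infinite_finite_induct) (use const[of 0] Kf_add in auto)
  have pow: "fls_X ^ i \<in> Kf" for i
    by (induction i) (use const[of 1] assms(1) Kf_mult in auto)
  have "u = (\<Sum>i\<le>nat m. fls_const (fls_nth u (int i)) * fls_X ^ i)"
  proof (rule fls_eqI)
    fix j
    have "fls_nth (\<Sum>i\<le>nat m. fls_const (fls_nth u (int i)) * fls_X ^ i) j
        = (\<Sum>i\<le>nat m. if j = int i then fls_nth u j else 0)"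
      by (auto simp: fls_nth_sum fls_mult_const_nth X_power_nth intro!: sum.cong)
    also have "\<dots> = fls_nth u j"
    proof (cases "0 \<le> j \<and> j \<le> m")
      case True
      then have "(\<Sum>i\<le>nat m. if j = int i then fls_nth u j else 0) = (\<Sum>i\<le>nat m. if i = nat j then fls_nth u j else 0)"
        by (intro sum.cong) auto
      moreover have "nat j \<le> nat m" using True by (simp add: nat_mono)
      ultimately show ?thesis by simp
    next
      case False
      then have "fls_nth u j = 0" using m by (auto simp: lo_def hi_def)
      then have "(if j = int i then fls_nth u j else 0) = 0" for i by (cases "j = int i") simp_all
      then show ?thesis using \<open>fls_nth u j = 0\<close> by (simp only: sum.neutral_const)
    qed
    finally show "fls_nth u j = fls_nth (\<Sum>i\<le>nat m. fls_const (fls_nth u (int i)) * fls_X ^ i) j" ..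
  qed
  also have "\<dots> \<in> Kf" by (intro sum Kf_mult const pow)
  finally show ?thesis .
qed

lemma (in function_field) pole_ring_R: "pole_ring R"
  by standard (use R_const R_add R_mult R_lo_1 in auto)

text \<open>Beyond the last gap both d and d + 1 are pole orders of functions in R. As all of R lies
  in Q(f, x), so do the quotients 1/t and t^-c a \<eta> from \<open>R_fractions\<close>, and hence t
  and \<eta>.\<close>

lemma specialise_algebraic:
  assumes "\<eta> \<in> lo 0" "P \<in> TP" "P \<noteq> 0" "poly P \<eta> = 0"
  shows "\<exists>d0. \<forall>d\<ge>d0. \<exists>R f x H. pole_relation R d f x H \<and>
     \<eta> \<in> pole_pair.Kf f x \<and> fls_X \<in> pole_pair.Kf f x"
proof -
  obtain a \<Phi> n c where a: "a \<in> tpoly" "a \<noteq> 0" and ff: "function_field \<Phi> (a * \<eta>) n c"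
    using integral_generator[OF assms] by blast
  interpret function_field \<Phi> "a * \<eta>" n c by (rule ff)
  define M where "M = {d::nat. \<not> (\<exists>x\<in>R. x \<noteq> 0 \<and> fls_subdegree x = - int d)}"
  have "finite M" using finite_gaps by (simp add: M_def)
  then obtain d1 where d1: "\<And>d. d \<in> M \<Longrightarrow> d \<le> d1" unfolding finite_nat_set_iff_bounded_le by blast
  have "\<exists>f x H. pole_relation R d f x H \<and> \<eta> \<in> pole_pair.Kf f x \<and> fls_X \<in> pole_pair.Kf f x"
    if d: "d \<ge> Suc d1" for d
  proof -
    have "d \<notin> M" "d + 1 \<notin> M" using d1 d by force+
    then obtain f x where fx: "f \<in> R" "fls_subdegree f = - int d" "x \<in> R" "fls_subdegree x = - int (d + 1)"
      by (auto simp: M_def)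
    interpret pole_ring R by (rule pole_ring_R)
    interpret pole_pair R d f x
      by standard (use fx d in auto)
    obtain H where H: "degree H = d" "ff.ev H x = 0" "coeff H 0 \<noteq> 0"
      "degree (coeff H 0) = degree (coeff H d) + (d + 1)"
      "\<And>i. 0 < i \<Longrightarrow> i < d \<Longrightarrow> coeff H i \<noteq> 0 \<Longrightarrow> wgt H i < wgt H d" using relation_exists by blast
    have "pole_relation R d f x H" by unfold_locales (use H in auto)
    obtain r where r: "r \<in> R" "r \<noteq> 0" "fls_X_inv * r \<in> R" "fls_X_inv ^ c * (a * \<eta>) * r \<in> R"
      using R_fractions by blast
    have "fls_X_inv = (fls_X_inv * r) * inverse r" using r(2) by simp
    also have "\<dots> \<in> Kf" using r by (intro Kf_mult Kf_inverse R_sub_Kf)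
    finally have s: "fls_X_inv \<in> Kf" .
    have XX: "fls_X_inv * fls_X = (1 :: L)"
      by (intro fls_eqI) (simp add: fls_X_times_conv_shift fls_X_inv_times_conv_shift)
    then have sX: "inverse fls_X_inv = (fls_X :: L)" by (rule inverse_unique)
    from Kf_inverse[OF s] have t: "fls_X \<in> Kf" unfolding sX .
    have pow: "fls_X ^ i \<in> Kf" for i
      by (rule tpoly_Kf[OF t tpoly_X])
    have "(fls_X ^ c * fls_X_inv ^ c :: L) = 1"
      using XX by (simp add: mult.commute flip: power_mult_distrib)
    then have "\<eta> = (fls_X_inv ^ c * (a * \<eta>) * r) * inverse r * fls_X ^ c * inverse a"
      using r(2) a(2) by (simp add: field_simps)
    also have "\<dots> \<in> Kf" using r a by (intro Kf_mult Kf_inverse R_sub_Kf pow tpoly_Kf[OF t])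
    finally have "\<eta> \<in> Kf" .
    with \<open>pole_relation R d f x H\<close> t show ?thesis by blast
  qed
  then show ?thesis by blast
qed

section \<open>Torsion over the specialised fields\<close>

text \<open>The twist by \<open>D = x(x+1)(x+b)\<close> makes the point with abscissa \<open>x\<close> of \<open>y\<^sup>2 = x(x+1)(x+b)\<close>
  rational.\<close>

locale halving_tower = dvf K v for K v +
  fixes b :: complex and X :: "nat \<Rightarrow> complex" and k :: nat
  assumes b_K: "b \<in> K" and b_ne: "b \<noteq> 0" "b \<noteq> 1"
    and X_K: "\<And>j. j \<le> k \<Longrightarrow> X j \<in> K" and X_0: "X 0 = 0" and X_inj: "inj_on X {..k}"
    and X_ne: "\<And>j. 1 \<le> j \<Longrightarrow> j \<le> k \<Longrightarrow> X j \<noteq> 0 \<and> X j + 1 \<noteq> 0 \<and> X j + b \<noteq> 0"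
    and X_double: "\<And>j. j < k \<Longrightarrow>
       ((X (Suc j))^2 - b)^2 = 4 * (X (Suc j) * (X (Suc j) + 1) * (X (Suc j) + b)) * X j"
    and k_pos: "k > 0"
begin

definition D :: complex where "D = X k * (X k + 1) * (X k + b)"

lemma D_nz: "D \<noteq> 0" using X_ne[of k] k_pos by (simp add: D_def)

lemma D_K: "D \<in> K" using X_K[of k] b_K unfolding D_def by (intro F_mult F_add) auto

sublocale curve_over_dvf "D * (1 + b)" "D^2 * b" K v
proof
  show "D\<^sup>2 * b \<noteq> 0" using D_nz b_ne by simp
  have "(D * (1 + b))\<^sup>2 - 4 * (D\<^sup>2 * b) = (D * (1 - b))\<^sup>2" by (simp add: power2_eq_square algebra_simps)
  moreover have "(D * (1 - b))\<^sup>2 \<noteq> 0" using D_nz b_ne by simp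
  ultimately show "(D * (1 + b))\<^sup>2 \<noteq> 4 * (D\<^sup>2 * b)" by auto
  show "D * (1 + b) \<in> K" "D\<^sup>2 * b \<in> K" using D_K b_K by (auto intro!: F_closed)
qed

lemma cubic: "(D*x)^3 + D * (1 + b) * (D*x)^2 + D^2 * b * (D*x) = D^3 * (x * (x + 1) * (x + b))"
  by (simp add: power2_eq_square power3_eq_cube algebra_simps)

definition P :: wpoint where "P = Some (D * X k, D^2)"

lemma P_EF: "P \<in> EF"
proof -
  have "(D^2)^2 = D^3 * D" by (simp add: power2_eq_square power3_eq_cube mult_ac)
  also have "\<dots> = (D * X k)^3 + D * (1 + b) * (D * X k)^2 + D^2 * b * (D * X k)"
    unfolding cubic by (simp add: D_def)
  finally show ?thesis using D_K X_K[of k] by (auto simp: P_def EF_Some intro!: F_closed)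
qed

lemma P_E: "P \<in> E" using P_EF EF_sub by blast

lemma multiples: "i \<le> k \<Longrightarrow> \<exists>y. mult (2^i) P = Some (D * X (k - i), y)"
proof (induction i)
  case 0
  then show ?case by (simp add: P_def)
next
  case (Suc i)
  then obtain y where y: "mult (2^i) P = Some (D * X (k - i), y)" by auto
  define j where "j = k - Suc i"
  have j: "k - i = Suc j" "j < k" using Suc.prems by (auto simp: j_def)
  let ?x = "X (Suc j)"
  have yE: "Some (D * ?x, y) \<in> E" using mult_in_E[OF P_E, of "2^i"] y j by simp
  have x: "?x * (?x + 1) * (?x + b) \<noteq> 0" using X_ne[of "Suc j"] j by simp
  have "y^2 = D^3 * (?x * (?x + 1) * (?x + b))" using yE cubic[of ?x] by simp
  then have "y \<noteq> 0" using D_nz x by auto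
  then obtain y' where "wadd cf (Some (D * ?x, y)) (Some (D * ?x, y)) =
      Some (((D * ?x)^2 - D^2 * b)^2 / (4*((D * ?x)^3 + D * (1 + b) * (D * ?x)^2 + D^2 * b * (D * ?x))), y')"
    using double_affine[OF yE] by blast
  also have "((D * ?x)^2 - D^2 * b)^2 / (4*((D * ?x)^3 + D * (1 + b) * (D * ?x)^2 + D^2 * b * (D * ?x))) = D * X j"
  proof -
    have "((D * ?x)^2 - D^2 * b)^2 = D^4 * (?x^2 - b)^2" by (simp add: power2_eq_square power4_eq_xxxx algebra_simps)
    also have "\<dots> = D^4 * (4 * (?x * (?x + 1) * (?x + b)) * X j)" using X_double[OF j(2)] by simp
    also have "\<dots> = (D * X j) * (4 * (D^3 * (?x * (?x + 1) * (?x + b))))"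
      by (simp add: power3_eq_cube power4_eq_xxxx mult_ac)
    finally have eq: "((D * ?x)^2 - D^2 * b)^2 = (D * X j) * (4 * (D^3 * (?x * (?x + 1) * (?x + b))))" .
    have nz: "4 * (D^3 * (?x * (?x + 1) * (?x + b))) \<noteq> 0" using D_nz x by simp
    show ?thesis unfolding cubic eq by (rule nonzero_mult_div_cancel_right[OF nz])
  qed
  finally have "wadd cf (mult (2^i) P) (mult (2^i) P) = Some (D * X j, y')" using y j by simp
  moreover have "mult (2 ^ Suc i) P = wadd cf (mult (2^i) P) (mult (2^i) P)"
    using mult_double[OF P_E, of "2^i"] by simp
  ultimately show ?case by (auto simp: j_def)
qed

lemma order: "mult (2 ^ Suc k) P = None"
proof -
  obtain y where y: "mult (2^k) P = Some (0, y)" using multiples[of k] X_0 by auto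
  then have "Some (0, y) \<in> E" using mult_in_E[OF P_E, of "2^k"] by simp
  then have "y = 0" by simp
  then have "wadd cf (mult (2^k) P) (mult (2^k) P) = None" using y by simp
  then show ?thesis using mult_double[OF P_E, of "2^k"] by simp
qed

text \<open>Only the points 2^i P with i \<le> k are counted; their abscissae are distinct. Since
  \<open>card\<close> of an infinite set is 0, the comparison relies on
  \<open>finite_torsion\<close>.\<close>

lemma card_torsion: "card (torsion_points cf K) \<ge> k"
proof -
  have "(\<lambda>i. mult (2^i) P) ` {..k} \<subseteq> TF"
  proof clarify
    fix i assume "i \<le> k"
    have "mult (2^(Suc k - i)) (mult (2^i) P) = mult (2^(Suc k - i) * 2^i) P" by (rule mult_mult[OF P_E])
    also have "(2::nat)^(Suc k - i) * 2^i = 2 ^ Suc k" using \<open>i \<le> k\<close> by (simp flip: power_add)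
    finally have "mult (2^(Suc k - i)) (mult (2^i) P) = None" using order by simp
    then have "torsion (mult (2^i) P)" using mult_in_E[OF P_E] unfolding torsion_def
      by (intro conjI exI[of _ "2^(Suc k - i)"]) auto
    then show "mult (2^i) P \<in> TF" using EF_mult[OF P_EF] by (simp add: TF_def)
  qed
  moreover have "inj_on (\<lambda>i. mult (2^i) P) {..k}"
  proof (rule inj_onI)
    fix i j assume ij: "i \<in> {..k}" "j \<in> {..k}" "mult (2^i) P = mult (2^j) P"
    then have "D * X (k - i) = D * X (k - j)" using multiples[of i] multiples[of j] by auto
    then have "X (k - i) = X (k - j)" using D_nz by simp
    then have "k - i = k - j" using X_inj by (auto dest: inj_onD)
    then show "i = j" using ij by auto
  qed
  ultimately have "card {..k} \<le> card TF"
    using finite_torsion unfolding torsion_points_eq by (metis card_image card_mono)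
  then show ?thesis by (simp add: torsion_points_eq)
qed

lemma elliptic: "elliptic_over cf K"
proof -
  have "wdisc cf = 16 * (D^2 * b)^2 * ((D * (1 + b))^2 - 4 * (D^2 * b))"
    by (simp add: wdisc_def Let_def power2_eq_square power3_eq_cube algebra_simps)
  also have "\<dots> \<noteq> 0" using B_nz disc_nz by simp
  finally show ?thesis using A_in B_in by (simp add: elliptic_over_def coeffs_in_def)
qed

end

lemma S_A1_member:
  assumes "halving_tower K v b X k" "number_field_of_degree K d" "d > 0"
  shows "d \<in> S_A1 k"
proof -
  interpret halving_tower K v b X k by (rule assms)
  show ?thesis unfolding S_A1_def using assms(2,3) elliptic card_torsion by blast
qed

section \<open>Density and the conclusion for almost all degrees\<close>

lemma upper_density_cofinite:
  assumes "finite ({0<..} - S)" shows "upper_density S = 1"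
proof -
  define c where "c = card ({0<..} - S)"
  have lower: "(real n - real c) / real n \<le> real (card (S \<inter> {1..n})) / real n" for n :: nat
  proof -
    have "{1..n} = S \<inter> {1..n} \<union> ({1..n} - S)" by blast
    then have "card {1..n} \<le> card (S \<inter> {1..n}) + card ({1..n} - S)"
      using card_Un_le by metis
    moreover have "card ({1..n} - S) \<le> c" unfolding c_def using assms by (intro card_mono) auto
    ultimately have "n \<le> card (S \<inter> {1..n}) + c" by simp
    then have "real n - real c \<le> real (card (S \<inter> {1..n}))" by linarith
    then show ?thesis by (intro divide_right_mono) auto
  qed
  have upper: "real (card (S \<inter> {1..n})) / real n \<le> 1" for n :: nat
  proof -
    have "card (S \<inter> {1..n}) \<le> card {1..n}" by (intro card_mono) auto
    then show ?thesis by (simp add: divide_le_eq)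
  qed
  have "(\<lambda>n. (real n - real c) / real n) \<longlonglongrightarrow> 1"
  proof -
    have "(\<lambda>n. 1 - real c * inverse (real n)) \<longlonglongrightarrow> 1 - real c * 0"
      by (intro tendsto_intros LIMSEQ_inverse_real_of_nat[THEN LIMSEQ_imp_Suc])
    moreover have "eventually (\<lambda>n. 1 - real c * inverse (real n) = (real n - real c) / real n) sequentially"
      using eventually_gt_at_top[of 0] by eventually_elim (simp add: field_simps)
    ultimately show ?thesis by (simp add: tendsto_cong)
  qed
  then have "(\<lambda>n. real (card (S \<inter> {1..n})) / real n) \<longlonglongrightarrow> 1"
    by (rule tendsto_sandwich[OF always_eventually always_eventually _ tendsto_const, rotated 2])
       (use lower upper in auto)
  then have "(\<lambda>n. ereal (real (card (S \<inter> {1..n})) / real n)) \<longlonglongrightarrow> ereal 1"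
    by (rule tendsto_ereal)
  then show ?thesis unfolding upper_density_def one_ereal_def
    by (intro lim_imp_Limsup) auto
qed

lemma almost_all_degrees:
  assumes k: "k \<ge> 1"
  shows "\<exists>d0. \<forall>d\<ge>d0. d \<in> S_A1 k"
proof -
  define bf :: "rat fps" where "bf = fps_const 16 * fps_X ^ (2^k)"
  obtain xf where xf: "xf 0 = 0"
    "\<And>j. 1 \<le> j \<Longrightarrow> j \<le> k \<Longrightarrow> \<exists>u. fps_nth u 0 = 1 \<and> xf j = fps_const 4 * fps_X ^ (2^(k - j)) * u"
    "\<And>j. j < k \<Longrightarrow> ((xf (Suc j))^2 - bf)^2 = 4 * (xf (Suc j) * (xf (Suc j) + 1) * (xf (Suc j) + bf)) * xf j"
    unfolding bf_def using halving_chain by metis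
  have xn: "fps_nth (xf j) n = 0" "fps_nth (xf j) (2^(k - j)) = 4" if jn: "1 \<le> j" "j \<le> k" "n < 2^(k - j)" for j n
  proof -
    obtain u where u: "fps_nth u 0 = 1" "xf j = fps_const 4 * fps_X ^ (2^(k - j)) * u" using xf(2) jn by blast
    have "fps_nth (fps_X ^ (2^(k - j)) * u) i = (if i < 2^(k - j) then 0 else fps_nth u (i - 2^(k - j)))" for i
      by (rule fps_X_power_mult_nth)
    then show "fps_nth (xf j) n = 0" "fps_nth (xf j) (2^(k - j)) = 4" using jn u by (simp_all add: mult.assoc)
  qed
  have x0: "fps_nth (xf j) 0 = 0" if "j \<le> k" for j
    using xf(1) xn(1)[of j 0] that by (cases j) auto
  have bn: "fps_nth bf n = (if n = 2^k then 16 else 0)" for n by (simp add: bf_def fps_X_power_nth)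
  define \<xi> where "\<xi> = (\<lambda>j. fps_to_fls (xf j))"
  define \<beta> where "\<beta> = fps_to_fls bf"
  have \<xi>_rel: "((\<xi> (Suc j))^2 - \<beta>)^2 = 4 * (\<xi> (Suc j) * (\<xi> (Suc j) + 1) * (\<xi> (Suc j) + \<beta>)) * \<xi> j" if "j < k" for j
    using arg_cong[OF xf(3)[OF that], of fps_to_fls]
    by (simp add: \<xi>_def \<beta>_def fls_times_fps_to_fls fps_to_fls_power)
  have \<xi>_0: "\<xi> 0 = 0" by (simp add: \<xi>_def xf(1))
  have \<beta>_t: "\<beta> \<in> tpoly"
  proof -
    have "\<beta> = fls_const 16 * fls_X ^ (2^k)" by (simp add: \<beta>_def bf_def fls_times_fps_to_fls fps_to_fls_power)
    then show ?thesis using tpoly_mult[OF tpoly_const[of 16] tpoly_X] by metis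
  qed
  have nz: "fps_to_fls f \<noteq> 0" if "fps_nth f n \<noteq> 0" for f :: "rat fps" and n
    using that by auto
  have \<beta>_nz: "\<beta> \<noteq> 0" unfolding \<beta>_def by (rule nz[of _ "2^k"]) (simp add: bn)
  have \<beta>_1: "\<beta> - 1 \<noteq> 0"
  proof -
    have "\<beta> - 1 = fps_to_fls (bf - 1)" by (simp add: \<beta>_def)
    then show ?thesis using nz[of "bf - 1" 0] bn[of 0] by simp
  qed
  have \<xi>_nz: "\<xi> j \<noteq> 0" if "1 \<le> j" "j \<le> k" for j
    unfolding \<xi>_def by (rule nz[of _ "2^(k - j)"]) (use xn(2)[of j 0] that in simp)
  have \<xi>_1: "\<xi> j + 1 \<noteq> 0" if "j \<le> k" for j
  proof -
    have "\<xi> j + 1 = fps_to_fls (xf j + 1)" by (simp add: \<xi>_def)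
    then show ?thesis using nz[of "xf j + 1" 0] x0[OF that] by simp
  qed
  have \<xi>_\<beta>: "\<xi> j + \<beta> \<noteq> 0" if "1 \<le> j" "j \<le> k" for j
  proof -
    have "(2::nat)^(k - j) \<noteq> 2^k" using that k by simp
    then have "fps_nth (xf j + bf) (2^(k - j)) = 4" using xn(2)[of j 0] bn[of "2^(k - j)"] that by simp
    then have "fps_to_fls (xf j + bf) \<noteq> 0" by (intro nz[of _ "2^(k - j)"]) simp
    then show ?thesis by (simp add: \<xi>_def \<beta>_def)
  qed
  have \<xi>_ne: "\<xi> i \<noteq> \<xi> j" if "i < j" "j \<le> k" for i j
  proof (cases "i = 0")
    case True
    then show ?thesis using \<xi>_0 \<xi>_nz[of j] that by simp
  next
    case False
    have "(2::nat)^(k - j) < 2^(k - i)" using that by simp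
    then have "fps_nth (xf i) (2^(k - j)) = 0" using xn(1)[of i "2^(k - j)"] False that by simp
    moreover have "fps_nth (xf j) (2^(k - j)) = 4" using xn(2)[of j 0] that by simp
    ultimately have "xf i \<noteq> xf j" by auto
    then show ?thesis by (simp add: \<xi>_def)
  qed
  define P where "P = fst (dup \<beta> k)"
  have P: "P \<in> TP" "P \<noteq> 0" using dup_TP[OF \<beta>_t, of k] dup_degree[of \<beta> k] by (auto simp: P_def)
  have "poly P (\<xi> k) = 0" using dup_eval[of k \<xi> \<beta> k, OF \<xi>_rel] \<xi>_0 by (simp add: P_def)
  moreover have "\<xi> k \<in> lo 0" by (auto simp: lo_def \<xi>_def)
  ultimately obtain d0 where d0: "\<And>d. d \<ge> d0 \<Longrightarrow> \<exists>R f x H. pole_relation R d f x H \<and>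
     \<xi> k \<in> pole_pair.Kf f x \<and> fls_X \<in> pole_pair.Kf f x"
    using specialise_algebraic P by blast
  have "d \<in> S_A1 k" if d: "d \<ge> d0 + 1" for d
  proof -
    obtain R f x H where rel: "pole_relation R d f x H" and Kf: "\<xi> k \<in> pole_pair.Kf f x" "fls_X \<in> pole_pair.Kf f x"
      using d0[of d] d by auto
    interpret pole_relation R d f x H by (rule rel)
    have constK: "fls_const q \<in> Kf" for q by (rule R_sub_Kf[OF R_const])
    have \<beta>_K: "\<beta> \<in> Kf" by (rule tpoly_Kf[OF Kf(2) \<beta>_t])
    have diffK: "u - w \<in> Kf" if "u \<in> Kf" "w \<in> Kf" for u w
      using Kf_add[OF that(1) Kf_mult[OF constK[of "-1"] that(2)]] by simp
    have oneK: "1 \<in> Kf" and fourK: "4 \<in> Kf" using constK[of 1] constK[of 4] by auto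
    have canc: "w = (q * w) * inverse q" if "q \<noteq> 0" for q w :: L
      using nonzero_mult_div_cancel_left[OF that, of w] by (simp only: divide_inverse)
    \<comment> \<open>Only \<open>\<xi> k\<close> and t are known to lie in the function field; the
      doubling relation yields the other abscissae one after another.\<close>
    have \<xi>_K: "\<xi> (k - i) \<in> Kf" if "i \<le> k" for i
      using that
    proof (induction i)
      case 0
      then show ?case using Kf by simp
    next
      case (Suc i)
      define j where "j = k - Suc i"
      have j: "k - i = Suc j" "j < k" using Suc.prems by (auto simp: j_def)
      let ?y = "\<xi> (Suc j)"
      have y: "?y \<in> Kf" using Suc j by simp
      have "4 * (?y * (?y + 1) * (?y + \<beta>)) \<noteq> 0"
        using \<xi>_nz[of "Suc j"] \<xi>_1[of "Suc j"] \<xi>_\<beta>[of "Suc j"] j by simp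
      then have "\<xi> j = (4 * (?y * (?y + 1) * (?y + \<beta>)) * \<xi> j) * inverse (4 * (?y * (?y + 1) * (?y + \<beta>)))"
        by (rule canc)
      also have "\<dots> = (?y^2 - \<beta>)^2 * inverse (4 * (?y * (?y + 1) * (?y + \<beta>)))"
        unfolding \<xi>_rel[OF j(2)] ..
      also have "\<dots> \<in> Kf"
        unfolding power2_eq_square by (intro Kf_mult Kf_inverse diffK Kf_add y \<beta>_K oneK fourK)
      finally show ?case by (simp add: j_def)
    qed
    have \<xi>_K': "\<xi> j \<in> Kf" if "j \<le> k" for j using \<xi>_K[of "k - j"] that by simp
    \<comment> \<open>All elements whose nonvanishing matters: for the curve, for the factors of the
      cubic at each abscissa, and for distinctness of the abscissae. Adjoining inverses keeps the
      nonzero ones nonzero, because \<open>\<phi>\<close> is multiplicative.\<close>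
    define S where "S = {\<beta>, \<beta> - 1} \<union> \<xi> ` {..k} \<union> (\<lambda>j. \<xi> j + 1) ` {..k} \<union> (\<lambda>j. \<xi> j + \<beta>) ` {..k} \<union>
      (\<lambda>(i, j). \<xi> i - \<xi> j) ` ({..k} \<times> {..k})"
    have "S \<subseteq> Kf" unfolding S_def using \<beta>_K oneK \<xi>_K' by (auto intro!: Kf_add diffK)
    then have sub: "S \<union> inverse ` S \<subseteq> Kf" using Kf_inverse by auto
    have fin: "finite (S \<union> inverse ` S)" by (simp add: S_def)
    obtain K v Bd and \<phi> :: "L \<Rightarrow> complex" where K: "number_field_of_degree K d" "dvf K v"
      and SB: "S \<union> inverse ` S \<subseteq> Bd"
      and hadd: "\<And>u w. u \<in> Bd \<Longrightarrow> w \<in> Bd \<Longrightarrow> u + w \<in> Bd \<and> \<phi> (u + w) = \<phi> u + \<phi> w"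
      and hmult: "\<And>u w. u \<in> Bd \<Longrightarrow> w \<in> Bd \<Longrightarrow> u * w \<in> Bd \<and> \<phi> (u * w) = \<phi> u * \<phi> w"
      and hconst: "\<And>q. fls_const q \<in> Bd \<and> \<phi> (fls_const q) = of_rat q" and hK: "\<And>u. u \<in> Bd \<Longrightarrow> \<phi> u \<in> K"
      by (rule specialisation_exists[OF fin sub]) (rule that; assumption)
    have h1: "1 \<in> Bd" "\<phi> 1 = 1" and h4: "4 \<in> Bd" "\<phi> 4 = 4" and h0: "\<phi> 0 = 0"
      using hconst[of 1] hconst[of 4] hconst[of 0] by auto
    have hdiff: "u - w \<in> Bd \<and> \<phi> (u - w) = \<phi> u - \<phi> w" if "u \<in> Bd" "w \<in> Bd" for u w
    proof -
      have "fls_const (-1) * w \<in> Bd \<and> \<phi> (fls_const (-1) * w) = - \<phi> w"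
        using hmult[of "fls_const (-1)" w] hconst[of "-1"] that by simp
      then show ?thesis using hadd[of u "fls_const (-1) * w"] that by simp
    qed
    have hnz: "\<phi> u \<noteq> 0" if "u \<in> S" "u \<noteq> 0" for u
    proof -
      have "u \<in> Bd" "inverse u \<in> Bd" using SB that by auto
      then have "\<phi> u * \<phi> (inverse u) = \<phi> (u * inverse u)" using hmult by metis
      also have "\<dots> = 1" using that h1 by simp
      finally show ?thesis by auto
    qed
    have \<beta>B: "\<beta> \<in> Bd" and \<xi>B: "\<And>j. j \<le> k \<Longrightarrow> \<xi> j \<in> Bd" using SB by (auto simp: S_def)
    have "halving_tower K v (\<phi> \<beta>) (\<lambda>j. \<phi> (\<xi> j)) k"
    proof (intro halving_tower.intro K halving_tower_axioms.intro)
      show "\<phi> \<beta> \<in> K" using hK \<beta>B by blast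
      show "\<phi> \<beta> \<noteq> 0" using hnz[of \<beta>] \<beta>_nz by (simp add: S_def)
      have "\<phi> (\<beta> - 1) \<noteq> 0" using hnz[of "\<beta> - 1"] \<beta>_1 by (simp add: S_def)
      then show "\<phi> \<beta> \<noteq> 1" using hdiff[OF \<beta>B h1(1)] h1 by simp
      show "\<phi> (\<xi> j) \<in> K" if "j \<le> k" for j using hK \<xi>B that by blast
      show "\<phi> (\<xi> 0) = 0" by (simp add: \<xi>_0 h0)
      show "inj_on (\<lambda>j. \<phi> (\<xi> j)) {..k}"
      proof (rule inj_onI, rule ccontr)
        fix i j assume ij: "i \<in> {..k}" "j \<in> {..k}" "\<phi> (\<xi> i) = \<phi> (\<xi> j)" "i \<noteq> j"
        have "\<xi> i - \<xi> j \<in> S" unfolding S_def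
          by (intro UnI2 image_eqI[of _ _ "(i, j)"]) (use ij in auto)
        moreover have "\<xi> i - \<xi> j \<noteq> 0" using \<xi>_ne[of i j] \<xi>_ne[of j i] ij by (cases "i < j") auto
        ultimately have "\<phi> (\<xi> i - \<xi> j) \<noteq> 0" by (rule hnz)
        then show False using hdiff[of "\<xi> i" "\<xi> j"] \<xi>B ij by simp
      qed
      show "\<phi> (\<xi> j) \<noteq> 0 \<and> \<phi> (\<xi> j) + 1 \<noteq> 0 \<and> \<phi> (\<xi> j) + \<phi> \<beta> \<noteq> 0" if j: "1 \<le> j" "j \<le> k" for j
      proof -
        have "\<xi> j \<in> S" "\<xi> j + 1 \<in> S" "\<xi> j + \<beta> \<in> S" using j by (auto simp: S_def)
        then have "\<phi> (\<xi> j) \<noteq> 0" "\<phi> (\<xi> j + 1) \<noteq> 0" "\<phi> (\<xi> j + \<beta>) \<noteq> 0"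
          using hnz \<xi>_nz[OF j] \<xi>_1[OF j(2)] \<xi>_\<beta>[OF j] by blast+
        then show ?thesis using hadd[OF \<xi>B[OF j(2)] h1(1)] hadd[OF \<xi>B[OF j(2)] \<beta>B] h1 by simp
      qed
      show "((\<phi> (\<xi> (Suc j)))^2 - \<phi> \<beta>)^2 =
          4 * (\<phi> (\<xi> (Suc j)) * (\<phi> (\<xi> (Suc j)) + 1) * (\<phi> (\<xi> (Suc j)) + \<phi> \<beta>)) * \<phi> (\<xi> j)" if j: "j < k" for j
      proof -
        let ?y = "\<xi> (Suc j)"
        have B: "?y \<in> Bd" "\<xi> j \<in> Bd" using \<xi>B j by auto
        have B2: "?y * ?y \<in> Bd" "\<phi> (?y * ?y) = \<phi> ?y * \<phi> ?y" using hmult B by auto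
        have B3: "?y * ?y - \<beta> \<in> Bd" "\<phi> (?y * ?y - \<beta>) = \<phi> ?y * \<phi> ?y - \<phi> \<beta>"
          using hdiff[OF B2(1) \<beta>B] B2 by auto
        have B4: "?y + 1 \<in> Bd" "\<phi> (?y + 1) = \<phi> ?y + 1" "?y + \<beta> \<in> Bd" "\<phi> (?y + \<beta>) = \<phi> ?y + \<phi> \<beta>"
          using hadd[OF B(1) h1(1)] hadd[OF B(1) \<beta>B] h1 by auto
        have B5: "?y * (?y + 1) \<in> Bd" "\<phi> (?y * (?y + 1)) = \<phi> ?y * (\<phi> ?y + 1)" using hmult[OF B(1) B4(1)] B4 by auto
        have B6: "?y * (?y + 1) * (?y + \<beta>) \<in> Bd" "\<phi> (?y * (?y + 1) * (?y + \<beta>)) = \<phi> ?y * (\<phi> ?y + 1) * (\<phi> ?y + \<phi> \<beta>)"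
          using hmult[OF B5(1) B4(3)] B4 B5 by auto
        have B7: "4 * (?y * (?y + 1) * (?y + \<beta>)) \<in> Bd"
           "\<phi> (4 * (?y * (?y + 1) * (?y + \<beta>))) = 4 * (\<phi> ?y * (\<phi> ?y + 1) * (\<phi> ?y + \<phi> \<beta>))"
          using hmult[OF h4(1) B6(1)] h4 B6 by auto
        have "\<phi> ((?y * ?y - \<beta>) * (?y * ?y - \<beta>)) = \<phi> (4 * (?y * (?y + 1) * (?y + \<beta>)) * \<xi> j)"
          using \<xi>_rel[OF j] by (simp only: power2_eq_square)
        then show ?thesis
          using hmult[OF B3(1) B3(1)] hmult[OF B7(1) B(2)] B3(2) B7(2) by (simp only: power2_eq_square)
      qed
      show "0 < k" using k by simp
    qed
    then show ?thesis using S_A1_member K(1) d by simp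
  qed
  then show ?thesis by blast
qed

theorem theorem1p6:
  shows "(\<forall>B::nat. B > 0 \<longrightarrow> finite ({0<..} - S_A1 B)) \<and>
         (\<exists>\<epsilon>::real. \<epsilon> > 0 \<and> (\<forall>B::nat. B > 0 \<longrightarrow> \<not> (upper_density (S_A1 B) \<le> ereal \<epsilon>)))"
proof -
  have fin: "finite ({0<..} - S_A1 B)" if "B > 0" for B :: nat
  proof -
    obtain d0 where d0: "\<And>d. d \<ge> d0 \<Longrightarrow> d \<in> S_A1 B" using almost_all_degrees[of B] \<open>B > 0\<close> by auto
    have "d < d0" if "d \<notin> S_A1 B" for d using d0[of d] that by (cases "d \<ge> d0") auto
    then have "{0<..} - S_A1 B \<subseteq> {..<d0}" by blast
    then show ?thesis by (rule finite_subset) simp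
  qed
  \<comment> \<open>The upper density is 1, so every bound below 1 fails; 1/2 is one choice.\<close>
  moreover have "\<not> (upper_density (S_A1 B) \<le> ereal (1/2))" if "B > 0" for B :: nat
    using upper_density_cofinite[OF fin[OF that]] by (simp add: one_ereal_def)
  ultimately show ?thesis by (intro conjI exI[of _ "1/2"]) simp_all
qed

end
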